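(* Consider the family of generalized switches operating under the MaxWeight scheduling algorithm, parametrized by $\epsilon\in(0,1)$, with mean arrival vector $\boldsymbol{\lambda}^{(\epsilon)}=(1-\epsilon)\boldsymbol{\nu}$ for a fixed vector $\boldsymbol{\nu}$ in the boundary of the capacity region $\mathcal{C}$ (all objects as defined in the context). Then there exist $\epsilon_0\in(0,1)$ and a constant $\beta$ independent of $\epsilon$ such that for every $\epsilon<\epsilon_0$ (with $\epsilon \in (0,1)$) and every vector $\boldsymbol{w}\in\bigcap_{\ell\in P}\mathcal{F}^{(\ell)}$, $$\left|\mathbb{E}\left[\langle\overline{\boldsymbol{q}}^{(\epsilon)},\boldsymbol{w}\rangle\right]-\frac{1}{2\epsilon}\boldsymbol{1}^T\left(H\circ\Sigma_a^{(\epsilon)}\right)\boldsymbol{1}-\frac{1}{2\epsilon}\boldsymbol{1}^T\left((C^TC)^{-1}\circ\Sigma_B\right)\boldsymbol{1}\right|\leq\beta\log\left(\frac{1}{\epsilon}\right),$$ where $H=C(C^TC)^{-1}C^T$ is the projection matrix onto $\mathcal{H}$ and $\circ$ denotes the Hadamard (entrywise) product.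
   Context: Generalized switch. There are $n$ queues in discrete time $k\in\mathbb{Z}_+$. $q_i(k)$ is the length of queue $i$, $a_i(k)$ the arrivals, $s_i(k)$ the potential service and $u_i(k)$ the unused service at queue $i$ in slot $k$; all are nonnegative integers (numbers of jobs). Boldface denotes the vector in $\mathbb{R}^n$; $\boldsymbol 1$ is the all-ones vector; $\langle\cdot,\cdot\rangle$ and $\|\cdot\|$ are the Euclidean inner product and norm. Arrivals: the vectors $\boldsymbol{a}(k)$ are i.i.d. over $k$, with mean $\boldsymbol{\lambda}=\mathbb{E}[\boldsymbol{a}(1)]$, covariance matrix $\Sigma_a$, and $a_i(1)\le A_{\max}$ with probability 1 for a finite constant $A_{\max}$. Services: channel states $\{M(k)\}$ are i.i.d. on a finite set $\mathcal{M}$, with $\psi_m=\mathbb{P}[M(1)=m]$. They are independent of the arrivals. In channel state $m$ the service vector must be chosen from a finite set $\mathcal{S}^{(m)}$ of feasible service rate vectors, which contains the projections on the coordinate axes of its elements. $S_{\max}$ is a finite constant with $s_i(1)\le S_{\max}$ with probability 1 for all $i$. Dynamics: in each slot the channel state is observed, a schedule is selected, arrivals occur, and jobs are then processed, so that $q_i(k+1)=q_i(k)+a_i(k)-s_i(k)+u_i(k)$ and $q_i(k+1)u_i(k)=0$ for all $i,k$, i.e. $u_i(k)=\max\{s_i(k)-q_i(k)-a_i(k),0\}$. MaxWeight: if $M(k)=m$, then $\boldsymbol{s}(k)\in\arg\max_{\boldsymbol{x}\in\mathcal{S}^{(m)}}\langle\boldsymbol{q}(k),\boldsymbol{x}\rangle$,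 with ties broken randomly. Capacity region: $\mathcal{C}=\sum_{m\in\mathcal{M}}\psi_m\,\mathrm{ConvexHull}(\mathcal{S}^{(m)})$. It is a coordinate convex polytope, written as $\mathcal{C}=\{\boldsymbol{x}\in\mathbb{R}^n_+:\langle\boldsymbol{c}^{(\ell)},\boldsymbol{x}\rangle\le b^{(\ell)},\ \ell=1,\dots,L\}$ with $\boldsymbol{c}^{(\ell)}\ge\boldsymbol{0}$, $\|\boldsymbol{c}^{(\ell)}\|=1$, $b^{(\ell)}>0$. The facets are $\mathcal{F}^{(\ell)}=\{\boldsymbol{x}\in\mathcal{C}:\langle\boldsymbol{c}^{(\ell)},\boldsymbol{x}\rangle=b^{(\ell)}\}$. Let $b^{(m,\ell)}=\max_{\boldsymbol{x}\in\mathcal{S}^{(m)}}\langle\boldsymbol{c}^{(\ell)},\boldsymbol{x}\rangle$. The random vector $(B_\ell)_{\ell\in[L]}$ equals $(b^{(m,\ell)})_{\ell\in[L]}$ with probability $\psi_m$, $m\in\mathcal{M}$. $\Sigma_B$ is its covariance matrix; in products with $(C^TC)^{-1}$ it is restricted to the index set $\tilde P$ defined below. Heavy traffic: fix $\boldsymbol{\nu}$ in the boundary of $\mathcal{C}$. The $\epsilon$-th system, $\epsilon\in(0,1)$, has $\mathbb{E}[\boldsymbol{a}^{(\epsilon)}(1)]=\boldsymbol{\lambda}^{(\epsilon)}=(1-\epsilon)\boldsymbol{\nu}$ and arrival covariance matrix $\Sigma_a^{(\epsilon)}$. The constants $A_{\max},S_{\max}$, the sets $\mathcal{S}^{(m)}$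 and the distribution of $M$ do not depend on $\epsilon$. For each $\epsilon\in(0,1)$ the queue length process is positive recurrent, and $\overline{\boldsymbol{q}}^{(\epsilon)}$ denotes its steady-state vector (the limit in distribution of $\boldsymbol{q}^{(\epsilon)}(k)$ as $k\to\infty$). Cone and subspace: $P=\{\ell\in[L]:\boldsymbol{\nu}\in\mathcal{F}^{(\ell)}\}$; $\mathcal{K}=\{\sum_{\ell\in P}\xi_\ell\boldsymbol{c}^{(\ell)}:\xi_\ell\ge0\}$; $\mathcal{H}$ is the affine hull (linear span) of $\mathcal{K}$. $\tilde P\subset P$ is a maximal set of indices such that $\{\boldsymbol{c}^{(\ell)}:\ell\in\tilde P\}$ is linearly independent, and $C=[\boldsymbol{c}^{(\ell)}]_{\ell\in\tilde P}$ is the matrix with these columns, so $\mathcal{H}$ is the column space of $C$.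
   Formalization: Added assumption: if ν_i = 0 (a queue without arrivals), then c^(ℓ)_i = 0 for every ℓ in P; automatic when ν > 0. Without it the claim fails, e.g. two queues with C = {x ≥ 0, x_1+x_2 ≤ 1}, ν = (1,0), a_2 = 0, started empty. *)

theory Defs
  imports "HOL-Probability.Probability"
begin

text \<open>Job counts are natural-number vectors; \<open>rvec\<close> embeds them into Euclidean space.\<close>

definition rvec :: "nat ^ 'n \<Rightarrow> real ^ 'n" where
  "rvec x = (\<chi> i. real (x $ i))"

text \<open>Truncated subtraction on \<open>nat\<close> amounts to \<open>max {s - q - a, 0}\<close>. In \<open>next_queue\<close> the
  unused service is added before the service is subtracted, so nothing is truncated there; see
  the two lemmas below.\<close>

definition unused :: "nat ^ 'n \<Rightarrow> nat ^ 'n \<Rightarrow> nat ^ 'n \<Rightarrow> nat ^ 'n" where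
  "unused q a s = (\<chi> i. s $ i - (q $ i + a $ i))"

definition next_queue :: "nat ^ 'n \<Rightarrow> nat ^ 'n \<Rightarrow> nat ^ 'n \<Rightarrow> nat ^ 'n" where
  "next_queue q a s = (\<chi> i. q $ i + a $ i + unused q a s $ i - s $ i)"

lemma rvec_next_queue:
  "rvec (next_queue q a s) = rvec q + rvec a - rvec s + rvec (unused q a s)"
  by (auto simp: vec_eq_iff rvec_def next_queue_def unused_def)

lemma next_queue_times_unused: "next_queue q a s $ i * unused q a s $ i = 0"
  by (auto simp: next_queue_def unused_def)

text \<open>A scheduling rule \<open>\<sigma>\<close> maps the queue lengths, the channel state and a random number (used to
  break ties) to a service vector. \<open>queue \<sigma> a m r x k\<close> is the vector of queue lengths in slot \<open>k\<close>
  when the initial state is \<open>x\<close> and \<open>a\<close>, \<open>m\<close>, \<open>r\<close> are the sequences of arrivals, channel states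
  and tie-breaking numbers.\<close>

primrec queue ::
  "(nat ^ 'n \<Rightarrow> 'm \<Rightarrow> real \<Rightarrow> nat ^ 'n) \<Rightarrow> (nat \<Rightarrow> nat ^ 'n) \<Rightarrow> (nat \<Rightarrow> 'm) \<Rightarrow> (nat \<Rightarrow> real)
    \<Rightarrow> nat ^ 'n \<Rightarrow> nat \<Rightarrow> nat ^ 'n" where
  "queue \<sigma> a m r x 0 = x"
| "queue \<sigma> a m r x (Suc k) =
     next_queue (queue \<sigma> a m r x k) (a k) (\<sigma> (queue \<sigma> a m r x k) (m k) (r k))"

text \<open>Every tie-breaking law is allowed: \<open>\<sigma> q m\<close>, applied to a random number, has an arbitrary
  distribution on the set of maximizers.\<close>

definition maxweight ::
  "('m \<Rightarrow> (nat ^ 'n) set) \<Rightarrow> (nat ^ 'n \<Rightarrow> 'm \<Rightarrow> real \<Rightarrow> nat ^ 'n) \<Rightarrow> bool" where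
  "maxweight S \<sigma> \<longleftrightarrow>
     (\<forall>q m. \<sigma> q m \<in> borel \<rightarrow>\<^sub>M count_space UNIV \<and>
        (\<forall>\<rho>. is_arg_max (\<lambda>x. rvec q \<bullet> rvec x) (\<lambda>x. x \<in> S m) (\<sigma> q m \<rho>)))"

definition covar :: "'w measure \<Rightarrow> ('w \<Rightarrow> real) \<Rightarrow> ('w \<Rightarrow> real) \<Rightarrow> real" where
  "covar M X Y =
     integral\<^sup>L M (\<lambda>\<omega>. (X \<omega> - integral\<^sup>L M X) * (Y \<omega> - integral\<^sup>L M Y))"

text \<open>The arrivals, channel states and tie-breaking numbers are each i.i.d. over the slots, mutually
  independent, and independent of the initial queue lengths \<open>x\<close>; \<open>\<psi>\<close> is the law of the channel
  state. Equivalently, the triples formed in each slot are i.i.d. with a product law. The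
  independence of \<open>x\<close> from all triples is expressed by a product law as well, since \<open>indep_var\<close>
  needs a common range type.\<close>

definition switch_inputs ::
  "'w measure \<Rightarrow> 'm pmf \<Rightarrow> (nat \<Rightarrow> 'w \<Rightarrow> nat ^ 'n) \<Rightarrow> (nat \<Rightarrow> 'w \<Rightarrow> 'm) \<Rightarrow> (nat \<Rightarrow> 'w \<Rightarrow> real)
    \<Rightarrow> ('w \<Rightarrow> nat ^ 'n) \<Rightarrow> bool" where
  "switch_inputs \<Omega> \<psi> a m r x \<longleftrightarrow>
     (let N = count_space UNIV \<Otimes>\<^sub>M (count_space UNIV \<Otimes>\<^sub>M borel);
          D = (\<lambda>k \<omega>. (a k \<omega>, m k \<omega>, r k \<omega>))
      in prob_space \<Omega> \<and>
         prob_space.indep_vars \<Omega> (\<lambda>_. N) D UNIV \<and>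
         (\<forall>k. distr \<Omega> N (D k) =
                distr \<Omega> (count_space UNIV) (a 1) \<Otimes>\<^sub>M
                  (measure_pmf \<psi> \<Otimes>\<^sub>M distr \<Omega> borel (r 1))) \<and>
         x \<in> \<Omega> \<rightarrow>\<^sub>M count_space UNIV \<and>
         distr \<Omega> (count_space UNIV \<Otimes>\<^sub>M PiM UNIV (\<lambda>_. N)) (\<lambda>\<omega>. (x \<omega>, \<lambda>k. D k \<omega>)) =
           distr \<Omega> (count_space UNIV) x \<Otimes>\<^sub>M distr \<Omega> (PiM UNIV (\<lambda>_. N)) (\<lambda>\<omega> k. D k \<omega>))"

text \<open>A state is positive recurrent if its expected return time is finite. (The infimum of the empty
  set of return times is infinite.) A queue length process is positive recurrent if it almost
  surely reaches the positive recurrent states; as the inputs need not make every vector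
  reachable, transient states cannot be excluded.\<close>

definition positive_recurrent_state ::
  "'w measure \<Rightarrow> (nat ^ 'n \<Rightarrow> 'm \<Rightarrow> real \<Rightarrow> nat ^ 'n) \<Rightarrow> (nat \<Rightarrow> 'w \<Rightarrow> nat ^ 'n)
    \<Rightarrow> (nat \<Rightarrow> 'w \<Rightarrow> 'm) \<Rightarrow> (nat \<Rightarrow> 'w \<Rightarrow> real) \<Rightarrow> nat ^ 'n \<Rightarrow> bool" where
  "positive_recurrent_state \<Omega> \<sigma> a m r y \<longleftrightarrow>
     (\<integral>\<^sup>+\<omega>. (INF k \<in> {k. 1 \<le> k \<and> queue \<sigma> (\<lambda>j. a j \<omega>) (\<lambda>j. m j \<omega>) (\<lambda>j. r j \<omega>) y k = y}.
              (of_nat k :: ennreal)) \<partial>\<Omega>) < \<infinity>"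

definition positive_recurrent ::
  "'w measure \<Rightarrow> (nat ^ 'n \<Rightarrow> 'm \<Rightarrow> real \<Rightarrow> nat ^ 'n) \<Rightarrow> (nat \<Rightarrow> 'w \<Rightarrow> nat ^ 'n)
    \<Rightarrow> (nat \<Rightarrow> 'w \<Rightarrow> 'm) \<Rightarrow> (nat \<Rightarrow> 'w \<Rightarrow> real) \<Rightarrow> ('w \<Rightarrow> nat ^ 'n) \<Rightarrow> bool" where
  "positive_recurrent \<Omega> \<sigma> a m r x \<longleftrightarrow>
     (AE \<omega> in \<Omega>. \<exists>k. positive_recurrent_state \<Omega> \<sigma> a m r
        (queue \<sigma> (\<lambda>j. a j \<omega>) (\<lambda>j. m j \<omega>) (\<lambda>j. r j \<omega>) (x \<omega>) k))"

text \<open>\<open>\<pi>\<close> is the law of the limit in distribution of the random vectors \<open>X k\<close>.\<close>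

definition converges_in_distribution ::
  "'w measure \<Rightarrow> (nat \<Rightarrow> 'w \<Rightarrow> nat ^ 'n) \<Rightarrow> (nat ^ 'n) pmf \<Rightarrow> bool" where
  "converges_in_distribution \<Omega> X \<pi> \<longleftrightarrow>
     (\<forall>g :: real ^ 'n \<Rightarrow> real. continuous_on UNIV g \<longrightarrow> bounded (range g) \<longrightarrow>
        (\<lambda>k. integral\<^sup>L \<Omega> (\<lambda>\<omega>. g (rvec (X k \<omega>))))
          \<longlonglongrightarrow> measure_pmf.expectation \<pi> (\<lambda>x. g (rvec x)))"

definition axis_projection :: "'n \<Rightarrow> nat ^ 'n \<Rightarrow> nat ^ 'n" where
  "axis_projection i x = (\<chi> j. if j = i then x $ i else 0)"

definition capacity_region :: "'m::finite pmf \<Rightarrow> ('m \<Rightarrow> (nat ^ 'n) set) \<Rightarrow> (real ^ 'n) set" where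
  "capacity_region \<psi> S =
     {\<Sum>m\<in>UNIV. pmf \<psi> m *\<^sub>R x m | x. \<forall>m. x m \<in> convex hull (rvec ` S m)}"

definition facet ::
  "(real ^ 'n) set \<Rightarrow> (nat \<Rightarrow> real ^ 'n) \<Rightarrow> (nat \<Rightarrow> real) \<Rightarrow> nat \<Rightarrow> (real ^ 'n) set" where
  "facet CR c b l = {x \<in> CR. c l \<bullet> x = b l}"

definition tight_facets ::
  "(real ^ 'n) set \<Rightarrow> nat \<Rightarrow> (nat \<Rightarrow> real ^ 'n) \<Rightarrow> (nat \<Rightarrow> real) \<Rightarrow> real ^ 'n \<Rightarrow> nat set" where
  "tight_facets CR L c b \<nu> = {l \<in> {1..L}. \<nu> \<in> facet CR c b l}"

text \<open>A queue without arrivals must not occur in a constraint that is tight at \<open>\<nu>\<close>; this holds in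
  particular if all coordinates of \<open>\<nu>\<close> are positive. Otherwise state space collapse fails: take two
  queues, one channel state, service vectors \<open>(0,0)\<close>, \<open>(1,0)\<close>, \<open>(0,1)\<close> and \<open>\<nu> = (1,0)\<close>. Started
  empty, the second queue stays empty and the first one is a single-server queue with
  \<open>\<epsilon> E q\<^sub>1 \<rightarrow> \<sigma>\<^sup>2 / 2\<close>, whereas the projection onto the span of \<open>(1,1)\<close> would give \<open>\<sigma>\<^sup>2 / 4\<close>.\<close>

definition idle_queues_not_tight ::
  "(real ^ 'n) set \<Rightarrow> nat \<Rightarrow> (nat \<Rightarrow> real ^ 'n) \<Rightarrow> (nat \<Rightarrow> real) \<Rightarrow> real ^ 'n \<Rightarrow> bool" where
  "idle_queues_not_tight CR L c b \<nu> \<longleftrightarrow>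
     (\<forall>i. \<nu> $ i = 0 \<longrightarrow> (\<forall>l \<in> tight_facets CR L c b \<nu>. c l $ i = 0))"

text \<open>\<open>max_rate S c m l\<close> is the value at channel state \<open>m\<close> of the \<open>l\<close>-th component of the random
  vector \<open>B\<close>.\<close>

definition max_rate ::
  "('m \<Rightarrow> (nat ^ 'n) set) \<Rightarrow> (nat \<Rightarrow> real ^ 'n) \<Rightarrow> 'm \<Rightarrow> nat \<Rightarrow> real" where
  "max_rate S c m l = Max ((\<lambda>x. c l \<bullet> rvec x) ` S m)"

text \<open>The columns of the matrix \<open>C\<close> are indexed by a set of facets, which may even be empty, and not
  by a type. Matrices are therefore functions of two indices, with the index sets passed to
  the operations.\<close>

definition maximal_independent :: "('l \<Rightarrow> 'v::real_vector) \<Rightarrow> 'l set \<Rightarrow> 'l set \<Rightarrow> bool" where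
  "maximal_independent c P J \<longleftrightarrow>
     J \<subseteq> P \<and> inj_on c J \<and> independent (c ` J) \<and>
     (\<forall>J'. J \<subseteq> J' \<longrightarrow> J' \<subseteq> P \<longrightarrow> inj_on c J' \<longrightarrow> independent (c ` J') \<longrightarrow> J' = J)"

definition col_matrix :: "('l \<Rightarrow> real ^ 'n) \<Rightarrow> 'n \<Rightarrow> 'l \<Rightarrow> real" where
  "col_matrix c i l = c l $ i"

definition transp :: "('i \<Rightarrow> 'j \<Rightarrow> real) \<Rightarrow> 'j \<Rightarrow> 'i \<Rightarrow> real" where
  "transp A j i = A i j"

definition mult_on :: "'j set \<Rightarrow> ('i \<Rightarrow> 'j \<Rightarrow> real) \<Rightarrow> ('j \<Rightarrow> 'k \<Rightarrow> real) \<Rightarrow> 'i \<Rightarrow> 'k \<Rightarrow> real" where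
  "mult_on J A B i k = (\<Sum>j\<in>J. A i j * B j k)"

definition inverse_on :: "'j set \<Rightarrow> ('j \<Rightarrow> 'j \<Rightarrow> real) \<Rightarrow> 'j \<Rightarrow> 'j \<Rightarrow> real" where
  "inverse_on J A = (SOME B. \<forall>i\<in>J. \<forall>k\<in>J.
     mult_on J A B i k = (if i = k then 1 else 0) \<and>
     mult_on J B A i k = (if i = k then 1 else 0))"

definition hadamard :: "('i \<Rightarrow> 'j \<Rightarrow> real) \<Rightarrow> ('i \<Rightarrow> 'j \<Rightarrow> real) \<Rightarrow> 'i \<Rightarrow> 'j \<Rightarrow> real" where
  "hadamard A B i j = A i j * B i j"

text \<open>\<open>ones_form J A\<close> is the quadratic form of \<open>A\<close> at the all-ones vector.\<close>

definition ones_form :: "'j set \<Rightarrow> ('j \<Rightarrow> 'j \<Rightarrow> real) \<Rightarrow> real" where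
  "ones_form J A = (\<Sum>i\<in>J. \<Sum>j\<in>J. A i j)"

definition gram_inverse :: "'l set \<Rightarrow> ('l \<Rightarrow> real ^ 'n) \<Rightarrow> 'l \<Rightarrow> 'l \<Rightarrow> real" where
  "gram_inverse J c = inverse_on J (mult_on UNIV (transp (col_matrix c)) (col_matrix c))"

definition projection_matrix :: "'l set \<Rightarrow> ('l \<Rightarrow> real ^ 'n) \<Rightarrow> 'n \<Rightarrow> 'n \<Rightarrow> real" where
  "projection_matrix J c =
     mult_on J (mult_on J (col_matrix c) (gram_inverse J c)) (transp (col_matrix c))"

end

theory Submission
  imports Defs
begin

text \<open>Let \<open>q\<close> be the queue vector in steady state, \<open>q'\<close> its value one slot later and \<open>p\<close> the
  orthogonal projection onto the span of the normals \<open>c l\<close>, \<open>l \<in> P\<close>, of the facets that are tight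
  at \<open>\<nu>\<close>. In steady state the squared length of \<open>p q\<close> does not change on average, and this balance
  is the theorem. Split \<open>\<nu>\<close> into channel-wise rates, \<open>\<nu> = (\<Sum>m. \<psi> m * \<nu>_part m)\<close> with \<open>\<nu>_part m\<close>
  in the convex hull of \<open>S m\<close>. Tightness of \<open>l\<close> forces \<open>c l \<bullet> \<nu>_part m\<close> to be the maximal rate
  \<open>B\<close> in direction \<open>c l\<close> at channel state \<open>m\<close>. Call a slot good if for every tight \<open>l\<close> the offered
  service \<open>s\<close> attains this maximum and the unused service \<open>u\<close> is orthogonal to \<open>c l\<close>. Then \<open>s\<close> and
  \<open>\<nu>_part m\<close> have the same projection, \<open>p u = 0\<close>, and the change is exactly
  \<open>2 * (p q \<bullet> (a - \<nu>_part m)) + (norm (p (a - \<nu>_part m)))\<^sup>2\<close>. Arrivals and channel are independent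
  of \<open>q\<close>, so its mean is \<open>- 2 * \<epsilon> * E (p q \<bullet> \<nu>)\<close> plus the sum of the two Hadamard forms, up to
  \<open>O(\<epsilon>\<^sup>2)\<close>. Solving for \<open>E (p q \<bullet> \<nu>)\<close> gives the claim: for \<open>w\<close> on all tight facets \<open>p q \<bullet> w = p q \<bullet> \<nu>\<close>,
  and \<open>q \<bullet> w\<close> differs from this by \<open>(q - p q) \<bullet> w\<close>.

  What remains is to show that bad slots and the part of \<open>q\<close> outside the span are harmless.

  State space collapse (\<open>cone_dist_drift\<close>, \<open>exp_cone_dist_bound\<close>): the distance of \<open>q\<close> to the cone
  generated by the tight normals has a negative drift as soon as it is large, because \<open>\<nu>\<close> can be
  moved inside the capacity region by a fixed amount in the direction from the cone towards \<open>q\<close>,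
  and MaxWeight serves at least as much weight as any point of the region. Since the increments
  are bounded, an exponential moment of the distance is bounded uniformly in \<open>\<epsilon>\<close>.

  Bad slots are rare (\<open>expected_loss\<close>, \<open>expected_bad_prob\<close>): stationarity of \<open>c l \<bullet> q\<close> says that the
  mean of \<open>B - c l \<bullet> s + c l \<bullet> u\<close> is \<open>\<epsilon> * b l\<close>. Both \<open>B - c l \<bullet> s\<close> and \<open>c l \<bullet> u\<close> are nonnegative
  and cannot be arbitrarily small without vanishing, so a slot is bad with probability \<open>O(\<epsilon>)\<close>.

  On a bad slot the balance is off by at most a constant times one plus the distance to the cone
  (\<open>step_close_to_ideal\<close>); here MaxWeight is used a second time. Cutting the distance at the level
  \<open>ln (1 / \<epsilon>) / \<theta>\<close>, above which the exponential moment takes over, bounds the total error by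
  \<open>O(\<epsilon> * ln (1 / \<epsilon>))\<close> (\<open>cone_dist_times_bad\<close>), and division by \<open>2 * \<epsilon>\<close> yields the logarithm.

  These arguments need only a law that is invariant under the one-slot transition. That the limit
  in distribution is invariant follows from the Markov property of the queue lengths
  (\<open>markov_property\<close>, \<open>stationary_of_limit\<close>), since every bounded function on the integer lattice
  is the restriction of a bounded continuous function.\<close>

section \<open>Orthogonal projection through a Gram matrix\<close>

lemma gram_entry: "mult_on UNIV (transp (col_matrix c)) (col_matrix c) l l' = c l \<bullet> c l'"
  by (simp add: mult_on_def transp_def col_matrix_def inner_vec_def)

text \<open>Normalise the component of \<open>c l\<close> orthogonal to the span of the other vectors. The dual basis
  yields the inverse of the Gram matrix below.\<close>

lemma dual_basis_exists:
  fixes c :: "'l \<Rightarrow> 'v::euclidean_space"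
  assumes inj: "inj_on c J" and indep: "independent (c ` J)" and l: "l \<in> J"
  obtains d where "d \<in> span (c ` J)" "\<And>k. k \<in> J \<Longrightarrow> d \<bullet> c k = (if k = l then 1 else 0)"
proof -
  let ?R = "c ` (J - {l})"
  have R: "?R = c ` J - {c l}" using inj l by (auto simp: inj_on_def)
  have notin: "c l \<notin> span ?R"
    using indep l unfolding R dependent_def by auto
  obtain y z where yz: "y \<in> span ?R" "\<And>w. w \<in> span ?R \<Longrightarrow> orthogonal z w" "c l = y + z"
    using orthogonal_subspace_decomp_exists[of ?R "c l"] by metis
  have z0: "z \<noteq> 0" using notin yz by auto
  have zl: "z \<bullet> c l = z \<bullet> z"
    using yz(2)[OF yz(1)] yz(3) by (simp add: orthogonal_def inner_add_right)
  have "z = c l - y" using yz(3) by simp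
  moreover have "span ?R \<subseteq> span (c ` J)" by (intro span_mono) auto
  ultimately have zs: "z \<in> span (c ` J)" using yz(1) l by (metis imageI span_base span_diff subsetD)
  show thesis
  proof (rule that[of "z /\<^sub>R (z \<bullet> z)"])
    show "z /\<^sub>R (z \<bullet> z) \<in> span (c ` J)" using zs by (rule span_mul)
    fix k assume "k \<in> J"
    show "(z /\<^sub>R (z \<bullet> z)) \<bullet> c k = (if k = l then 1 else 0)"
    proof (cases "k = l")
      case True then show ?thesis using zl z0 by simp
    next
      case False
      then have "c k \<in> span ?R" using \<open>k \<in> J\<close> by (auto intro: span_base)
      then show ?thesis using yz(2) False by (auto simp: orthogonal_def)
    qed
  qed
qed

text \<open>The choice in \<open>inverse_on\<close> is legitimate: the coefficients of the dual basis with respect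
  to \<open>c\<close> form a left inverse of the Gram matrix, and by symmetry also a right inverse.\<close>

lemma gram_inverse_left_right:
  fixes c :: "'l \<Rightarrow> real ^ 'n"
  assumes fin: "finite J" and inj: "inj_on c J" and indep: "independent (c ` J)"
    and ik: "i \<in> J" "k \<in> J"
  shows "(\<Sum>j\<in>J. (c i \<bullet> c j) * gram_inverse J c j k) = (if i = k then 1 else 0)"
    and "(\<Sum>j\<in>J. gram_inverse J c i j * (c j \<bullet> c k)) = (if i = k then 1 else 0)"
proof -
  let ?G = "mult_on UNIV (transp (col_matrix c)) (col_matrix c)"
  have "\<forall>l\<in>J. \<exists>d. d \<in> span (c ` J) \<and> (\<forall>k\<in>J. d \<bullet> c k = (if k = l then 1 else 0))"
    using dual_basis_exists[OF inj indep] by metis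
  then obtain d where d0: "\<forall>l\<in>J. d l \<in> span (c ` J) \<and> (\<forall>k\<in>J. d l \<bullet> c k = (if k = l then 1 else 0))"
    by (rule bchoice[THEN exE])
  then have d: "\<And>l. l \<in> J \<Longrightarrow> d l \<in> span (c ` J)"
    "\<And>l k. l \<in> J \<Longrightarrow> k \<in> J \<Longrightarrow> d l \<bullet> c k = (if k = l then 1 else 0)"
    by auto
  have "\<forall>l\<in>J. \<exists>g. d l = (\<Sum>j\<in>J. g j *\<^sub>R c j)"
  proof
    fix l assume "l \<in> J"
    then have "d l \<in> range (\<lambda>u. \<Sum>v\<in>c ` J. u v *\<^sub>R v)"
      using d(1) fin by (simp add: span_finite)
    then obtain u where "d l = (\<Sum>v\<in>c ` J. u v *\<^sub>R v)" by auto
    then have "d l = (\<Sum>j\<in>J. u (c j) *\<^sub>R c j)" by (simp add: sum.reindex[OF inj])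
    then show "\<exists>g. d l = (\<Sum>j\<in>J. g j *\<^sub>R c j)" by (rule exI[of _ "\<lambda>j. u (c j)"])
  qed
  then obtain B where B: "\<And>l. l \<in> J \<Longrightarrow> d l = (\<Sum>j\<in>J. B l j *\<^sub>R c j)" by metis
  \<comment> \<open>The coordinates of the dual basis are its own Gram matrix, so they are symmetric.\<close>
  have Bd: "B l k = d l \<bullet> d k" if "l \<in> J" "k \<in> J" for l k
  proof -
    have "d l \<bullet> d k = (\<Sum>j\<in>J. B l j * (c j \<bullet> d k))"
      by (subst B[OF that(1)]) (simp add: inner_sum_left)
    also have "\<dots> = (\<Sum>j\<in>J. if j = k then B l j else 0)"
      using d(2)[OF that(2)] by (intro sum.cong) (auto simp: inner_commute)
    finally show ?thesis using fin that by simp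
  qed
  have left: "mult_on J B ?G i k = (if i = k then 1 else 0)" if "i \<in> J" "k \<in> J" for i k
  proof -
    have "mult_on J B ?G i k = d i \<bullet> c k"
      by (subst B[OF that(1)]) (simp add: mult_on_def[of J] gram_entry inner_sum_left)
    then show ?thesis using d(2) that by auto
  qed
  have right: "mult_on J ?G B i k = (if i = k then 1 else 0)" if "i \<in> J" "k \<in> J" for i k
  proof -
    have "mult_on J ?G B i k = mult_on J B ?G k i"
      unfolding mult_on_def[of J] using that
      by (intro sum.cong) (auto simp: gram_entry Bd inner_commute)
    then show ?thesis using left that by auto
  qed
  have "\<forall>i\<in>J. \<forall>k\<in>J.
     mult_on J ?G (gram_inverse J c) i k = (if i = k then 1 else 0) \<and>
     mult_on J (gram_inverse J c) ?G i k = (if i = k then 1 else 0)"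
    unfolding gram_inverse_def inverse_on_def
    by (rule someI[of _ B]) (use left right in auto)
  then show "(\<Sum>j\<in>J. (c i \<bullet> c j) * gram_inverse J c j k) = (if i = k then 1 else 0)"
    and "(\<Sum>j\<in>J. gram_inverse J c i j * (c j \<bullet> c k)) = (if i = k then 1 else 0)"
    using ik by (auto simp: mult_on_def[of J] gram_entry)
qed

text \<open>The linear map with matrix \<open>C (C\<^sup>T C)\<^sup>-\<^sup>1 C\<^sup>T\<close>, written out so that both forms of the claim can be
  read off from its squared norm: the one indexed by facets in \<open>norm_gram_projection_sq\<close>, the one
  indexed by queues in \<open>norm_gram_projection_sq_coordinates\<close>.\<close>

definition gram_projection :: "'l set \<Rightarrow> ('l \<Rightarrow> real ^ 'n) \<Rightarrow> real ^ 'n \<Rightarrow> real ^ 'n" where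
  "gram_projection J c x = (\<Sum>l\<in>J. (\<Sum>l'\<in>J. gram_inverse J c l l' * (c l' \<bullet> x)) *\<^sub>R c l)"

lemma linear_gram_projection: "linear (gram_projection J c)"
  unfolding gram_projection_def
  by (rule linearI)
     (simp_all add: inner_add_right distrib_left sum.distrib scaleR_left_distrib
       scaleR_sum_right, simp add: sum_distrib_left mult.left_commute)

lemma gram_projection_in_span: "gram_projection J c x \<in> span (c ` J)"
  unfolding gram_projection_def by (intro span_sum span_mul span_base) auto

lemma inner_gram_projection_generator:
  fixes c :: "'l \<Rightarrow> real ^ 'n"
  assumes fin: "finite J" and inj: "inj_on c J" and indep: "independent (c ` J)" and l: "l \<in> J"
  shows "c l \<bullet> gram_projection J c x = c l \<bullet> x"
proof -
  have "c l \<bullet> gram_projection J c x =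
      (\<Sum>j\<in>J. \<Sum>k\<in>J. (c l \<bullet> c j) * gram_inverse J c j k * (c k \<bullet> x))"
    by (simp add: gram_projection_def inner_sum_right sum_distrib_left mult_ac)
  also have "\<dots> = (\<Sum>k\<in>J. (\<Sum>j\<in>J. (c l \<bullet> c j) * gram_inverse J c j k) * (c k \<bullet> x))"
    by (subst sum.swap) (simp add: sum_distrib_right)
  also have "\<dots> = (\<Sum>k\<in>J. if k = l then c k \<bullet> x else 0)"
    using gram_inverse_left_right(1)[OF fin inj indep l] by (intro sum.cong) auto
  finally show ?thesis using fin l by simp
qed

lemma inner_gram_projection_span:
  fixes c :: "'l \<Rightarrow> real ^ 'n"
  assumes fin: "finite J" and inj: "inj_on c J" and indep: "independent (c ` J)"
    and y: "y \<in> span (c ` J)"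
  shows "y \<bullet> gram_projection J c x = y \<bullet> x"
proof -
  have "span (c ` J) \<subseteq> {y. y \<bullet> (gram_projection J c x - x) = 0}"
    using inner_gram_projection_generator[OF fin inj indep]
    by (intro span_minimal) (auto intro!: subspaceI simp: inner_add_left inner_diff_right)
  then have "y \<bullet> (gram_projection J c x - x) = 0" using y by auto
  then show ?thesis by (simp add: inner_diff_right)
qed

lemma norm_gram_projection_sq:
  fixes c :: "'l \<Rightarrow> real ^ 'n"
  assumes "finite J" "inj_on c J" "independent (c ` J)"
  shows "(norm (gram_projection J c x))\<^sup>2 =
    (\<Sum>l\<in>J. \<Sum>l'\<in>J. gram_inverse J c l l' * ((c l \<bullet> x) * (c l' \<bullet> x)))"
proof -
  have "(norm (gram_projection J c x))\<^sup>2 = gram_projection J c x \<bullet> x"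
    unfolding power2_norm_eq_inner
    by (rule inner_gram_projection_span[OF assms gram_projection_in_span])
  also have "\<dots> = (\<Sum>l\<in>J. \<Sum>l'\<in>J. gram_inverse J c l l' * ((c l \<bullet> x) * (c l' \<bullet> x)))"
    by (simp add: gram_projection_def inner_sum_left sum_distrib_right sum_distrib_left mult_ac)
  finally show ?thesis .
qed

lemma norm_gram_projection_sq_coordinates:
  fixes c :: "'l \<Rightarrow> real ^ 'n"
  assumes "finite J" "inj_on c J" "independent (c ` J)"
  shows "(norm (gram_projection J c x))\<^sup>2 =
    (\<Sum>i\<in>UNIV. \<Sum>j\<in>UNIV. projection_matrix J c i j * (x $ i * x $ j))"
proof -
  let ?B = "gram_inverse J c"
  have "(norm (gram_projection J c x))\<^sup>2 =
    (\<Sum>l\<in>J. \<Sum>l'\<in>J. \<Sum>i\<in>UNIV. \<Sum>j\<in>UNIV. ?B l l' * ((c l $ i * x $ i) * (c l' $ j * x $ j)))"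
    unfolding norm_gram_projection_sq[OF assms] inner_vec_def inner_real_def sum_product
    by (intro sum.cong refl) (simp only: sum_distrib_left)
  also have "\<dots> = (\<Sum>i\<in>UNIV. \<Sum>j\<in>UNIV. \<Sum>l'\<in>J. \<Sum>l\<in>J. ?B l l' * ((c l $ i * x $ i) * (c l' $ j * x $ j)))"
  proof -
    have "(\<Sum>l\<in>J. \<Sum>l'\<in>J. \<Sum>i\<in>UNIV. \<Sum>j\<in>UNIV. F l l' i j) =
        (\<Sum>i\<in>UNIV. \<Sum>j\<in>UNIV. \<Sum>l'\<in>J. \<Sum>l\<in>J. F l l' i j)" for F :: "'l \<Rightarrow> 'l \<Rightarrow> 'n \<Rightarrow> 'n \<Rightarrow> real"
    proof -
      have "(\<Sum>l\<in>J. \<Sum>l'\<in>J. \<Sum>i\<in>UNIV. \<Sum>j\<in>UNIV. F l l' i j) =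
          (\<Sum>(l, l', i, j)\<in>J \<times> J \<times> UNIV \<times> UNIV. F l l' i j)"
        by (simp only: sum.cartesian_product split_def)
      also have "\<dots> = (\<Sum>(i, j, l', l)\<in>UNIV \<times> UNIV \<times> J \<times> J. F l l' i j)"
        by (rule sum.reindex_bij_witness[where i = "\<lambda>(i, j, l', l). (l, l', i, j)"
              and j = "\<lambda>(l, l', i, j). (i, j, l', l)"]) auto
      finally show ?thesis by (simp only: sum.cartesian_product split_def)
    qed
    then show ?thesis .
  qed
  also have "\<dots> = (\<Sum>i\<in>UNIV. \<Sum>j\<in>UNIV. projection_matrix J c i j * (x $ i * x $ j))"
    by (simp add: projection_matrix_def mult_on_def transp_def col_matrix_def
        sum_distrib_right sum_distrib_left mult_ac)
  finally show ?thesis .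
qed

lemma span_maximal_independent:
  fixes c :: "'l \<Rightarrow> 'v::real_vector"
  assumes "maximal_independent c P J"
  shows "span (c ` P) = span (c ` J)"
proof
  have J: "J \<subseteq> P" "inj_on c J" "independent (c ` J)"
    and max: "\<And>J'. J \<subseteq> J' \<Longrightarrow> J' \<subseteq> P \<Longrightarrow> inj_on c J' \<Longrightarrow> independent (c ` J') \<Longrightarrow> J' = J"
    using assms unfolding maximal_independent_def by blast+
  show "span (c ` J) \<subseteq> span (c ` P)" using J(1) by (intro span_mono) auto
  have "c l \<in> span (c ` J)" if l: "l \<in> P" for l
  proof (rule ccontr)
    assume n: "c l \<notin> span (c ` J)"
    then have cl: "c l \<notin> c ` J" using span_superset[of "c ` J"] by blast
    then have "inj_on c (insert l J)" using J(2) by (simp add: inj_on_insert) blast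
    moreover have "independent (c ` insert l J)"
      using n J(3) by (simp add: independent_insertI)
    ultimately have "insert l J = J" using max[of "insert l J"] l J(1) by auto
    then have "l \<in> J" by blast
    then show False using cl by blast
  qed
  then show "span (c ` P) \<subseteq> span (c ` J)" by (intro span_minimal) (auto intro: subspace_span)
qed

section \<open>Invariant laws of Markov chains\<close>

lemma integrable_pmf_bounded:
  fixes f :: "'a \<Rightarrow> real"
  assumes "\<And>x. \<bar>f x\<bar> \<le> B"
  shows "integrable (measure_pmf \<pi>) f"
  by (rule measure_pmf.integrable_const_bound[of _ B]) (use assms in auto)

text \<open>The nonnegative case is the iterated integral of a bind; the shift by \<open>B\<close> reduces to it.\<close>

lemma stationary_expectation:
  fixes f :: "'a \<Rightarrow> real"
  assumes st: "bind_pmf \<pi> K = \<pi>" and bd: "\<And>x. \<bar>f x\<bar> \<le> B"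
  shows "measure_pmf.expectation \<pi> (\<lambda>x. measure_pmf.expectation (K x) f) = measure_pmf.expectation \<pi> f"
proof -
  define g where "g x = f x + B" for x
  have g0: "0 \<le> g x" and g_bd: "\<bar>g x\<bar> \<le> 2 * B" for x using bd[of x] by (auto simp: g_def)
  have nn: "(\<integral>\<^sup>+y. ennreal (g y) \<partial>measure_pmf p) = ennreal (measure_pmf.expectation p g)" for p
    by (rule nn_integral_eq_integral) (auto intro: integrable_pmf_bounded g_bd simp: g0)
  have Eg0: "0 \<le> measure_pmf.expectation p g" for p by (simp add: g0)
  have Eg_bd: "\<bar>measure_pmf.expectation p g\<bar> \<le> 2 * B" for p :: "'a pmf"
  proof -
    have "measure_pmf.expectation p g \<le> measure_pmf.expectation p (\<lambda>_. 2 * B)"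
      using g_bd by (intro integral_mono integrable_pmf_bounded[OF g_bd])
        (auto intro: order_trans[OF abs_ge_self])
    then show ?thesis using Eg0[of p] by simp
  qed
  have "ennreal (measure_pmf.expectation \<pi> g) =
      (\<integral>\<^sup>+y. ennreal (g y) \<partial>measure_pmf (bind_pmf \<pi> K))" by (simp add: nn st)
  also have "\<dots> = (\<integral>\<^sup>+x. ennreal (measure_pmf.expectation (K x) g) \<partial>measure_pmf \<pi>)"
    by (subst nn_integral_bind_pmf) (simp add: nn)
  also have "\<dots> = ennreal (measure_pmf.expectation \<pi> (\<lambda>x. measure_pmf.expectation (K x) g))"
    by (rule nn_integral_eq_integral) (auto intro: integrable_pmf_bounded Eg_bd simp: Eg0)
  finally have eq: "measure_pmf.expectation \<pi> g = measure_pmf.expectation \<pi> (\<lambda>x. measure_pmf.expectation (K x) g)"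
    by (subst (asm) ennreal_inj) (auto simp: Eg0 g0 intro!: integral_nonneg_AE)
  have f_eq: "measure_pmf.expectation p f = measure_pmf.expectation p g - B" for p :: "'a pmf"
  proof -
    have "measure_pmf.expectation p g = measure_pmf.expectation p f + measure_pmf.expectation p (\<lambda>_. B)"
      unfolding g_def
      by (rule Bochner_Integration.integral_add) (auto intro: integrable_pmf_bounded bd)
    then show ?thesis by simp
  qed
  have "measure_pmf.expectation \<pi> (\<lambda>x. measure_pmf.expectation (K x) g - B) =
      measure_pmf.expectation \<pi> (\<lambda>x. measure_pmf.expectation (K x) g) - B"
    by (subst Bochner_Integration.integral_diff) (auto intro: integrable_pmf_bounded Eg_bd)
  then show ?thesis by (simp add: f_eq eq)
qed

lemma expectation_pmf_mono:
  fixes f g :: "'a \<Rightarrow> real"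
  assumes "finite (set_pmf p)" "\<And>x. x \<in> set_pmf p \<Longrightarrow> f x \<le> g x"
  shows "measure_pmf.expectation p f \<le> measure_pmf.expectation p g"
  by (rule integral_mono_AE)
     (use assms in \<open>auto intro: integrable_measure_pmf_finite simp: AE_measure_pmf_iff\<close>)

lemma expectation_abs_bound:
  fixes f :: "'a \<Rightarrow> real"
  assumes "finite (set_pmf p)" "\<And>x. x \<in> set_pmf p \<Longrightarrow> \<bar>f x\<bar> \<le> B"
  shows "\<bar>measure_pmf.expectation p f\<bar> \<le> B"
proof -
  have "measure_pmf.expectation p f \<le> measure_pmf.expectation p (\<lambda>_. B)"
    "measure_pmf.expectation p (\<lambda>_. - B) \<le> measure_pmf.expectation p f"
    by (rule expectation_pmf_mono; use assms in force)+
  then show ?thesis by simp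
qed

text \<open>The Foster--Lyapunov bound without assuming that \<open>V\<close> is integrable. The truncation \<open>min V n\<close>
  has zero mean drift. Where \<open>V \<le> n\<close> its drift is at most that of \<open>V\<close>, and elsewhere it is
  not positive; so the part of \<open>f\<close> on \<open>{V \<le> n}\<close> has mean at most \<open>C\<close>, and Fatou's lemma applies.\<close>

lemma foster_bound:
  fixes V f :: "'a \<Rightarrow> real"
  assumes st: "bind_pmf \<pi> K = \<pi>" and fin: "\<And>x. finite (set_pmf (K x))"
    and V: "\<And>x. 0 \<le> V x" and f: "\<And>x. 0 \<le> f x" and C: "0 \<le> C"
    and drift: "\<And>x. measure_pmf.expectation (K x) V \<le> V x - f x + C"
  shows "integrable (measure_pmf \<pi>) f" and "measure_pmf.expectation \<pi> f \<le> C"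
proof -
  \<comment> \<open>the part of \<open>f\<close> that the truncation at level \<open>n\<close> sees; it is bounded by the drift inequality\<close>
  define h where "h = (\<lambda>(n::nat) x. f x * indicator {x. V x \<le> real n} x)"
  have EV0: "0 \<le> measure_pmf.expectation (K x) V" for x
    using V by (intro integral_nonneg_AE) auto
  have h_bd: "\<bar>h n x\<bar> \<le> real n + C" for n x
    using drift[of x] EV0[of x] f[of x] C by (auto simp: h_def indicator_def)
  have h_le: "measure_pmf.expectation \<pi> (h n) \<le> C" for n
  proof -
    let ?W = "\<lambda>x. min (V x) (real n)"
    have Wbd: "\<bar>?W x\<bar> \<le> real n" for x using V[of x] by auto
    have EWbd: "\<bar>measure_pmf.expectation (K x) ?W\<bar> \<le> real n" for x
      by (rule expectation_abs_bound[OF fin]) (rule Wbd)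
    have le: "h n x - C \<le> ?W x - measure_pmf.expectation (K x) ?W" for x
    proof (cases "V x \<le> real n")
      case True
      have "measure_pmf.expectation (K x) ?W \<le> measure_pmf.expectation (K x) V"
        by (rule expectation_pmf_mono[OF fin]) auto
      then show ?thesis using drift[of x] True by (auto simp: h_def)
    next
      case False
      then show ?thesis using EWbd[of x] C by (auto simp: h_def)
    qed
    have "measure_pmf.expectation \<pi> (\<lambda>x. h n x - C) \<le>
        measure_pmf.expectation \<pi> (\<lambda>x. ?W x - measure_pmf.expectation (K x) ?W)"
    proof (rule integral_mono)
      show "integrable (measure_pmf \<pi>) (\<lambda>x. h n x - C)"
        using h_bd by (intro Bochner_Integration.integrable_diff integrable_pmf_bounded) auto
      show "integrable (measure_pmf \<pi>) (\<lambda>x. ?W x - measure_pmf.expectation (K x) ?W)"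
        using Wbd EWbd by (intro Bochner_Integration.integrable_diff integrable_pmf_bounded) auto
    qed (rule le)
    also have "\<dots> = measure_pmf.expectation \<pi> ?W
        - measure_pmf.expectation \<pi> (\<lambda>x. measure_pmf.expectation (K x) ?W)"
      by (rule Bochner_Integration.integral_diff) (rule integrable_pmf_bounded, rule Wbd EWbd)+
    also have "\<dots> = 0"
      using stationary_expectation[OF st, of ?W "real n"] Wbd by simp
    finally show ?thesis
      by (subst (asm) Bochner_Integration.integral_diff)
         (auto intro: integrable_pmf_bounded h_bd)
  qed
  have "(\<integral>\<^sup>+x. ennreal (f x) \<partial>measure_pmf \<pi>) = (\<integral>\<^sup>+x. liminf (\<lambda>n. ennreal (h n x)) \<partial>measure_pmf \<pi>)"
  proof (rule nn_integral_cong)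
    fix x
    obtain N :: nat where N: "V x \<le> real N" using real_arch_simple by blast
    have "eventually (\<lambda>n. ennreal (f x) = ennreal (h n x)) sequentially"
      using eventually_ge_at_top[of N]
      by eventually_elim (use N in \<open>auto simp: h_def indicator_def\<close>)
    then have "(\<lambda>n. ennreal (h n x)) \<longlonglongrightarrow> ennreal (f x)"
      using tendsto_cong by fastforce
    then show "ennreal (f x) = liminf (\<lambda>n. ennreal (h n x))"
      using lim_imp_Liminf[OF sequentially_bot] by metis
  qed
  also have "\<dots> \<le> liminf (\<lambda>n. \<integral>\<^sup>+x. ennreal (h n x) \<partial>measure_pmf \<pi>)"
    by (rule nn_integral_liminf) auto
  also have "\<dots> \<le> liminf (\<lambda>n::nat. ennreal C)"
  proof (intro Liminf_mono always_eventually allI)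
    fix n
    have "(\<integral>\<^sup>+x. ennreal (h n x) \<partial>measure_pmf \<pi>) = ennreal (measure_pmf.expectation \<pi> (h n))"
      by (rule nn_integral_eq_integral)
         (rule integrable_pmf_bounded, rule h_bd, simp add: h_def f)
    then show "(\<integral>\<^sup>+x. ennreal (h n x) \<partial>measure_pmf \<pi>) \<le> ennreal C"
      using h_le by (simp add: ennreal_leI)
  qed
  finally have nn: "(\<integral>\<^sup>+x. ennreal (f x) \<partial>measure_pmf \<pi>) \<le> ennreal C"
    by (simp add: Liminf_const)
  show int: "integrable (measure_pmf \<pi>) f"
    using nn by (intro integrableI_nonneg) (auto simp: f le_less_trans[OF _ ennreal_less_top])
  show "measure_pmf.expectation \<pi> f \<le> C"
    using nn nn_integral_eq_integral[OF int] f C by simp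
qed

text \<open>Again \<open>V\<close> itself need not be integrable, only its increments. Hence for a quadratic \<open>V\<close> first
  moments of the state suffice. Clamping \<open>V\<close> to \<open>{-n..n}\<close> does not enlarge increments, so dominated
  convergence passes to the limit.\<close>

lemma stationary_drift_zero:
  fixes V g :: "'a \<Rightarrow> real"
  assumes st: "bind_pmf \<pi> K = \<pi>" and fin: "\<And>x. finite (set_pmf (K x))"
    and g: "integrable (measure_pmf \<pi>) g"
    and jump: "\<And>x y. y \<in> set_pmf (K x) \<Longrightarrow> \<bar>V y - V x\<bar> \<le> g x"
  shows "measure_pmf.expectation \<pi> (\<lambda>x. measure_pmf.expectation (K x) (\<lambda>y. V y - V x)) = 0"
proof -
  define clamp where "clamp = (\<lambda>(n::nat) v. max (- real n) (min v (real n)))"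
  define D where "D = (\<lambda>n x. measure_pmf.expectation (K x) (\<lambda>y. clamp n (V y) - clamp n (V x)))"
  have cbd: "\<bar>clamp n v\<bar> \<le> real n" for n v by (auto simp: clamp_def)
  have clip: "\<bar>clamp n u - clamp n v\<bar> \<le> \<bar>u - v\<bar>" for n u v by (auto simp: clamp_def)
  have D0: "measure_pmf.expectation \<pi> (D n) = 0" for n
  proof -
    let ?W = "\<lambda>x. clamp n (V x)"
    have EWbd: "\<bar>measure_pmf.expectation (K x) ?W\<bar> \<le> real n" for x
      by (rule expectation_abs_bound[OF fin]) (rule cbd)
    have "D n x = measure_pmf.expectation (K x) ?W - ?W x" for x
      unfolding D_def
      by (subst Bochner_Integration.integral_diff) (auto intro: integrable_pmf_bounded cbd)
    then have "measure_pmf.expectation \<pi> (D n) =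
        measure_pmf.expectation \<pi> (\<lambda>x. measure_pmf.expectation (K x) ?W - ?W x)"
      by (intro Bochner_Integration.integral_cong) auto
    also have "\<dots> = measure_pmf.expectation \<pi> (\<lambda>x. measure_pmf.expectation (K x) ?W)
        - measure_pmf.expectation \<pi> ?W"
      by (rule Bochner_Integration.integral_diff) (rule integrable_pmf_bounded, rule cbd EWbd)+
    also have "\<dots> = 0"
      using stationary_expectation[OF st, of ?W "real n"] cbd by simp
    finally show ?thesis .
  qed
  have "(\<lambda>n. measure_pmf.expectation \<pi> (D n)) \<longlonglongrightarrow>
      measure_pmf.expectation \<pi> (\<lambda>x. measure_pmf.expectation (K x) (\<lambda>y. V y - V x))"
  proof (rule integral_dominated_convergence[OF _ _ g])
    show "AE x in measure_pmf \<pi>. (\<lambda>n. D n x) \<longlonglongrightarrow> measure_pmf.expectation (K x) (\<lambda>y. V y - V x)"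
    proof (rule AE_I2)
      fix x
      obtain B where B: "\<And>y. y \<in> V ` insert x (set_pmf (K x)) \<Longrightarrow> \<bar>y\<bar> \<le> B"
        using fin[of x] finite_imp_bounded[of "V ` insert x (set_pmf (K x))"]
        by (auto simp: bounded_iff)
      obtain N :: nat where N: "B \<le> real N" using real_arch_simple by blast
      have "eventually (\<lambda>n. D n x = measure_pmf.expectation (K x) (\<lambda>y. V y - V x)) sequentially"
        using eventually_ge_at_top[of N]
      proof eventually_elim
        fix n assume n: "N \<le> n"
        have id: "clamp n v = v" if "v \<in> V ` insert x (set_pmf (K x))" for v
        proof -
          have "B \<le> real n" using N n by (meson of_nat_le_iff order_trans)
          then have "\<bar>v\<bar> \<le> real n" using B[OF that] by linarith
          then show ?thesis by (auto simp: clamp_def)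
        qed
        show "D n x = measure_pmf.expectation (K x) (\<lambda>y. V y - V x)"
          unfolding D_def by (rule integral_cong_AE) (auto simp: AE_measure_pmf_iff id)
      qed
      then show "(\<lambda>n. D n x) \<longlonglongrightarrow> measure_pmf.expectation (K x) (\<lambda>y. V y - V x)"
        by (rule tendsto_eventually)
    qed
    show "AE x in measure_pmf \<pi>. norm (D n x) \<le> g x" for n
    proof (rule AE_I2)
      fix x
      show "norm (D n x) \<le> g x"
        unfolding D_def real_norm_def
        by (rule expectation_abs_bound[OF fin]) (rule order_trans[OF clip jump])
    qed
  qed auto
  then show ?thesis unfolding D0 by (simp add: LIMSEQ_const_iff)
qed

lemma exp_le_quadratic:
  fixes t :: real
  assumes "\<bar>t\<bar> \<le> 1"
  shows "exp t \<le> 1 + t + t\<^sup>2"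
proof (cases "0 \<le> t")
  case True then show ?thesis using exp_bound[of t] assms by simp
next
  case False
  define s where "s = - t"
  have s: "0 \<le> s" "s \<le> 1" using False assms by (auto simp: s_def)
  have "1 + s + s\<^sup>2 / 2 \<le> exp s" using exp_lower_Taylor_quadratic[OF s(1)] .
  moreover have "1 \<le> (1 + s + s\<^sup>2 / 2) * (1 - s + s\<^sup>2)"
  proof -
    have "(1 + s + s\<^sup>2 / 2) * (1 - s + s\<^sup>2) = 1 + (s\<^sup>2 / 2 + s ^ 3 / 2 + s ^ 4 / 2)"
      by (simp add: field_simps power2_eq_square power3_eq_cube power4_eq_xxxx)
    then show ?thesis using s by simp
  qed
  moreover have "0 \<le> 1 - s + s\<^sup>2" using s by (simp add: add_nonneg_nonneg)
  ultimately have "1 \<le> exp s * (1 - s + s\<^sup>2)"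
    by (meson mult_right_mono order_trans)
  then have "exp (- s) \<le> 1 - s + s\<^sup>2"
    by (simp add: exp_minus field_simps)
  then show ?thesis by (simp add: s_def)
qed

section \<open>Geometry of the capacity region\<close>

lemma finite_positive_lower_bound:
  fixes f :: "'a \<Rightarrow> real"
  assumes "finite A" "\<And>a. a \<in> A \<Longrightarrow> 0 < f a"
  obtains \<delta> where "0 < \<delta>" "\<And>a. a \<in> A \<Longrightarrow> \<delta> \<le> f a"
proof
  \<comment> \<open>the element \<open>1\<close> takes care of an empty \<open>A\<close>\<close>
  show "0 < Min (insert 1 (f ` A))" using assms by (subst Min_gr_iff) auto
  show "Min (insert 1 (f ` A)) \<le> f a" if "a \<in> A" for a using assms(1) that by (intro Min_le) auto
qed

lemma convex_hull_inner_le: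
  assumes "\<And>x. x \<in> A \<Longrightarrow> v \<bullet> x \<le> t" "z \<in> convex hull A"
  shows "v \<bullet> z \<le> t"
proof -
  have "convex hull A \<subseteq> {x. v \<bullet> x \<le> t}"
    using assms(1) by (intro hull_minimal) (auto simp: convex_halfspace_le)
  then show ?thesis using assms(2) by auto
qed

lemma convex_hull_norm_le:
  assumes "\<And>x. x \<in> A \<Longrightarrow> norm x \<le> t" "z \<in> convex hull A"
  shows "norm z \<le> t"
proof -
  have "convex hull A \<subseteq> cball 0 t"
    using assms(1) by (intro hull_minimal) (auto simp: convex_cball)
  then show ?thesis using assms(2) by auto
qed

text \<open>The support function of the rate vectors of a channel state. With \<open>v = c l\<close> it is the value
  \<open>B\<close> of the \<open>l\<close>-th constraint; with \<open>v\<close> the queue vector it is the weight that MaxWeight attains.\<close>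

definition best_rate :: "('m \<Rightarrow> (nat ^ 'n) set) \<Rightarrow> real ^ 'n \<Rightarrow> 'm \<Rightarrow> real" where
  "best_rate S v m = Max ((\<lambda>x. v \<bullet> rvec x) ` S m)"

lemma max_rate_eq_best_rate: "max_rate S c m l = best_rate S (c l) m"
  by (simp add: max_rate_def best_rate_def)

lemma rvec_nonneg: "0 \<le> rvec x $ i"
  by (simp add: rvec_def)

text \<open>The data shared by all members of the family.\<close>

locale switch_geometry =
  fixes \<psi> :: "'m::finite pmf"
    and S :: "'m \<Rightarrow> (nat ^ 'n::finite) set"
    and c :: "nat \<Rightarrow> real ^ 'n" and b :: "nat \<Rightarrow> real" and L :: nat
    and \<nu> :: "real ^ 'n" and J :: "nat set"
  assumes S_finite: "\<And>m. finite (S m)" and S_nonempty: "\<And>m. S m \<noteq> {}"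
    and region_eq:
      "capacity_region \<psi> S = {x. (\<forall>i. 0 \<le> x $ i) \<and> (\<forall>l\<in>{1..L}. c l \<bullet> x \<le> b l)}"
    and c_nonneg: "\<And>l i. l \<in> {1..L} \<Longrightarrow> 0 \<le> c l $ i"
    and c_norm: "\<And>l. l \<in> {1..L} \<Longrightarrow> norm (c l) = 1"
    and b_pos: "\<And>l. l \<in> {1..L} \<Longrightarrow> 0 < b l"
    and \<nu>_in_region: "\<nu> \<in> capacity_region \<psi> S"
    and \<nu>_idle: "idle_queues_not_tight (capacity_region \<psi> S) L c b \<nu>"
    and J_maximal: "maximal_independent c (tight_facets (capacity_region \<psi> S) L c b \<nu>) J"
begin

abbreviation region :: "(real ^ 'n) set" where "region \<equiv> capacity_region \<psi> S"
abbreviation P :: "nat set" where "P \<equiv> tight_facets region L c b \<nu>"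
abbreviation proj :: "real ^ 'n \<Rightarrow> real ^ 'n" where "proj \<equiv> gram_projection J c"

lemma P_subset: "P \<subseteq> {1..L}" and P_tight: "l \<in> P \<Longrightarrow> c l \<bullet> \<nu> = b l"
  by (auto simp: tight_facets_def facet_def)

lemma P_iff: "l \<in> P \<longleftrightarrow> l \<in> {1..L} \<and> c l \<bullet> \<nu> = b l"
  using \<nu>_in_region by (auto simp: tight_facets_def facet_def)

lemma finite_P: "finite P"
  using P_subset finite_subset by blast

lemma J_basis: "J \<subseteq> P" "finite J" "inj_on c J" "independent (c ` J)"
  using J_maximal finite_P finite_subset unfolding maximal_independent_def by blast+

lemma span_P: "span (c ` P) = span (c ` J)"
  by (rule span_maximal_independent[OF J_maximal])

lemma c_nonneg_P: "l \<in> P \<Longrightarrow> 0 \<le> c l $ i"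
  using c_nonneg P_subset by blast

lemma linear_proj: "linear proj" by (rule linear_gram_projection)

lemma proj_span: "proj x \<in> span (c ` P)"
  using gram_projection_in_span span_P by blast

lemma inner_proj: "y \<in> span (c ` P) \<Longrightarrow> y \<bullet> proj x = y \<bullet> x"
  using inner_gram_projection_span[OF J_basis(2-4)] span_P by blast

text \<open>The projection is symmetric and idempotent.\<close>

lemma inner_proj_left: "proj x \<bullet> y = proj x \<bullet> proj y"
  by (simp add: inner_proj proj_span)

lemma proj_pythagoras:
  assumes "y \<in> span (c ` P)"
  shows "(norm (x - y))\<^sup>2 = (norm (x - proj x))\<^sup>2 + (norm (proj x - y))\<^sup>2"
proof -
  have "proj x - y \<in> span (c ` P)" using assms proj_span by (intro span_diff)
  then have "(proj x - y) \<bullet> (x - proj x) = 0"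
    using inner_proj by (simp add: inner_diff_right)
  then show ?thesis
    unfolding power2_norm_eq_inner by (simp add: inner_diff inner_commute algebra_simps)
qed

lemma norm_proj_le: "norm (proj x) \<le> norm x"
proof -
  have "(norm (proj x))\<^sup>2 \<le> (norm x)\<^sup>2"
    using proj_pythagoras[of 0 x] by (simp add: span_zero)
  then show ?thesis by (simp add: power2_le_iff_abs_le)
qed

lemma proj_eq_of_inner_eq:
  assumes "\<And>l. l \<in> P \<Longrightarrow> c l \<bullet> x = c l \<bullet> y"
  shows "proj x = proj y"
proof -
  have "c l \<bullet> x = c l \<bullet> y" if "l \<in> J" for l using assms J_basis(1) that by blast
  then show ?thesis by (simp add: gram_projection_def)
qed

lemma inner_span_eq:
  assumes "\<And>l. l \<in> P \<Longrightarrow> c l \<bullet> x = c l \<bullet> y" "v \<in> span (c ` P)"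
  shows "v \<bullet> x = v \<bullet> y"
  using inner_proj[OF assms(2)] proj_eq_of_inner_eq[OF assms(1)] by metis

text \<open>Collapse takes place onto the cone rather than onto its span: only nonnegative combinations of
  the tight normals give MaxWeight a reason to serve on all the tight faces at once.\<close>

definition cone_of_P :: "(real ^ 'n) set" where "cone_of_P = convex_cone hull (c ` P)"
definition near :: "real ^ 'n \<Rightarrow> real ^ 'n" where "near x = closest_point cone_of_P x"
definition cone_dist :: "real ^ 'n \<Rightarrow> real" where "cone_dist x = norm (x - near x)"

lemma cone_inner_nonneg:
  assumes "\<And>l. l \<in> P \<Longrightarrow> 0 \<le> c l \<bullet> v" "y \<in> cone_of_P"
  shows "0 \<le> y \<bullet> v"
proof -
  have "convex_cone hull (c ` P) \<subseteq> {y. 0 \<le> y \<bullet> v}"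
  proof (rule hull_minimal)
    show "convex_cone {y. 0 \<le> y \<bullet> v}"
      using convex_cone_halfspace_ge[of v] by (simp add: inner_commute)
  qed (use assms in auto)
  then show ?thesis using assms(2) by (auto simp: cone_of_P_def)
qed

lemma cone_coordinate_nonneg: "y \<in> cone_of_P \<Longrightarrow> 0 \<le> y $ i"
  using cone_inner_nonneg[of "axis i 1" y] c_nonneg_P by (simp add: inner_axis)

text \<open>This is where the condition on queues without arrivals enters. By this lemma the displacement
  from the cone to a queue vector is nonnegative in the coordinates where \<open>\<nu>\<close> vanishes, so that
  \<open>\<nu>\<close> may be moved in this direction.\<close>

lemma cone_coordinate_zero: "y \<in> cone_of_P \<Longrightarrow> \<nu> $ i = 0 \<Longrightarrow> y $ i = 0"
  using cone_inner_nonneg[of "- axis i 1" y] cone_coordinate_nonneg[of y i] \<nu>_idle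
  by (simp add: inner_axis idle_queues_not_tight_def)

lemma cone_in_span: "cone_of_P \<subseteq> span (c ` P)"
  unfolding cone_of_P_def
  by (rule hull_minimal) (auto intro: span_base subspace_imp_convex_cone subspace_span)

lemma cone_closed: "closed cone_of_P" and cone_convex: "convex cone_of_P"
  and cone_nonempty: "cone_of_P \<noteq> {}"
  using finite_P
  by (auto simp: cone_of_P_def closed_convex_cone_hull convex_convex_cone_hull convex_cone_hull_nonempty)

lemma near_in_cone: "near x \<in> cone_of_P"
  unfolding near_def by (rule closest_point_in_set[OF cone_closed cone_nonempty])

lemma near_span: "near x \<in> span (c ` P)"
  using near_in_cone cone_in_span by blast

lemma cone_dist_le: "y \<in> cone_of_P \<Longrightarrow> cone_dist x \<le> norm (x - y)"
  using closest_point_le[OF cone_closed, of y x] by (simp add: cone_dist_def near_def dist_norm)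

lemma near_dot: "y \<in> cone_of_P \<Longrightarrow> (x - near x) \<bullet> (y - near x) \<le> 0"
  unfolding near_def by (rule closest_point_dot[OF cone_convex cone_closed])

text \<open>Compare with the points \<open>0\<close> and \<open>2 *\<^sub>R near x\<close> of the cone.\<close>

lemma near_orthogonal: "(x - near x) \<bullet> near x = 0"
proof -
  have "0 \<in> cone_of_P" by (simp add: cone_of_P_def convex_cone_hull_contains_0)
  moreover have "2 *\<^sub>R near x \<in> cone_of_P"
    using near_in_cone[of x] by (simp add: cone_of_P_def convex_cone_hull_mul)
  ultimately show ?thesis
    using near_dot[of 0 x] near_dot[of "2 *\<^sub>R near x" x] by (simp add: scaleR_2)
qed

lemma near_polar:
  assumes "l \<in> P"
  shows "c l \<bullet> (x - near x) \<le> 0"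
proof -
  have "c l \<in> cone_of_P" using assms by (simp add: cone_of_P_def hull_inc)
  then have "near x + c l \<in> cone_of_P"
    using near_in_cone[of x] by (simp add: cone_of_P_def convex_cone_hull_add)
  then show ?thesis using near_dot[of "near x + c l" x] by (simp add: inner_commute)
qed

lemma cone_dist_nonneg: "0 \<le> cone_dist x" by (simp add: cone_dist_def)

text \<open>This identity turns the weight gained by moving \<open>\<nu>\<close> along \<open>x - near x\<close> into a multiple of the
  distance to the cone.\<close>

lemma cone_dist_sq: "x \<bullet> (x - near x) = (cone_dist x)\<^sup>2"
  using near_orthogonal[of x]
  by (simp add: cone_dist_def power2_norm_eq_inner inner_diff inner_commute)

lemma cone_dist_lipschitz: "\<bar>cone_dist x - cone_dist y\<bar> \<le> norm (x - y)"
proof -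
  have "cone_dist x \<le> cone_dist y + norm (x - y)" for x y
  proof -
    have "cone_dist x \<le> norm (x - near y)" by (rule cone_dist_le[OF near_in_cone])
    also have "\<dots> \<le> norm (x - y) + norm (y - near y)"
      using norm_triangle_ineq[of "x - y" "y - near y"] by simp
    finally show ?thesis by (simp add: cone_dist_def)
  qed
  from this[of x y] this[of y x] show ?thesis by (simp add: norm_minus_commute)
qed

text \<open>The nearest point of the cone lies in the span, so Pythagoras splits the displacement into a
  part outside the span and a part inside it.\<close>

lemma norm_diff_proj_le_cone_dist: "norm (x - proj x) \<le> cone_dist x"
  and norm_proj_diff_near_le_cone_dist: "norm (proj x - near x) \<le> cone_dist x"
proof -
  have "(cone_dist x)\<^sup>2 = (norm (x - proj x))\<^sup>2 + (norm (proj x - near x))\<^sup>2"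
    unfolding cone_dist_def by (rule proj_pythagoras[OF near_span])
  then have "(norm (x - proj x))\<^sup>2 \<le> (cone_dist x)\<^sup>2" "(norm (proj x - near x))\<^sup>2 \<le> (cone_dist x)\<^sup>2"
    by auto
  then show "norm (x - proj x) \<le> cone_dist x" "norm (proj x - near x) \<le> cone_dist x"
    using cone_dist_nonneg[of x] power2_le_imp_le by blast+
qed

lemma region_le: "z \<in> region \<Longrightarrow> l \<in> {1..L} \<Longrightarrow> c l \<bullet> z \<le> b l"
  unfolding region_eq by auto

lemma best_rate_upper: "s \<in> S m \<Longrightarrow> v \<bullet> rvec s \<le> best_rate S v m"
  unfolding best_rate_def using S_finite by (intro Max_ge) auto

lemma best_rate_attained: obtains s where "s \<in> S m" "v \<bullet> rvec s = best_rate S v m"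
proof -
  have "best_rate S v m \<in> (\<lambda>x. v \<bullet> rvec x) ` S m"
    unfolding best_rate_def using S_finite S_nonempty by (intro Max_in) auto
  then show thesis using that by auto
qed

lemma hull_best_rate: "z \<in> convex hull (rvec ` S m) \<Longrightarrow> v \<bullet> z \<le> best_rate S v m"
  by (rule convex_hull_inner_le) (auto intro: best_rate_upper)

lemma region_best_rate:
  assumes "z \<in> region"
  shows "v \<bullet> z \<le> (\<Sum>m\<in>UNIV. pmf \<psi> m * best_rate S v m)"
proof -
  obtain y where y: "z = (\<Sum>m\<in>UNIV. pmf \<psi> m *\<^sub>R y m)" "\<And>m. y m \<in> convex hull (rvec ` S m)"
    using assms unfolding capacity_region_def by blast
  show ?thesis unfolding y(1) inner_sum_right inner_scaleR_right
    by (intro sum_mono mult_left_mono hull_best_rate y) auto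
qed

lemma sum_best_rate_attained:
  obtains z where "z \<in> region" "v \<bullet> z = (\<Sum>m\<in>UNIV. pmf \<psi> m * best_rate S v m)"
proof -
  have "\<exists>s. s \<in> S m \<and> v \<bullet> rvec s = best_rate S v m" for m using best_rate_attained by metis
  then obtain s where s: "\<And>m. s m \<in> S m \<and> v \<bullet> rvec (s m) = best_rate S v m" by metis
  show thesis
  proof
    show "(\<Sum>m\<in>UNIV. pmf \<psi> m *\<^sub>R rvec (s m)) \<in> region"
      unfolding capacity_region_def using s by (auto intro!: hull_inc)
    show "v \<bullet> (\<Sum>m\<in>UNIV. pmf \<psi> m *\<^sub>R rvec (s m)) = (\<Sum>m\<in>UNIV. pmf \<psi> m * best_rate S v m)"
      using s by (simp add: inner_sum_right)
  qed
qed

lemma sum_best_rate_tight: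
  assumes "l \<in> P"
  shows "(\<Sum>m\<in>UNIV. pmf \<psi> m * best_rate S (c l) m) = b l"
proof (rule antisym)
  obtain z where "z \<in> region" "c l \<bullet> z = (\<Sum>m\<in>UNIV. pmf \<psi> m * best_rate S (c l) m)"
    by (rule sum_best_rate_attained)
  moreover have "l \<in> {1..L}" using assms P_subset by blast
  ultimately show "(\<Sum>m\<in>UNIV. pmf \<psi> m * best_rate S (c l) m) \<le> b l"
    using region_le by metis
  show "b l \<le> (\<Sum>m\<in>UNIV. pmf \<psi> m * best_rate S (c l) m)"
    using region_best_rate[OF \<nu>_in_region, of "c l"] P_tight[OF assms] by simp
qed

text \<open>A splitting of \<open>\<nu>\<close> over the channel states, as provided by the definition of the capacity region.
  It is not unique, but its projection is, at channel states of positive probability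
  (\<open>\<nu>_part_tight\<close>).\<close>

definition \<nu>_part :: "'m \<Rightarrow> real ^ 'n" where
  "\<nu>_part = (SOME y. \<nu> = (\<Sum>m\<in>UNIV. pmf \<psi> m *\<^sub>R y m) \<and> (\<forall>m. y m \<in> convex hull (rvec ` S m)))"

lemma \<nu>_part: "(\<Sum>m\<in>UNIV. pmf \<psi> m *\<^sub>R \<nu>_part m) = \<nu>" "\<nu>_part m \<in> convex hull (rvec ` S m)"
proof -
  have "\<exists>y. \<nu> = (\<Sum>m\<in>UNIV. pmf \<psi> m *\<^sub>R y m) \<and> (\<forall>m. y m \<in> convex hull (rvec ` S m))"
    using \<nu>_in_region unfolding capacity_region_def by blast
  from someI_ex[OF this, folded \<nu>_part_def]
  show "(\<Sum>m\<in>UNIV. pmf \<psi> m *\<^sub>R \<nu>_part m) = \<nu>" "\<nu>_part m \<in> convex hull (rvec ` S m)"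
    by auto
qed

text \<open>No channel can exceed its maximal rate in direction \<open>c l\<close>, and the averages agree; hence equality
  holds at every channel state of positive probability.\<close>

lemma \<nu>_part_tight:
  assumes l: "l \<in> P" and m: "m \<in> set_pmf \<psi>"
  shows "c l \<bullet> \<nu>_part m = best_rate S (c l) m"
proof -
  have "c l \<bullet> (\<Sum>m\<in>UNIV. pmf \<psi> m *\<^sub>R \<nu>_part m) = (\<Sum>m\<in>UNIV. pmf \<psi> m * best_rate S (c l) m)"
    using P_tight[OF l] sum_best_rate_tight[OF l] by (simp add: \<nu>_part)
  then have "(\<Sum>m\<in>UNIV. pmf \<psi> m * (best_rate S (c l) m - c l \<bullet> \<nu>_part m)) = 0"
    by (simp add: inner_sum_right right_diff_distrib sum_subtractf)
  moreover have "0 \<le> pmf \<psi> m * (best_rate S (c l) m - c l \<bullet> \<nu>_part m)" for m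
    using hull_best_rate[OF \<nu>_part(2)] by simp
  ultimately have "pmf \<psi> m * (best_rate S (c l) m - c l \<bullet> \<nu>_part m) = 0"
    by (subst (asm) sum_nonneg_eq_0_iff) auto
  then show ?thesis using m by (simp add: set_pmf_iff)
qed

text \<open>The geometric core of state space collapse. Move \<open>\<nu>\<close> by a small fixed length \<open>\<delta>\<close> in the unit
  direction \<open>e\<close> from the cone to \<open>q\<close>. Tight constraints stay satisfied because \<open>e\<close> is polar to the
  cone, the others have slack, and the coordinates stay nonnegative by \<open>cone_coordinate_zero\<close>.
  The weight gained is \<open>\<delta>\<close> times the distance.\<close>

lemma drift_direction_exists:
  obtains \<delta> where "0 < \<delta>"
    "\<And>q. (\<And>i. 0 \<le> q $ i) \<Longrightarrow> \<exists>z\<in>region. \<delta> * cone_dist q \<le> q \<bullet> (z - \<nu>)"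
proof -
  obtain \<delta>1 where d1: "0 < \<delta>1" "\<And>i. i \<in> {i. 0 < \<nu> $ i} \<Longrightarrow> \<delta>1 \<le> \<nu> $ i"
    by (rule finite_positive_lower_bound[of "{i. 0 < \<nu> $ i}" "\<lambda>i. \<nu> $ i"]) auto
  obtain \<delta>2 where d2: "0 < \<delta>2" "\<And>l. l \<in> {1..L} - P \<Longrightarrow> \<delta>2 \<le> b l - c l \<bullet> \<nu>"
  proof (rule finite_positive_lower_bound[of "{1..L} - P" "\<lambda>l. b l - c l \<bullet> \<nu>"])
    fix l assume l: "l \<in> {1..L} - P"
    then have "c l \<bullet> \<nu> \<le> b l" using \<nu>_in_region unfolding region_eq by auto
    moreover have "c l \<bullet> \<nu> \<noteq> b l" using l P_iff by blast
    ultimately show "0 < b l - c l \<bullet> \<nu>" by simp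
  qed auto
  define \<delta> where "\<delta> = min \<delta>1 \<delta>2"
  have \<delta>: "0 < \<delta>" "\<delta> \<le> \<delta>1" "\<delta> \<le> \<delta>2" using d1 d2 by (auto simp: \<delta>_def)
  show thesis
  proof (rule that[OF \<delta>(1)])
    fix q :: "real ^ 'n" assume q: "\<And>i. 0 \<le> q $ i"
    show "\<exists>z\<in>region. \<delta> * cone_dist q \<le> q \<bullet> (z - \<nu>)"
    proof (cases "cone_dist q = 0")
      case True then show ?thesis using \<nu>_in_region by (intro bexI[of _ \<nu>]) auto
    next
      case False
      then have g: "0 < cone_dist q" using cone_dist_nonneg[of q] by simp
      define e where "e = (q - near q) /\<^sub>R cone_dist q"
      have e1: "norm e = 1" using g by (simp add: e_def cone_dist_def)
      have "\<nu> + \<delta> *\<^sub>R e \<in> region"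
        unfolding region_eq
      proof (intro CollectI conjI allI ballI)
        fix i
        show "0 \<le> (\<nu> + \<delta> *\<^sub>R e) $ i"
        proof (cases "\<nu> $ i = 0")
          case True
          then have "near q $ i = 0" by (rule cone_coordinate_zero[OF near_in_cone])
          then show ?thesis using True q[of i] g \<delta> by (simp add: e_def)
        next
          case False
          then have "0 < \<nu> $ i" using \<nu>_in_region unfolding region_eq
            by (simp add: order_less_le)
          then have "\<delta> \<le> \<nu> $ i" using d1 \<delta> by force
          moreover have "\<bar>e $ i\<bar> \<le> 1" using component_le_norm_cart[of e i] e1 by simp
          then have "\<bar>\<delta> * e $ i\<bar> \<le> \<delta>" using \<delta> by (simp add: abs_mult)
          ultimately show ?thesis by (simp add: abs_le_iff)
        qed
      next
        fix l assume l: "l \<in> {1..L}"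
        show "c l \<bullet> (\<nu> + \<delta> *\<^sub>R e) \<le> b l"
        proof (cases "l \<in> P")
          case True
          then have "c l \<bullet> e \<le> 0"
            using near_polar[OF True, of q] g by (simp add: e_def mult_le_0_iff)
          then have "\<delta> * (c l \<bullet> e) \<le> 0" using \<delta> by (simp add: mult_le_0_iff)
          then show ?thesis using P_tight[OF True] by (simp add: inner_add_right)
        next
          case False
          have "c l \<bullet> e \<le> 1" using norm_cauchy_schwarz[of "c l" e] c_norm[OF l] e1 by simp
          then have "\<delta> * (c l \<bullet> e) \<le> \<delta>" using \<delta> by simp
          moreover have "\<delta> \<le> b l - c l \<bullet> \<nu>" using d2(2)[of l] False l \<delta> by force
          ultimately show ?thesis by (simp add: inner_add_right)
        qed
      qed
      moreover have "q \<bullet> (\<delta> *\<^sub>R e) = \<delta> * cone_dist q"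
        using cone_dist_sq[of q] g by (simp add: e_def power2_eq_square del: scaleR_right_diff_distrib)
      ultimately show ?thesis by (intro bexI[of _ "\<nu> + \<delta> *\<^sub>R e"]) auto
    qed
  qed
qed

text \<open>Scaling \<open>\<nu>\<close> down by \<open>\<epsilon>\<close> leaves room of order \<open>\<epsilon>\<close> for every queue. This gives the first moment of the
  queue lengths for each fixed \<open>\<epsilon>\<close>.\<close>

lemma interior_direction_exists:
  obtains \<eta> where "0 < \<eta>"
    "\<And>\<epsilon>. 0 \<le> \<epsilon> \<Longrightarrow> \<epsilon> \<le> 1 \<Longrightarrow> (1 - \<epsilon>) *\<^sub>R \<nu> + (\<epsilon> * \<eta>) *\<^sub>R 1 \<in> region"
proof -
  have c1: "0 \<le> c l \<bullet> 1" if "l \<in> {1..L}" for l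
    using c_nonneg[OF that] by (simp add: inner_vec_def sum_nonneg)
  obtain \<eta> where eta: "0 < \<eta>" "\<And>l. l \<in> {1..L} \<Longrightarrow> \<eta> \<le> b l / (1 + c l \<bullet> 1)"
    by (rule finite_positive_lower_bound[of "{1..L}" "\<lambda>l. b l / (1 + c l \<bullet> 1)"])
       (use b_pos c1 in \<open>auto intro!: divide_pos_pos add_pos_nonneg\<close>)
  show thesis
  proof (rule that[OF eta(1)])
    fix \<epsilon> :: real assume e: "0 \<le> \<epsilon>" "\<epsilon> \<le> 1"
    show "(1 - \<epsilon>) *\<^sub>R \<nu> + (\<epsilon> * \<eta>) *\<^sub>R 1 \<in> region"
      unfolding region_eq
    proof (intro CollectI conjI allI ballI)
      fix i show "0 \<le> ((1 - \<epsilon>) *\<^sub>R \<nu> + (\<epsilon> * \<eta>) *\<^sub>R 1) $ i"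
        using e eta \<nu>_in_region unfolding region_eq by simp
    next
      fix l assume l: "l \<in> {1..L}"
      have "\<eta> * (1 + c l \<bullet> 1) \<le> b l"
        using eta(2)[OF l] c1[OF l] by (simp add: pos_le_divide_eq add_pos_nonneg)
      then have "\<epsilon> * (\<eta> * (c l \<bullet> 1)) \<le> \<epsilon> * b l"
        using eta(1) e by (intro mult_left_mono) (auto simp: distrib_left)
      moreover have "(1 - \<epsilon>) * (c l \<bullet> \<nu>) \<le> (1 - \<epsilon>) * b l"
        using \<nu>_in_region l e unfolding region_eq by (intro mult_left_mono) auto
      ultimately show "c l \<bullet> ((1 - \<epsilon>) *\<^sub>R \<nu> + (\<epsilon> * \<eta>) *\<^sub>R 1) \<le> b l"
        by (simp add: inner_add_right left_diff_distrib)
    qed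
  qed
qed

text \<open>There are finitely many service vectors, and the unused service is integral; hence a lost
  rate or an unused service along a tight normal is at least some \<open>\<gamma>\<close> unless it vanishes.
  Markov's inequality then bounds the probability of a loss by its mean.\<close>

lemma positive_loss_bounded_below:
  obtains \<gamma> where "0 < \<gamma>"
    "\<And>m s l. s \<in> S m \<Longrightarrow> l \<in> P \<Longrightarrow> c l \<bullet> rvec s \<noteq> best_rate S (c l) m \<Longrightarrow>
       \<gamma> \<le> best_rate S (c l) m - c l \<bullet> rvec s"
    "\<And>l u. l \<in> P \<Longrightarrow> c l \<bullet> rvec u \<noteq> 0 \<Longrightarrow> \<gamma> \<le> c l \<bullet> rvec u"
proof -
  let ?A = "{(m, s, l). s \<in> S m \<and> l \<in> P \<and> c l \<bullet> rvec s \<noteq> best_rate S (c l) m}"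
  have "?A \<subseteq> UNIV \<times> (\<Union>m. S m) \<times> P" by auto
  then have finA: "finite ?A"
    by (rule finite_subset) (use S_finite finite_P in auto)
  obtain \<gamma>1 where g1: "0 < \<gamma>1"
    "\<And>z. z \<in> ?A \<Longrightarrow> \<gamma>1 \<le> (case z of (m, s, l) \<Rightarrow> best_rate S (c l) m - c l \<bullet> rvec s)"
  proof (rule finite_positive_lower_bound[OF finA])
    fix z assume z: "z \<in> ?A"
    then show "0 < (case z of (m, s, l) \<Rightarrow> best_rate S (c l) m - c l \<bullet> rvec s)"
      using best_rate_upper by (auto simp: less_le)
  qed auto
  let ?B = "{(l, i). l \<in> P \<and> 0 < c l $ i}"
  have "?B \<subseteq> P \<times> UNIV" by auto
  then have finB: "finite ?B"
    by (rule finite_subset) (use finite_P in auto)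
  obtain \<gamma>2 where g2: "0 < \<gamma>2" "\<And>z. z \<in> ?B \<Longrightarrow> \<gamma>2 \<le> (case z of (l, i) \<Rightarrow> c l $ i)"
    by (rule finite_positive_lower_bound[OF finB, of "\<lambda>(l, i). c l $ i"]) auto
  show thesis
  proof (rule that[of "min \<gamma>1 \<gamma>2"])
    show "0 < min \<gamma>1 \<gamma>2" using g1 g2 by simp
    show "min \<gamma>1 \<gamma>2 \<le> best_rate S (c l) m - c l \<bullet> rvec s"
      if "s \<in> S m" "l \<in> P" "c l \<bullet> rvec s \<noteq> best_rate S (c l) m" for m s l
      using g1(2)[of "(m, s, l)"] that by simp
    show "min \<gamma>1 \<gamma>2 \<le> c l \<bullet> rvec u" if l: "l \<in> P" and u: "c l \<bullet> rvec u \<noteq> 0" for l u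
    proof -
      have nonneg: "0 \<le> c l $ i * rvec u $ i" for i
        using c_nonneg_P[OF l] rvec_nonneg by (rule mult_nonneg_nonneg)
      obtain i where i: "c l $ i * rvec u $ i \<noteq> 0"
        using u unfolding inner_vec_def inner_real_def by (metis (no_types, lifting) sum.neutral)
      then have pos: "0 < c l $ i" using c_nonneg_P[OF l, of i] by (simp add: less_le)
      have "1 \<le> rvec u $ i" using i by (auto simp: rvec_def)
      then have "c l $ i \<le> c l $ i * rvec u $ i" using pos by simp
      also have "\<dots> \<le> c l \<bullet> rvec u"
        unfolding inner_vec_def inner_real_def by (rule member_le_sum) (auto simp: nonneg)
      finally show ?thesis using g2(2)[of "(l, i)"] l pos by simp
    qed
  qed
qed

end

section \<open>One slot of the switch under a stationary law\<close>

lemma rvec_unused_bounds: "0 \<le> rvec (unused q a s) $ i" "rvec (unused q a s) $ i \<le> rvec s $ i"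
  by (auto simp: rvec_def unused_def)

lemma norm_rvec_unused: "norm (rvec (unused q a s)) \<le> norm (rvec s)"
  by (rule norm_le_componentwise_cart) (use rvec_unused_bounds in \<open>auto simp: rvec_nonneg\<close>)

text \<open>Service of a queue is unused only if the queue is shorter than the offered service.\<close>

lemma rvec_queue_inner_unused: "rvec q \<bullet> rvec (unused q a s) \<le> (norm (rvec s))\<^sup>2"
proof -
  have "rvec q $ i * rvec (unused q a s) $ i \<le> rvec s $ i * rvec s $ i" for i
  proof (cases "s $ i - (q $ i + a $ i) = 0")
    case True then show ?thesis by (simp add: rvec_def unused_def)
  next
    case False
    then have "q $ i * (s $ i - (q $ i + a $ i)) \<le> s $ i * s $ i" by (intro mult_le_mono) auto
    then have "real (q $ i * (s $ i - (q $ i + a $ i))) \<le> real (s $ i * s $ i)"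
      by (rule of_nat_mono)
    then show ?thesis by (simp add: rvec_def unused_def)
  qed
  then show ?thesis
    unfolding power2_norm_eq_inner inner_vec_def inner_real_def by (intro sum_mono) simp
qed

lemma rvec_next_inner_unused: "rvec (next_queue q a s) \<bullet> rvec (unused q a s) = 0"
proof -
  have "rvec (next_queue q a s) $ i * rvec (unused q a s) $ i = 0" for i
    using next_queue_times_unused[of q a s i] by (auto simp: rvec_def)
  then show ?thesis unfolding inner_vec_def inner_real_def by (intro sum.neutral) blast
qed

lemma norm_rvec_next_diff: "norm (rvec (next_queue q a s) - rvec q) \<le> norm (rvec a) + norm (rvec s)"
proof -
  have "norm (rvec (unused q a s) - rvec s) \<le> norm (rvec s)"
    by (rule norm_le_componentwise_cart)
       (auto simp: abs_le_iff rvec_nonneg intro: order_trans[OF rvec_unused_bounds(2)] add_increasing rvec_unused_bounds)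
  then have "norm (rvec a + (rvec (unused q a s) - rvec s)) \<le> norm (rvec a) + norm (rvec s)"
    using norm_triangle_ineq order_trans add_left_mono by meson
  then show ?thesis by (simp add: rvec_next_queue algebra_simps)
qed

text \<open>One member of the family, in steady state. An outcome \<open>z\<close> of the law \<open>law x\<close> of a slot entered in
  state \<open>x\<close> consists of arrivals, channel state and offered service, drawn jointly; the random tie
  breaking is absorbed into the law. The constants \<open>D\<close>, \<open>\<delta>\<close>, \<open>\<gamma>\<close> can be chosen once for the whole family,
  and the final bound is a function of them and of the geometry.\<close>

locale stationary_switch = switch_geometry \<psi> S c b L \<nu> J
  for \<psi> :: "'m::finite pmf"
    and S :: "'m \<Rightarrow> (nat ^ 'n::finite) set"
    and c b L \<nu> J +
  fixes \<epsilon> D \<delta> \<gamma> :: real and pa \<pi> :: "(nat ^ 'n) pmf"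
    and law :: "nat ^ 'n \<Rightarrow> ((nat ^ 'n) \<times> 'm \<times> (nat ^ 'n)) pmf"
  assumes \<epsilon>_pos: "0 < \<epsilon>" and \<epsilon>_le: "\<epsilon> \<le> 1 / 3" and \<epsilon>_\<delta>: "\<epsilon> * norm \<nu> \<le> \<delta> / 2"
    and D_ge: "1 \<le> D"
    and arrivals_finite: "finite (set_pmf pa)"
    and arrivals_bound: "\<And>x. x \<in> set_pmf pa \<Longrightarrow> norm (rvec x) \<le> D"
    and service_bound: "\<And>m s. s \<in> S m \<Longrightarrow> norm (rvec s) \<le> D"
    and arrivals_mean: "\<And>i. measure_pmf.expectation pa (\<lambda>x. rvec x $ i) = (1 - \<epsilon>) * \<nu> $ i"
    and \<delta>_pos: "0 < \<delta>" and \<delta>_le: "\<delta> \<le> 1"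
    and \<delta>_drift: "\<And>q. (\<And>i. 0 \<le> q $ i) \<Longrightarrow> \<exists>z\<in>capacity_region \<psi> S. \<delta> * cone_dist q \<le> q \<bullet> (z - \<nu>)"
    and \<gamma>_pos: "0 < \<gamma>"
    and \<gamma>_service: "\<And>m s l. s \<in> S m \<Longrightarrow> l \<in> tight_facets (capacity_region \<psi> S) L c b \<nu> \<Longrightarrow>
       c l \<bullet> rvec s \<noteq> best_rate S (c l) m \<Longrightarrow> \<gamma> \<le> best_rate S (c l) m - c l \<bullet> rvec s"
    and \<gamma>_unused: "\<And>l u. l \<in> tight_facets (capacity_region \<psi> S) L c b \<nu> \<Longrightarrow>
       c l \<bullet> rvec u \<noteq> 0 \<Longrightarrow> \<gamma> \<le> c l \<bullet> rvec u"
    and law_marginal: "\<And>x. map_pmf (\<lambda>z. (fst z, fst (snd z))) (law x) = pair_pmf pa \<psi>"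
    and law_maxweight: "\<And>x z. z \<in> set_pmf (law x) \<Longrightarrow>
       is_arg_max (\<lambda>y. rvec x \<bullet> rvec y) (\<lambda>y. y \<in> S (fst (snd z))) (snd (snd z))"
    and stationary:
      "bind_pmf \<pi> (\<lambda>x. map_pmf (\<lambda>z. next_queue x (fst z) (snd (snd z))) (law x)) = \<pi>"
begin

text \<open>Components of an outcome \<open>z\<close>, as real vectors; \<open>E x\<close> is the expectation over a slot entered in
  state \<open>x\<close>, \<open>E\<pi>\<close> the one over the stationary state.\<close>

abbreviation arrived :: "(nat ^ 'n) \<times> 'm \<times> (nat ^ 'n) \<Rightarrow> real ^ 'n" where "arrived z \<equiv> rvec (fst z)"
abbreviation channel :: "(nat ^ 'n) \<times> 'm \<times> (nat ^ 'n) \<Rightarrow> 'm" where "channel z \<equiv> fst (snd z)"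
abbreviation offered :: "(nat ^ 'n) \<times> 'm \<times> (nat ^ 'n) \<Rightarrow> real ^ 'n" where "offered z \<equiv> rvec (snd (snd z))"
abbreviation wasted :: "nat ^ 'n \<Rightarrow> (nat ^ 'n) \<times> 'm \<times> (nat ^ 'n) \<Rightarrow> real ^ 'n" where
  "wasted x z \<equiv> rvec (unused x (fst z) (snd (snd z)))"
abbreviation next_state :: "nat ^ 'n \<Rightarrow> (nat ^ 'n) \<times> 'm \<times> (nat ^ 'n) \<Rightarrow> nat ^ 'n" where
  "next_state x z \<equiv> next_queue x (fst z) (snd (snd z))"
abbreviation E :: "nat ^ 'n \<Rightarrow> ((nat ^ 'n) \<times> 'm \<times> (nat ^ 'n) \<Rightarrow> real) \<Rightarrow> real" where
  "E x f \<equiv> measure_pmf.expectation (law x) f"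
abbreviation E\<pi> :: "(nat ^ 'n \<Rightarrow> real) \<Rightarrow> real" where
  "E\<pi> f \<equiv> measure_pmf.expectation \<pi> f"

lemma law_support:
  assumes "z \<in> set_pmf (law x)"
  shows "fst z \<in> set_pmf pa" "channel z \<in> set_pmf \<psi>" "snd (snd z) \<in> S (channel z)"
proof -
  have "(fst z, channel z) \<in> set_pmf (map_pmf (\<lambda>z. (fst z, fst (snd z))) (law x))"
    using assms by auto
  then show "fst z \<in> set_pmf pa" "channel z \<in> set_pmf \<psi>" by (auto simp: law_marginal)
  show "snd (snd z) \<in> S (channel z)" using law_maxweight[OF assms] by (simp add: is_arg_max_def)
qed

lemma finite_law: "finite (set_pmf (law x))"
proof (rule finite_subset)
  show "set_pmf (law x) \<subseteq> set_pmf pa \<times> UNIV \<times> (\<Union>m. S m)"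
    using law_support by (fastforce simp: mem_Times_iff)
  show "finite (set_pmf pa \<times> (UNIV :: 'm set) \<times> (\<Union>m. S m))"
    using arrivals_finite S_finite by auto
qed

lemma law_integrable [simp]: "integrable (measure_pmf (law x)) (f :: _ \<Rightarrow> real)"
  by (rule integrable_measure_pmf_finite[OF finite_law])

lemma E_mono: "(\<And>z. z \<in> set_pmf (law x) \<Longrightarrow> f z \<le> g z) \<Longrightarrow> E x f \<le> E x g"
  by (rule expectation_pmf_mono[OF finite_law])

lemma E_cong: "(\<And>z. z \<in> set_pmf (law x) \<Longrightarrow> f z = g z) \<Longrightarrow> E x f = E x g"
  by (rule integral_cong_AE) (auto simp: AE_measure_pmf_iff)

lemma E_arrivals: "E x (\<lambda>z. g (fst z)) = measure_pmf.expectation pa g"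
proof -
  have "map_pmf fst (law x) = map_pmf fst (map_pmf (\<lambda>z. (fst z, fst (snd z))) (law x))"
    by (simp add: pmf.map_comp o_def)
  also have "\<dots> = pa" by (simp add: law_marginal map_fst_pair_pmf)
  finally show ?thesis using integral_map_pmf[of fst "law x" g] by simp
qed

lemma E_channel: "E x (\<lambda>z. g (channel z)) = measure_pmf.expectation \<psi> g"
proof -
  have "map_pmf (\<lambda>z. fst (snd z)) (law x) = map_pmf snd (map_pmf (\<lambda>z. (fst z, fst (snd z))) (law x))"
    by (simp add: pmf.map_comp o_def)
  also have "\<dots> = \<psi>" by (simp add: law_marginal map_snd_pair_pmf)
  finally show ?thesis using integral_map_pmf[of "\<lambda>z. fst (snd z)" "law x" g] by simp
qed

lemma expectation_channel: "measure_pmf.expectation \<psi> g = (\<Sum>m\<in>UNIV. pmf \<psi> m * g m)"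
  by (subst integral_measure_pmf_real[of UNIV]) (auto simp: mult.commute)

lemma expectation_arrivals_inner:
  "measure_pmf.expectation pa (\<lambda>x. v \<bullet> rvec x) = (1 - \<epsilon>) * (v \<bullet> \<nu>)"
proof -
  have "measure_pmf.expectation pa (\<lambda>x. v \<bullet> rvec x) =
      (\<Sum>i\<in>UNIV. v $ i * measure_pmf.expectation pa (\<lambda>x. rvec x $ i))"
    unfolding inner_vec_def inner_real_def
    by (subst Bochner_Integration.integral_sum) (auto intro: integrable_measure_pmf_finite[OF arrivals_finite])
  also have "\<dots> = (1 - \<epsilon>) * (v \<bullet> \<nu>)"
    by (simp add: arrivals_mean inner_vec_def sum_distrib_left mult_ac)
  finally show ?thesis .
qed

lemma E_inner_arrived: "E x (\<lambda>z. v \<bullet> arrived z) = (1 - \<epsilon>) * (v \<bullet> \<nu>)"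
  using E_arrivals[of x "\<lambda>a. v \<bullet> rvec a"] by (simp add: expectation_arrivals_inner)

lemma expectation_\<nu>_part: "measure_pmf.expectation \<psi> (\<lambda>m. v \<bullet> \<nu>_part m) = v \<bullet> \<nu>"
  unfolding expectation_channel by (subst \<nu>_part(1)[symmetric]) (simp add: inner_sum_right)

lemma E_\<nu>_part: "E x (\<lambda>z. v \<bullet> \<nu>_part (channel z)) = v \<bullet> \<nu>"
  using E_channel[of x "\<lambda>m. v \<bullet> \<nu>_part m"] by (simp add: expectation_\<nu>_part)

lemma expectation_pair:
  "measure_pmf.expectation (pair_pmf pa \<psi>) f =
     measure_pmf.expectation pa (\<lambda>a. measure_pmf.expectation \<psi> (\<lambda>m. f (a, m)))" for f :: "_ \<Rightarrow> real"
proof -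
  have "measure_pmf.expectation (pair_pmf pa \<psi>) f =
      (\<Sum>z\<in>set_pmf pa \<times> UNIV. f z * pmf (pair_pmf pa \<psi>) z)"
    using arrivals_finite by (intro integral_measure_pmf_real) auto
  also have "\<dots> = (\<Sum>a\<in>set_pmf pa. \<Sum>m\<in>UNIV. f (a, m) * (pmf pa a * pmf \<psi> m))"
    by (auto simp: sum.cartesian_product pmf_pair intro!: sum.cong)
  also have "\<dots> = (\<Sum>a\<in>set_pmf pa. measure_pmf.expectation \<psi> (\<lambda>m. f (a, m)) * pmf pa a)"
    by (simp add: expectation_channel sum_distrib_left mult_ac)
  also have "\<dots> = measure_pmf.expectation pa (\<lambda>a. measure_pmf.expectation \<psi> (\<lambda>m. f (a, m)))"
    using arrivals_finite by (intro integral_measure_pmf_real[symmetric]) auto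
  finally show ?thesis .
qed

lemma E_pair:
  "E x (\<lambda>z. f (fst z) (channel z)) =
     measure_pmf.expectation pa (\<lambda>a. measure_pmf.expectation \<psi> (f a))"
proof -
  have "E x (\<lambda>z. f (fst z) (channel z)) = measure_pmf.expectation (pair_pmf pa \<psi>) (\<lambda>y. f (fst y) (snd y))"
    unfolding law_marginal[of x, symmetric] by simp
  then show ?thesis by (simp add: expectation_pair)
qed

lemma stationary_bound:
  assumes "\<And>x. 0 \<le> V x" "\<And>x. 0 \<le> f x" "0 \<le> C"
    and "\<And>x. E x (\<lambda>z. V (next_state x z)) \<le> V x - f x + C"
  shows "integrable (measure_pmf \<pi>) f" "E\<pi> f \<le> C"
  by (rule foster_bound[OF stationary, of V f C]; use assms finite_law in simp)+

lemma stationary_drift: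
  assumes "integrable (measure_pmf \<pi>) g"
    and "\<And>x z. z \<in> set_pmf (law x) \<Longrightarrow> \<bar>V (next_state x z) - V x\<bar> \<le> g x"
  shows "E\<pi> (\<lambda>x. E x (\<lambda>z. V (next_state x z) - V x)) = 0"
  using stationary_drift_zero[OF stationary _ assms(1), of V] assms(2) finite_law by fastforce

lemma service_best:
  assumes "z \<in> set_pmf (law x)"
  shows "rvec x \<bullet> offered z = best_rate S (rvec x) (channel z)"
proof (rule antisym)
  obtain s where "s \<in> S (channel z)" "rvec x \<bullet> rvec s = best_rate S (rvec x) (channel z)"
    by (rule best_rate_attained)
  then show "best_rate S (rvec x) (channel z) \<le> rvec x \<bullet> offered z"
    using law_maxweight[OF assms] unfolding is_arg_max_linorder by metis
qed (rule best_rate_upper[OF law_support(3)[OF assms]])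

text \<open>The only consequence of MaxWeight that drift arguments need: on average it serves at least the
  weight of any point of the capacity region.\<close>

lemma E_service_ge:
  assumes "y \<in> region"
  shows "rvec x \<bullet> y \<le> E x (\<lambda>z. rvec x \<bullet> offered z)"
proof -
  have "E x (\<lambda>z. rvec x \<bullet> offered z) = E x (\<lambda>z. best_rate S (rvec x) (channel z))"
    by (rule E_cong) (rule service_best)
  also have "\<dots> = (\<Sum>m\<in>UNIV. pmf \<psi> m * best_rate S (rvec x) m)"
    by (simp add: E_channel[of x "best_rate S (rvec x)"] expectation_channel)
  finally show ?thesis using region_best_rate[OF assms] by simp
qed

lemma step_bounds:
  assumes "z \<in> set_pmf (law x)"
  shows "norm (arrived z) \<le> D" "norm (offered z) \<le> D" "norm (wasted x z) \<le> D"
    "norm (rvec (next_state x z) - rvec x) \<le> 2 * D" "rvec x \<bullet> wasted x z \<le> D\<^sup>2"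
    "norm (\<nu>_part (channel z)) \<le> D"
proof -
  show a: "norm (arrived z) \<le> D" and s: "norm (offered z) \<le> D"
    using arrivals_bound service_bound law_support[OF assms] by auto
  show "norm (wasted x z) \<le> D" using norm_rvec_unused s by (rule order_trans)
  show "norm (rvec (next_state x z) - rvec x) \<le> 2 * D"
    using norm_rvec_next_diff[of x "fst z" "snd (snd z)"] a s by simp
  have "(norm (offered z))\<^sup>2 \<le> D\<^sup>2" using s by (intro power_mono) auto
  then show "rvec x \<bullet> wasted x z \<le> D\<^sup>2"
    using rvec_queue_inner_unused[of x "fst z" "snd (snd z)"] by simp
  show "norm (\<nu>_part (channel z)) \<le> D"
    by (rule convex_hull_norm_le[OF _ \<nu>_part(2)]) (auto intro: service_bound)
qed

lemma region_norm: "z \<in> region \<Longrightarrow> norm z \<le> D"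
proof -
  assume "z \<in> region"
  then obtain y where y: "z = (\<Sum>m\<in>UNIV. pmf \<psi> m *\<^sub>R y m)" "\<And>m. y m \<in> convex hull (rvec ` S m)"
    unfolding capacity_region_def by blast
  have "norm (y m) \<le> D" for m
    by (rule convex_hull_norm_le[OF _ y(2)]) (auto intro: service_bound)
  then have "norm z \<le> (\<Sum>m\<in>UNIV. pmf \<psi> m * D)"
    unfolding y(1) by (intro sum_norm_le) (auto intro: mult_left_mono)
  also have "\<dots> = D" by (simp add: sum_distrib_right[symmetric] sum_pmf_eq_1)
  finally show ?thesis .
qed

text \<open>Along the generators of the cone \<open>\<nu>_part\<close> attains the maximal rate, so it dominates any service
  along the whole cone.\<close>

lemma inner_\<nu>_part_service_nonneg:
  assumes "y \<in> cone_of_P" "z \<in> set_pmf (law x)"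
  shows "0 \<le> y \<bullet> (\<nu>_part (channel z) - offered z)"
  by (rule cone_inner_nonneg[OF _ assms(1)])
     (use best_rate_upper[OF law_support(3)[OF assms(2)]] \<nu>_part_tight law_support(2)[OF assms(2)]
       in \<open>auto simp: inner_diff_right\<close>)

text \<open>Foster's bound for the squared norm. Its value blows up as \<open>\<epsilon>\<close> tends to \<open>0\<close>, so only finiteness is
  recorded; it makes the balance of a quadratic function valid.\<close>

lemma integrable_queue: "integrable (measure_pmf \<pi>) (\<lambda>x. norm (rvec x))"
proof -
  obtain \<eta> where eta: "0 < \<eta>"
    "\<And>\<epsilon>. 0 \<le> \<epsilon> \<Longrightarrow> \<epsilon> \<le> 1 \<Longrightarrow> (1 - \<epsilon>) *\<^sub>R \<nu> + (\<epsilon> * \<eta>) *\<^sub>R 1 \<in> region"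
    by (rule interior_direction_exists) blast
  let ?y = "(1 - \<epsilon>) *\<^sub>R \<nu> + (\<epsilon> * \<eta>) *\<^sub>R 1"
  let ?f = "\<lambda>x. 2 * (\<epsilon> * \<eta>) * (rvec x \<bullet> 1)"
  have y: "?y \<in> region" using eta(2)[of \<epsilon>] \<epsilon>_pos \<epsilon>_le by simp
  have one: "0 \<le> rvec x \<bullet> (1 :: real ^ 'n)" for x :: "nat ^ 'n"
    by (simp add: inner_vec_def sum_nonneg rvec_nonneg)
  have int: "integrable (measure_pmf \<pi>) ?f"
  proof (rule stationary_bound(1)[where V = "\<lambda>x. (norm (rvec x))\<^sup>2" and C = "(2 * D)\<^sup>2"])
    fix x
    have path: "(norm (rvec (next_state x z)))\<^sup>2 \<le>
        (norm (rvec x))\<^sup>2 + 2 * (rvec x \<bullet> arrived z - rvec x \<bullet> offered z) + (2 * D)\<^sup>2"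
      if z: "z \<in> set_pmf (law x)" for z
    proof -
      have "rvec (next_state x z) = (rvec x + arrived z - offered z) + wasted x z" by (simp add: rvec_next_queue)
      then have eq: "rvec x + (arrived z - offered z) = rvec (next_state x z) - wasted x z" by simp
      have "(norm (rvec x + (arrived z - offered z)))\<^sup>2 = (norm (rvec (next_state x z)))\<^sup>2 + (norm (wasted x z))\<^sup>2"
        unfolding eq power2_norm_eq_inner
        using rvec_next_inner_unused[of x "fst z" "snd (snd z)"]
        by (simp add: inner_diff inner_commute)
      then have "(norm (rvec (next_state x z)))\<^sup>2 \<le> (norm (rvec x + (arrived z - offered z)))\<^sup>2" by simp
      also have "\<dots> = (norm (rvec x))\<^sup>2 + 2 * (rvec x \<bullet> arrived z - rvec x \<bullet> offered z) + (norm (arrived z - offered z))\<^sup>2"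
        unfolding power2_norm_eq_inner by (simp add: inner_add inner_diff inner_commute algebra_simps)
      also have "norm (arrived z - offered z) \<le> 2 * D"
        using step_bounds(1,2)[OF z] norm_triangle_ineq4[of "arrived z" "offered z"] by simp
      then have "(norm (arrived z - offered z))\<^sup>2 \<le> (2 * D)\<^sup>2" by (intro power_mono) auto
      finally show ?thesis by simp
    qed
    have "E x (\<lambda>z. (norm (rvec (next_state x z)))\<^sup>2) \<le>
        E x (\<lambda>z. (norm (rvec x))\<^sup>2 + 2 * (rvec x \<bullet> arrived z - rvec x \<bullet> offered z) + (2 * D)\<^sup>2)"
      by (rule E_mono) (rule path)
    also have "\<dots> = (norm (rvec x))\<^sup>2 +
        2 * ((1 - \<epsilon>) * (rvec x \<bullet> \<nu>) - E x (\<lambda>z. rvec x \<bullet> offered z)) + (2 * D)\<^sup>2"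
      by (simp add: E_inner_arrived)
    also have "\<dots> \<le> (norm (rvec x))\<^sup>2 - ?f x + (2 * D)\<^sup>2"
      using E_service_ge[OF y, of x] by (simp add: inner_add_right)
    finally show "E x (\<lambda>z. (norm (rvec (next_state x z)))\<^sup>2) \<le> (norm (rvec x))\<^sup>2 - ?f x + (2 * D)\<^sup>2" .
  qed (use one eta(1) \<epsilon>_pos in auto)
  show ?thesis
  proof (rule Bochner_Integration.integrable_bound)
    show "integrable (measure_pmf \<pi>) (\<lambda>x. (1 / (2 * (\<epsilon> * \<eta>))) * ?f x)"
      using int by (rule integrable_mult_right)
    show "AE x in measure_pmf \<pi>. norm (norm (rvec x)) \<le> norm ((1 / (2 * (\<epsilon> * \<eta>))) * ?f x)"
    proof (rule AE_I2)
      fix x :: "nat ^ 'n"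
      have "norm (rvec x) \<le> rvec x \<bullet> 1"
        using norm_le_l1_cart[of "rvec x"] by (simp add: inner_vec_def rvec_nonneg)
      then show "norm (norm (rvec x)) \<le> norm ((1 / (2 * (\<epsilon> * \<eta>))) * ?f x)"
        using one[of x] eta(1) \<epsilon>_pos by simp
    qed
  qed auto
qed

section \<open>State space collapse\<close>

text \<open>Bound the new distance by the distance to the old nearest point \<open>k\<close>. Unused service helps, since
  \<open>k\<close> is nonnegative and the queues with unused service are short. For the mean of \<open>a - s\<close> along
  \<open>q - k\<close>, split \<open>s\<close> into its products with \<open>q\<close>, where MaxWeight beats \<open>\<nu>\<close> by \<open>\<delta>\<close> times the distance,
  and with \<open>k\<close>, where no service beats \<open>\<nu>\<close>. The reduction of the load by \<open>\<epsilon>\<close> costs at most half of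
  this gain.\<close>

lemma cone_dist_drift:
  "E x (\<lambda>z. (cone_dist (rvec (next_state x z)))\<^sup>2) \<le> (cone_dist (rvec x))\<^sup>2 - \<delta> * cone_dist (rvec x) + 6 * D\<^sup>2"
proof -
  let ?q = "rvec x" and ?k = "near (rvec x)"
  have path: "(cone_dist (rvec (next_state x z)))\<^sup>2 \<le>
      (cone_dist ?q)\<^sup>2 + 2 * ((?q - ?k) \<bullet> arrived z - (?q - ?k) \<bullet> offered z) + 6 * D\<^sup>2"
    if z: "z \<in> set_pmf (law x)" for z
  proof -
    let ?q' = "rvec (next_state x z)"
    have "cone_dist ?q' \<le> norm (?q' - ?k)" by (rule cone_dist_le[OF near_in_cone])
    then have "(cone_dist ?q')\<^sup>2 \<le> (norm (?q' - ?k))\<^sup>2" using cone_dist_nonneg by (intro power_mono)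
    also have "\<dots> = (norm ((?q - ?k) + (?q' - ?q)))\<^sup>2" by simp
    also have "\<dots> = (cone_dist ?q)\<^sup>2 + 2 * ((?q - ?k) \<bullet> (?q' - ?q)) + (norm (?q' - ?q))\<^sup>2"
      unfolding cone_dist_def power2_norm_eq_inner by (simp only: inner_add inner_commute)
    finally have "(cone_dist ?q')\<^sup>2 \<le> (cone_dist ?q)\<^sup>2 + 2 * ((?q - ?k) \<bullet> (?q' - ?q)) + (norm (?q' - ?q))\<^sup>2" .
    moreover have "(norm (?q' - ?q))\<^sup>2 \<le> 4 * D\<^sup>2"
      using power_mono[OF step_bounds(4)[OF z], of 2] by (simp add: power_mult_distrib)
    moreover have "(?q - ?k) \<bullet> (?q' - ?q) = (?q - ?k) \<bullet> arrived z - (?q - ?k) \<bullet> offered z + (?q - ?k) \<bullet> wasted x z"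
      by (simp add: rvec_next_queue inner_add_right inner_diff_right)
    moreover have "(?q - ?k) \<bullet> wasted x z \<le> D\<^sup>2"
    proof -
      have "0 \<le> ?k \<bullet> wasted x z"
        unfolding inner_vec_def inner_real_def
        by (intro sum_nonneg mult_nonneg_nonneg cone_coordinate_nonneg[OF near_in_cone] rvec_nonneg)
      then show ?thesis using step_bounds(5)[OF z] by (simp add: inner_diff_left)
    qed
    ultimately show ?thesis by simp
  qed
  have "E x (\<lambda>z. (cone_dist (rvec (next_state x z)))\<^sup>2) \<le>
      E x (\<lambda>z. (cone_dist ?q)\<^sup>2 + 2 * ((?q - ?k) \<bullet> arrived z - (?q - ?k) \<bullet> offered z) + 6 * D\<^sup>2)"
    by (rule E_mono) (rule path)
  also have "\<dots> = (cone_dist ?q)\<^sup>2 + 2 * ((1 - \<epsilon>) * ((?q - ?k) \<bullet> \<nu>) - E x (\<lambda>z. (?q - ?k) \<bullet> offered z)) + 6 * D\<^sup>2"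
    by (simp add: E_inner_arrived)
  finally have 1: "E x (\<lambda>z. (cone_dist (rvec (next_state x z)))\<^sup>2) \<le>
    (cone_dist ?q)\<^sup>2 + 2 * ((1 - \<epsilon>) * ((?q - ?k) \<bullet> \<nu>) - E x (\<lambda>z. (?q - ?k) \<bullet> offered z)) + 6 * D\<^sup>2" .
  have 2: "E x (\<lambda>z. (?q - ?k) \<bullet> offered z) = E x (\<lambda>z. ?q \<bullet> offered z) - E x (\<lambda>z. ?k \<bullet> offered z)"
    by (simp add: inner_diff_left)
  \<comment> \<open>no service beats \<open>\<nu>\<close> along the cone\<close>
  have 3: "E x (\<lambda>z. ?k \<bullet> offered z) \<le> ?k \<bullet> \<nu>"
  proof -
    have "E x (\<lambda>z. ?k \<bullet> offered z) \<le> E x (\<lambda>z. ?k \<bullet> \<nu>_part (channel z))"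
      by (rule E_mono)
         (use inner_\<nu>_part_service_nonneg[OF near_in_cone] in \<open>simp add: inner_diff_right\<close>)
    then show ?thesis by (simp add: E_\<nu>_part)
  qed
  obtain y where y: "y \<in> region" "\<delta> * cone_dist ?q \<le> ?q \<bullet> (y - \<nu>)"
    using \<delta>_drift[of ?q] rvec_nonneg by blast
  have 4: "?q \<bullet> \<nu> + \<delta> * cone_dist ?q \<le> E x (\<lambda>z. ?q \<bullet> offered z)"
    using E_service_ge[OF y(1), of x] y(2) by (simp add: inner_diff_right)
  \<comment> \<open>the price of the reduced load\<close>
  have 5: "- \<epsilon> * ((?q - ?k) \<bullet> \<nu>) \<le> \<delta> / 2 * cone_dist ?q"
  proof -
    have "\<bar>(?q - ?k) \<bullet> \<nu>\<bar> \<le> cone_dist ?q * norm \<nu>"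
      unfolding cone_dist_def by (rule Cauchy_Schwarz_ineq2)
    then have "\<epsilon> * \<bar>(?q - ?k) \<bullet> \<nu>\<bar> \<le> \<epsilon> * (cone_dist ?q * norm \<nu>)"
      using \<epsilon>_pos by (intro mult_left_mono) auto
    also have "\<dots> \<le> \<delta> / 2 * cone_dist ?q"
      using mult_right_mono[OF \<epsilon>_\<delta> cone_dist_nonneg[of ?q]] by (simp add: mult_ac)
    finally have "\<epsilon> * \<bar>(?q - ?k) \<bullet> \<nu>\<bar> \<le> \<delta> / 2 * cone_dist ?q" .
    moreover have "- \<epsilon> * ((?q - ?k) \<bullet> \<nu>) \<le> \<epsilon> * \<bar>(?q - ?k) \<bullet> \<nu>\<bar>"
      using \<epsilon>_pos by (metis abs_ge_minus_self abs_mult abs_of_pos mult_minus_left)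
    ultimately show ?thesis by linarith
  qed
  have 6: "(1 - \<epsilon>) * ((?q - ?k) \<bullet> \<nu>) = ?q \<bullet> \<nu> - ?k \<bullet> \<nu> - \<epsilon> * ((?q - ?k) \<bullet> \<nu>)"
    by (simp add: left_diff_distrib inner_diff_left)
  show ?thesis using 1 2 3 4 5 6 by (simp add: algebra_simps)
qed

text \<open>The exponent is so small that the quadratic term in the expansion of the exponential takes away
  at most half of the linear drift; \<open>M\<close> is the resulting bound on the exponential moment. Both are
  functions of \<open>D\<close> and \<open>\<delta>\<close> only, hence uniform in \<open>\<epsilon>\<close>.\<close>

definition \<theta> :: real where "\<theta> = \<delta> / (32 * D\<^sup>2)"
definition M :: real where "M = exp (\<theta> * (12 * D\<^sup>2 / \<delta> + 2 * D)) / (\<theta> * \<delta> / 8)"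

lemma \<theta>_pos: "0 < \<theta>" and \<theta>_jump: "\<theta> * (2 * D) \<le> 1" and \<theta>_le: "4 * D\<^sup>2 * \<theta>\<^sup>2 \<le> \<theta> * \<delta> / 8"
  and \<theta>_le_1: "\<theta> * \<delta> / 8 \<le> 1"
proof -
  have D2: "D \<le> D\<^sup>2" "1 \<le> D\<^sup>2" using D_ge mult_mono[of 1 D 1 D] by (auto simp: power2_eq_square)
  show pos: "0 < \<theta>" using \<delta>_pos D_ge by (simp add: \<theta>_def)
  have eq: "32 * D\<^sup>2 * \<theta> = \<delta>" using D_ge by (simp add: \<theta>_def)
  have "\<theta> * D \<le> \<theta> * D\<^sup>2" using pos D2 by simp
  moreover have "32 * (\<theta> * D\<^sup>2) \<le> 1" using eq \<delta>_le by (simp add: mult_ac)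
  moreover have "0 \<le> \<theta> * D\<^sup>2" using pos by simp
  ultimately have "2 * (\<theta> * D) \<le> 1" by linarith
  then show "\<theta> * (2 * D) \<le> 1" by (simp add: mult_ac)
  have "4 * D\<^sup>2 * \<theta>\<^sup>2 = \<theta> * (32 * D\<^sup>2 * \<theta>) / 8" by (simp add: power2_eq_square)
  then show "4 * D\<^sup>2 * \<theta>\<^sup>2 \<le> \<theta> * \<delta> / 8" using eq by simp
  have "\<theta> * 1 \<le> \<theta> * D\<^sup>2" using pos D2 by (intro mult_left_mono) auto
  moreover have "32 * (\<theta> * D\<^sup>2) \<le> 1" using eq \<delta>_le by (simp add: mult_ac)
  ultimately have "\<theta> \<le> 1" using pos by linarith
  then show "\<theta> * \<delta> / 8 \<le> 1" using mult_mono[of \<theta> 1 \<delta> 1] \<delta>_le \<delta>_pos pos by simp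
qed

lemma M_pos: "0 < M" using \<theta>_pos \<delta>_pos by (simp add: M_def)

lemma cone_dist_jump:
  assumes "z \<in> set_pmf (law x)"
  shows "\<bar>cone_dist (rvec (next_state x z)) - cone_dist (rvec x)\<bar> \<le> 2 * D"
  using cone_dist_lipschitz step_bounds(4)[OF assms] by (rule order_trans)

text \<open>Concavity of the square root: \<open>y - x \<le> (y\<^sup>2 - x\<^sup>2) / (2 * x)\<close> for \<open>x > 0\<close>.\<close>

lemma cone_dist_mean_drift:
  assumes g: "12 * D\<^sup>2 / \<delta> \<le> cone_dist (rvec x)"
  shows "E x (\<lambda>z. cone_dist (rvec (next_state x z)) - cone_dist (rvec x)) \<le> - (\<delta> / 4)"
proof -
  let ?g = "cone_dist (rvec x)"
  have "0 < 12 * D\<^sup>2 / \<delta>" using D_ge \<delta>_pos by simp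
  then have gpos: "0 < ?g" using g by linarith
  have "E x (\<lambda>z. cone_dist (rvec (next_state x z)) - ?g) \<le> E x (\<lambda>z. ((cone_dist (rvec (next_state x z)))\<^sup>2 - ?g\<^sup>2) / (2 * ?g))"
  proof (rule E_mono)
    fix z
    have "0 \<le> (cone_dist (rvec (next_state x z)) - ?g)\<^sup>2" by simp
    then show "cone_dist (rvec (next_state x z)) - ?g \<le> ((cone_dist (rvec (next_state x z)))\<^sup>2 - ?g\<^sup>2) / (2 * ?g)"
      using gpos by (simp add: field_simps power2_eq_square)
  qed
  also have "\<dots> = (E x (\<lambda>z. (cone_dist (rvec (next_state x z)))\<^sup>2) - ?g\<^sup>2) / (2 * ?g)" by simp
  also have "\<dots> \<le> (- \<delta> * ?g + 6 * D\<^sup>2) / (2 * ?g)"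
    using cone_dist_drift[of x] gpos by (intro divide_right_mono) auto
  also have "\<dots> \<le> - (\<delta> / 4)"
  proof -
    have "12 * D\<^sup>2 \<le> \<delta> * ?g" using g \<delta>_pos by (simp add: field_simps)
    then have "- \<delta> * ?g + 6 * D\<^sup>2 \<le> - (\<delta> / 4) * (2 * ?g)" by simp
    then show ?thesis using gpos by (simp add: pos_divide_le_eq)
  qed
  finally show ?thesis .
qed

text \<open>The exponential of the distance contracts in the mean by a fixed factor when the distance is
  large and is bounded after one step otherwise, so Foster's bound applies.\<close>

lemma exp_cone_dist_bound:
  "integrable (measure_pmf \<pi>) (\<lambda>x. exp (\<theta> * cone_dist (rvec x)))"
  "E\<pi> (\<lambda>x. exp (\<theta> * cone_dist (rvec x))) \<le> M"
proof -
  let ?V = "\<lambda>x. exp (\<theta> * cone_dist (rvec x))"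
  let ?\<kappa> = "\<theta> * \<delta> / 8"
  let ?C = "exp (\<theta> * (12 * D\<^sup>2 / \<delta> + 2 * D))"
  have \<kappa>: "0 < ?\<kappa>" using \<theta>_pos \<delta>_pos by simp
  have drift: "E x (\<lambda>z. ?V (next_state x z)) \<le> ?V x - ?\<kappa> * ?V x + ?C" for x
  proof (cases "12 * D\<^sup>2 / \<delta> \<le> cone_dist (rvec x)")
    case True
    let ?d = "\<lambda>z. cone_dist (rvec (next_state x z)) - cone_dist (rvec x)"
    have "E x (\<lambda>z. ?V (next_state x z)) \<le> E x (\<lambda>z. ?V x * (1 + \<theta> * ?d z + ?\<kappa>))"
    proof (rule E_mono)
      fix z assume z: "z \<in> set_pmf (law x)"
      have "\<bar>\<theta> * ?d z\<bar> \<le> \<theta> * (2 * D)"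
        using cone_dist_jump[OF z] \<theta>_pos by (simp add: abs_mult)
      then have le1: "\<bar>\<theta> * ?d z\<bar> \<le> 1" and sq: "(\<theta> * ?d z)\<^sup>2 \<le> (\<theta> * (2 * D))\<^sup>2"
        using \<theta>_jump power_mono[of "\<bar>\<theta> * ?d z\<bar>" "\<theta> * (2 * D)" 2] by auto
      have "exp (\<theta> * ?d z) \<le> 1 + \<theta> * ?d z + (\<theta> * ?d z)\<^sup>2" by (rule exp_le_quadratic[OF le1])
      also have "\<dots> \<le> 1 + \<theta> * ?d z + ?\<kappa>"
        using sq \<theta>_le by (simp add: power_mult_distrib mult_ac)
      finally have "?V x * exp (\<theta> * ?d z) \<le> ?V x * (1 + \<theta> * ?d z + ?\<kappa>)" by simp
      moreover have "?V x * exp (\<theta> * ?d z) = ?V (next_state x z)"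
        by (simp add: exp_add[symmetric] algebra_simps)
      ultimately show "?V (next_state x z) \<le> ?V x * (1 + \<theta> * ?d z + ?\<kappa>)" by simp
    qed
    also have "\<dots> = ?V x * (1 + \<theta> * E x ?d + ?\<kappa>)" by simp
    also have "\<dots> \<le> ?V x * (1 - ?\<kappa>)"
    proof -
      have "\<theta> * E x ?d \<le> \<theta> * (- (\<delta> / 4))"
        using cone_dist_mean_drift[OF True] \<theta>_pos by (intro mult_left_mono) auto
      then have "1 + \<theta> * E x ?d + ?\<kappa> \<le> 1 - ?\<kappa>" by linarith
      then show ?thesis by simp
    qed
    also have "\<dots> \<le> ?V x - ?\<kappa> * ?V x + ?C" by (simp add: algebra_simps)
    finally show ?thesis .
  next
    case False
    have "E x (\<lambda>z. ?V (next_state x z)) \<le> E x (\<lambda>_. ?C)"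
      using cone_dist_jump False \<theta>_pos by (intro E_mono) fastforce
    moreover have "?\<kappa> * ?V x \<le> 1 * ?V x" using \<theta>_le_1 by (intro mult_right_mono) auto
    moreover have "E x (\<lambda>_. ?C) = ?C" by simp
    ultimately show ?thesis by linarith
  qed
  have 1: "integrable (measure_pmf \<pi>) (\<lambda>x. ?\<kappa> * ?V x)" and 2: "E\<pi> (\<lambda>x. ?\<kappa> * ?V x) \<le> ?C"
    by (rule stationary_bound[where V = ?V and C = ?C]; use \<kappa> drift in \<open>auto simp: less_imp_le\<close>)+
  have "(\<lambda>x. (1 / ?\<kappa>) * (?\<kappa> * ?V x)) = ?V" using \<theta>_pos \<delta>_pos by (simp add: fun_eq_iff)
  with integrable_mult_right[OF 1, of "1 / ?\<kappa>"]
  show "integrable (measure_pmf \<pi>) ?V" by (simp only:)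
  have "?\<kappa> * E\<pi> ?V \<le> ?C" using 2 by (simp only: integral_mult_right_zero)
  then show "E\<pi> ?V \<le> M"
    unfolding M_def using \<kappa> by (simp only: pos_le_divide_eq mult.commute)
qed

section \<open>Slots that leave the tight faces\<close>

definition bad :: "nat ^ 'n \<Rightarrow> (nat ^ 'n) \<times> 'm \<times> (nat ^ 'n) \<Rightarrow> bool" where
  "bad x z \<longleftrightarrow> (\<exists>l\<in>P. c l \<bullet> offered z \<noteq> best_rate S (c l) (channel z) \<or> c l \<bullet> wasted x z \<noteq> 0)"

text \<open>What a slot falls short of the ideal along \<open>c l\<close>: rate that was not offered, plus offered rate that
  found no job.\<close>

definition loss :: "nat ^ 'n \<Rightarrow> (nat ^ 'n) \<times> 'm \<times> (nat ^ 'n) \<Rightarrow> nat \<Rightarrow> real" where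
  "loss x z l = best_rate S (c l) (channel z) - c l \<bullet> offered z + c l \<bullet> wasted x z"

lemma loss_nonneg:
  assumes "z \<in> set_pmf (law x)" "l \<in> P"
  shows "0 \<le> best_rate S (c l) (channel z) - c l \<bullet> offered z" "0 \<le> c l \<bullet> wasted x z" "0 \<le> loss x z l"
proof -
  show "0 \<le> best_rate S (c l) (channel z) - c l \<bullet> offered z"
    using best_rate_upper[OF law_support(3)[OF assms(1)]] by simp
  moreover show "0 \<le> c l \<bullet> wasted x z"
    unfolding inner_vec_def inner_real_def
    using c_nonneg_P[OF assms(2)] by (intro sum_nonneg mult_nonneg_nonneg rvec_nonneg)
  ultimately show "0 \<le> loss x z l" by (simp add: loss_def)
qed

lemma bad_le_loss:
  assumes z: "z \<in> set_pmf (law x)"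
  shows "of_bool (bad x z) \<le> (\<Sum>l\<in>P. loss x z l) / \<gamma>"
proof (cases "bad x z")
  case False
  then show ?thesis using \<gamma>_pos loss_nonneg(3)[OF z] by (simp add: sum_nonneg)
next
  case True
  then obtain l where l: "l \<in> P" "c l \<bullet> offered z \<noteq> best_rate S (c l) (channel z) \<or> c l \<bullet> wasted x z \<noteq> 0"
    unfolding bad_def by blast
  have "\<gamma> \<le> loss x z l"
    using l(2) \<gamma>_service[OF law_support(3)[OF z] l(1)]
      \<gamma>_unused[OF l(1), of "unused x (fst z) (snd (snd z))"] loss_nonneg(1,2)[OF z l(1)]
    unfolding loss_def by linarith
  also have "\<dots> \<le> (\<Sum>l\<in>P. loss x z l)"
    using loss_nonneg(3)[OF z] finite_P l(1) by (intro member_le_sum) auto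
  finally show ?thesis using True \<gamma>_pos by simp
qed

lemma integrable_E_bounded:
  assumes "integrable (measure_pmf \<pi>) g" "\<And>x z. z \<in> set_pmf (law x) \<Longrightarrow> \<bar>f x z\<bar> \<le> g x"
  shows "integrable (measure_pmf \<pi>) (\<lambda>x. E x (f x))"
proof (rule Bochner_Integration.integrable_bound[OF assms(1)])
  show "AE x in measure_pmf \<pi>. norm (E x (f x)) \<le> norm (g x)"
  proof (rule AE_I2)
    fix x
    have "\<bar>E x (f x)\<bar> \<le> g x" by (rule expectation_abs_bound[OF finite_law assms(2)])
    then show "norm (E x (f x)) \<le> norm (g x)" by simp
  qed
qed auto

lemma abs_inner_le: "norm u \<le> s \<Longrightarrow> norm v \<le> t \<Longrightarrow> \<bar>u \<bullet> v\<bar> \<le> s * t"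
  for u v :: "'v::real_inner"
  by (rule order_trans[OF Cauchy_Schwarz_ineq2 mult_mono]) (auto intro: order_trans[OF norm_ge_zero])

lemma c_inner_abs_le:
  assumes "l \<in> P" "norm v \<le> t" shows "\<bar>c l \<bullet> v\<bar> \<le> t"
  using abs_inner_le[of "c l" 1 v t] c_norm P_subset assms by auto

lemma best_rate_abs_le:
  assumes "l \<in> P" shows "\<bar>best_rate S (c l) m\<bar> \<le> D"
proof -
  obtain s where "s \<in> S m" "c l \<bullet> rvec s = best_rate S (c l) m" by (rule best_rate_attained)
  then show ?thesis using c_inner_abs_le[OF assms service_bound] by metis
qed

lemma loss_abs_le:
  assumes "z \<in> set_pmf (law x)" "l \<in> P" shows "\<bar>loss x z l\<bar> \<le> 3 * D"
  using best_rate_abs_le[OF assms(2), of "channel z"] c_inner_abs_le[OF assms(2) step_bounds(2)[OF assms(1)]]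
    c_inner_abs_le[OF assms(2) step_bounds(3)[OF assms(1)]]
  unfolding loss_def by linarith

lemma integrable_E_loss:
  assumes "l \<in> P" shows "integrable (measure_pmf \<pi>) (\<lambda>x. E x (\<lambda>z. loss x z l))"
  by (rule integrable_E_bounded[where g = "\<lambda>_. 3 * D"]) (use loss_abs_le assms in auto)

text \<open>The mean of \<open>c l \<bullet> q\<close> is constant and arrivals bring \<open>(1 - \<epsilon>) * b l\<close> per slot, while the maximal
  rates average to \<open>b l\<close>; the losses account for the difference.\<close>

lemma expected_loss:
  assumes l: "l \<in> P"
  shows "E\<pi> (\<lambda>x. E x (\<lambda>z. loss x z l)) = \<epsilon> * b l"
proof -
  have "E x (\<lambda>z. c l \<bullet> rvec (next_state x z) - c l \<bullet> rvec x) = E x (\<lambda>z. loss x z l) - \<epsilon> * b l" for x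
  proof -
    have "E x (\<lambda>z. c l \<bullet> rvec (next_state x z) - c l \<bullet> rvec x) =
        E x (\<lambda>z. c l \<bullet> arrived z + (loss x z l - best_rate S (c l) (channel z)))"
      by (intro E_cong) (simp add: rvec_next_queue loss_def inner_add_right inner_diff_right)
    also have "\<dots> = (1 - \<epsilon>) * b l + (E x (\<lambda>z. loss x z l) - E x (\<lambda>z. best_rate S (c l) (channel z)))"
      by (simp add: E_inner_arrived P_tight[OF l])
    also have "E x (\<lambda>z. best_rate S (c l) (channel z)) = b l"
      by (simp add: E_channel[of x "best_rate S (c l)"] expectation_channel sum_best_rate_tight[OF l])
    finally show ?thesis by (simp add: algebra_simps)
  qed
  moreover have "E\<pi> (\<lambda>x. E x (\<lambda>z. c l \<bullet> rvec (next_state x z) - c l \<bullet> rvec x)) = 0"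
  proof (rule stationary_drift[where g = "\<lambda>_. 2 * D"])
    fix x z assume "z \<in> set_pmf (law x)"
    from c_inner_abs_le[OF l step_bounds(4)[OF this]]
    show "\<bar>c l \<bullet> rvec (next_state x z) - c l \<bullet> rvec x\<bar> \<le> 2 * D" by (simp add: inner_diff_right)
  qed auto
  ultimately have "E\<pi> (\<lambda>x. E x (\<lambda>z. loss x z l) - \<epsilon> * b l) = 0" by simp
  then show ?thesis using integrable_E_loss[OF l] by simp
qed

definition bad_prob :: "nat ^ 'n \<Rightarrow> real" where "bad_prob x = E x (\<lambda>z. of_bool (bad x z))"

lemma bad_prob_bounds: "0 \<le> bad_prob x" "bad_prob x \<le> 1"
proof -
  show "0 \<le> bad_prob x" unfolding bad_prob_def by (intro integral_nonneg_AE) auto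
  have "bad_prob x \<le> E x (\<lambda>_. 1)" unfolding bad_prob_def by (intro E_mono) auto
  then show "bad_prob x \<le> 1" by simp
qed

lemma integrable_bad_prob: "integrable (measure_pmf \<pi>) bad_prob"
  by (rule integrable_pmf_bounded[of _ 1]) (use bad_prob_bounds in auto)

definition b_total :: real where "b_total = (\<Sum>l\<in>P. b l)"

lemma expected_bad_prob: "E\<pi> bad_prob \<le> \<epsilon> * b_total / \<gamma>"
proof -
  have "bad_prob x \<le> (\<Sum>l\<in>P. E x (\<lambda>z. loss x z l)) / \<gamma>" for x
  proof -
    have "bad_prob x \<le> E x (\<lambda>z. (\<Sum>l\<in>P. loss x z l) / \<gamma>)"
      unfolding bad_prob_def by (rule E_mono) (rule bad_le_loss)
    then show ?thesis by simp
  qed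
  then have "E\<pi> bad_prob \<le> E\<pi> (\<lambda>x. (\<Sum>l\<in>P. E x (\<lambda>z. loss x z l)) / \<gamma>)"
    using integrable_bad_prob integrable_E_loss by (intro integral_mono) auto
  also have "\<dots> = (\<Sum>l\<in>P. E\<pi> (\<lambda>x. E x (\<lambda>z. loss x z l))) / \<gamma>"
    using integrable_E_loss by simp
  also have "\<dots> = \<epsilon> * b_total / \<gamma>"
    by (simp add: expected_loss b_total_def sum_distrib_left)
  finally show ?thesis .
qed

lemma b_total_nonneg: "0 \<le> b_total"
  unfolding b_total_def using b_pos P_subset by (intro sum_nonneg) (auto simp: less_imp_le)

text \<open>The source of the logarithm. A bad slot has probability \<open>O(\<epsilon>)\<close>, and the distance \<open>g\<close> exceeds
  \<open>t = ln (1 / \<epsilon>) / \<theta>\<close> by at most \<open>exp (\<theta> * (g - t)) / \<theta> = \<epsilon> * exp (\<theta> * g) / \<theta>\<close>, whose mean is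
  \<open>O(\<epsilon>)\<close> too.\<close>

lemma cone_dist_times_bad:
  "integrable (measure_pmf \<pi>) (\<lambda>x. (1 + cone_dist (rvec x)) * bad_prob x)"
  "E\<pi> (\<lambda>x. (1 + cone_dist (rvec x)) * bad_prob x) \<le>
     \<epsilon> * ((1 + ln (1 / \<epsilon>) / \<theta>) * b_total / \<gamma> + M / \<theta>)"
proof -
  define t where "t = ln (1 / \<epsilon>) / \<theta>"
  have t0: "0 \<le> t" using \<epsilon>_pos \<epsilon>_le \<theta>_pos by (simp add: t_def)
  have le: "(1 + cone_dist (rvec x)) * bad_prob x \<le> (1 + t) * bad_prob x + \<epsilon> / \<theta> * exp (\<theta> * cone_dist (rvec x))" for x
  proof -
    let ?g = "cone_dist (rvec x)"
    have "\<theta> * (?g - t) \<le> exp (\<theta> * (?g - t))" using exp_ge_add_one_self[of "\<theta> * (?g - t)"] by linarith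
    also have "\<dots> = exp (\<theta> * ?g) * exp (- (\<theta> * t))" by (simp add: exp_add[symmetric] algebra_simps)
    \<comment> \<open>the level \<open>t\<close> is chosen for this\<close>
    also have "exp (- (\<theta> * t)) = \<epsilon>" using \<theta>_pos \<epsilon>_pos by (simp add: t_def ln_div)
    finally have "?g - t \<le> \<epsilon> / \<theta> * exp (\<theta> * ?g)" using \<theta>_pos by (simp add: field_simps)
    then have "(?g - t) * bad_prob x \<le> (\<epsilon> / \<theta> * exp (\<theta> * ?g)) * bad_prob x"
      using bad_prob_bounds(1) by (rule mult_right_mono)
    also have "\<dots> \<le> (\<epsilon> / \<theta> * exp (\<theta> * ?g)) * 1"
      using bad_prob_bounds \<epsilon>_pos \<theta>_pos by (intro mult_left_mono) auto
    finally show ?thesis by (simp add: algebra_simps)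
  qed
  have int: "integrable (measure_pmf \<pi>) (\<lambda>x. (1 + t) * bad_prob x + \<epsilon> / \<theta> * exp (\<theta> * cone_dist (rvec x)))"
    using integrable_bad_prob exp_cone_dist_bound(1)
    by (intro Bochner_Integration.integrable_add integrable_mult_right) auto
  show int': "integrable (measure_pmf \<pi>) (\<lambda>x. (1 + cone_dist (rvec x)) * bad_prob x)"
  proof (rule Bochner_Integration.integrable_bound[OF int])
    show "AE x in measure_pmf \<pi>. norm ((1 + cone_dist (rvec x)) * bad_prob x) \<le>
      norm ((1 + t) * bad_prob x + \<epsilon> / \<theta> * exp (\<theta> * cone_dist (rvec x)))"
    proof (rule AE_I2)
      fix x
      have "0 \<le> (1 + cone_dist (rvec x)) * bad_prob x" using cone_dist_nonneg bad_prob_bounds by simp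
      then show "norm ((1 + cone_dist (rvec x)) * bad_prob x) \<le>
          norm ((1 + t) * bad_prob x + \<epsilon> / \<theta> * exp (\<theta> * cone_dist (rvec x)))"
        using le[of x] by simp
    qed
  qed auto
  have "E\<pi> (\<lambda>x. (1 + cone_dist (rvec x)) * bad_prob x) \<le>
      E\<pi> (\<lambda>x. (1 + t) * bad_prob x + \<epsilon> / \<theta> * exp (\<theta> * cone_dist (rvec x)))"
    using int' int le by (rule integral_mono)
  also have "\<dots> = (1 + t) * E\<pi> bad_prob + \<epsilon> / \<theta> * E\<pi> (\<lambda>x. exp (\<theta> * cone_dist (rvec x)))"
    using integrable_bad_prob exp_cone_dist_bound(1) by simp
  also have "\<dots> \<le> (1 + t) * (\<epsilon> * b_total / \<gamma>) + \<epsilon> / \<theta> * M"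
    using expected_bad_prob exp_cone_dist_bound(2) t0 \<epsilon>_pos \<theta>_pos by (intro add_mono mult_left_mono) auto
  also have "\<dots> = \<epsilon> * ((1 + t) * b_total / \<gamma> + M / \<theta>)" by (simp add: algebra_simps)
  finally show "E\<pi> (\<lambda>x. (1 + cone_dist (rvec x)) * bad_prob x) \<le>
     \<epsilon> * ((1 + ln (1 / \<epsilon>) / \<theta>) * b_total / \<gamma> + M / \<theta>)" by (simp add: t_def)
qed

section \<open>Balance of the squared projection\<close>

lemma proj_diff: "proj (x - y) = proj x - proj y" and proj_add: "proj (x + y) = proj x + proj y"
  using linear_proj by (simp_all add: linear_diff linear_add)

text \<open>The change of the squared projection that the slot would cause if \<open>\<nu>_part\<close> were served and no
  service were wasted.\<close>

definition ideal_drift :: "nat ^ 'n \<Rightarrow> (nat ^ 'n) \<times> 'm \<times> (nat ^ 'n) \<Rightarrow> real" where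
  "ideal_drift x z = 2 * (proj (rvec x) \<bullet> (arrived z - \<nu>_part (channel z))) + (norm (proj (arrived z - \<nu>_part (channel z))))\<^sup>2"

text \<open>Expand the norms of both sides of \<open>p q' - p u = p q + p (a - s)\<close>. The product of the projections of
  \<open>q'\<close> and \<open>u\<close> does not vanish, although that of \<open>q'\<close> and \<open>u\<close> does.\<close>

lemma squared_projection_step:
  "(norm (proj (rvec (next_state x z))))\<^sup>2 - (norm (proj (rvec x)))\<^sup>2 =
     2 * (proj (rvec x) \<bullet> (arrived z - offered z)) + (norm (proj (arrived z - offered z)))\<^sup>2
       + 2 * (proj (rvec (next_state x z)) \<bullet> wasted x z) - (norm (proj (wasted x z)))\<^sup>2"
proof -
  let ?p = "proj (rvec x)" and ?p' = "proj (rvec (next_state x z))" and ?d = "proj (arrived z - offered z)"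
    and ?u = "proj (wasted x z)"
  have "rvec (next_state x z) = (rvec x + (arrived z - offered z)) + wasted x z" by (simp add: rvec_next_queue)
  then have "?p' = ?p + ?d + ?u" by (simp only: proj_add)
  then have "?p' - ?u = ?p + ?d" by simp
  then have "(norm (?p' - ?u))\<^sup>2 = (norm (?p + ?d))\<^sup>2" by simp
  then have "(norm ?p')\<^sup>2 - 2 * (?p' \<bullet> ?u) + (norm ?u)\<^sup>2 = (norm ?p)\<^sup>2 + 2 * (?p \<bullet> ?d) + (norm ?d)\<^sup>2"
    unfolding power2_norm_eq_inner by (simp add: inner_add inner_diff inner_commute)
  then show ?thesis
    unfolding inner_proj_left[of "rvec x" "arrived z - offered z"] inner_proj_left[of "rvec (next_state x z)" "wasted x z"]
    by linarith
qed

text \<open>On a good slot the two changes agree. On a bad one the delicate term is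
  \<open>p q \<bullet> (\<nu>_part m - s)\<close>, where \<open>p q\<close> is unbounded. It is bounded above because MaxWeight makes the
  product with \<open>q\<close> nonpositive, and below because the product with the nearest point of the cone is
  nonnegative; both points are within the distance to the cone of \<open>p q\<close>.\<close>

lemma step_close_to_ideal:
  assumes z: "z \<in> set_pmf (law x)"
  shows "\<bar>(norm (proj (rvec (next_state x z))))\<^sup>2 - (norm (proj (rvec x)))\<^sup>2 - ideal_drift x z\<bar> \<le>
    13 * D\<^sup>2 * ((1 + cone_dist (rvec x)) * of_bool (bad x z))"
proof (cases "bad x z")
  case False
  have "c l \<bullet> offered z = c l \<bullet> \<nu>_part (channel z)" if "l \<in> P" for l
    using False that \<nu>_part_tight[OF that law_support(2)[OF z]] by (auto simp: bad_def)
  then have s: "proj (offered z) = proj (\<nu>_part (channel z))" by (rule proj_eq_of_inner_eq)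
  have "proj (wasted x z) = proj 0"
    using False by (intro proj_eq_of_inner_eq) (auto simp: bad_def)
  then have u: "proj (wasted x z) = 0" using linear_proj by (simp add: linear_0)
  have "(norm (proj (rvec (next_state x z))))\<^sup>2 - (norm (proj (rvec x)))\<^sup>2 = ideal_drift x z"
    unfolding squared_projection_step ideal_drift_def inner_proj_left[of _ "wasted x z"] u
    by (simp add: proj_diff s inner_proj_left[of _ "arrived z - _"])
  then show ?thesis using False by simp
next
  case True
  let ?q = "rvec x" and ?q' = "rvec (next_state x z)" and ?v = "\<nu>_part (channel z)"
  note bounds = step_bounds[OF z]
  have vs: "norm (?v - offered z) \<le> 2 * D" and as: "norm (arrived z - offered z) \<le> 2 * D"
    and av: "norm (arrived z - ?v) \<le> 2 * D"
    using norm_triangle_ineq4[of ?v "offered z"] norm_triangle_ineq4[of "arrived z" "offered z"]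
      norm_triangle_ineq4[of "arrived z" ?v] bounds by linarith+
  have 1: "\<bar>proj ?q \<bullet> (?v - offered z)\<bar> \<le> cone_dist ?q * (2 * D)"
  proof -
    \<comment> \<open>upper bound through \<open>q\<close>, lower bound through the nearest point of the cone\<close>
    have "\<bar>(?q - proj ?q) \<bullet> (?v - offered z)\<bar> \<le> cone_dist ?q * (2 * D)"
      by (rule abs_inner_le[OF norm_diff_proj_le_cone_dist vs])
    moreover have "?q \<bullet> (?v - offered z) \<le> 0"
      using service_best[OF z] hull_best_rate[OF \<nu>_part(2)] by (simp add: inner_diff_right)
    moreover have "\<bar>(proj ?q - near ?q) \<bullet> (?v - offered z)\<bar> \<le> cone_dist ?q * (2 * D)"
      by (rule abs_inner_le[OF norm_proj_diff_near_le_cone_dist vs])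
    moreover have "0 \<le> near ?q \<bullet> (?v - offered z)"
      by (rule inner_\<nu>_part_service_nonneg[OF near_in_cone z])
    ultimately show ?thesis unfolding inner_diff_left by linarith
  qed
  have sq: "(norm (proj v))\<^sup>2 \<le> t\<^sup>2" if "norm v \<le> t" for v t
    using order_trans[OF norm_proj_le that] by (intro power_mono) auto
  have 2: "(norm (proj (arrived z - offered z)))\<^sup>2 \<le> (2 * D)\<^sup>2" "(norm (proj (arrived z - ?v)))\<^sup>2 \<le> (2 * D)\<^sup>2"
    "(norm (proj (wasted x z)))\<^sup>2 \<le> D\<^sup>2"
    by (rule sq[OF as], rule sq[OF av], rule sq[OF bounds(3)])
  have 3: "\<bar>proj ?q' \<bullet> wasted x z\<bar> \<le> (cone_dist ?q + 2 * D) * D"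
  proof -
    have "cone_dist ?q' \<le> cone_dist ?q + 2 * D" using cone_dist_jump[OF z] by linarith
    then have "norm (?q' - proj ?q') \<le> cone_dist ?q + 2 * D" using norm_diff_proj_le_cone_dist order_trans by blast
    then have "\<bar>(?q' - proj ?q') \<bullet> wasted x z\<bar> \<le> (cone_dist ?q + 2 * D) * D"
      by (rule abs_inner_le[OF _ bounds(3)])
    then show ?thesis
      using rvec_next_inner_unused[of x "fst z" "snd (snd z)"] by (simp add: inner_diff_left)
  qed
  have "(norm (proj ?q'))\<^sup>2 - (norm (proj ?q))\<^sup>2 - ideal_drift x z =
      2 * (proj ?q \<bullet> (?v - offered z)) + (norm (proj (arrived z - offered z)))\<^sup>2 - (norm (proj (arrived z - ?v)))\<^sup>2
        + 2 * (proj ?q' \<bullet> wasted x z) - (norm (proj (wasted x z)))\<^sup>2"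
    unfolding squared_projection_step ideal_drift_def by (simp add: inner_diff_right)
  also have "\<bar>\<dots>\<bar> \<le> 2 * (cone_dist ?q * (2 * D)) + (2 * D)\<^sup>2 + (2 * D)\<^sup>2 + 2 * ((cone_dist ?q + 2 * D) * D) + D\<^sup>2"
    using 1 2 3 zero_le_power2[of "norm (proj (arrived z - offered z))"]
      zero_le_power2[of "norm (proj (arrived z - ?v))"] zero_le_power2[of "norm (proj (wasted x z))"]
    by linarith
  also have "\<dots> = 6 * (cone_dist ?q * D) + 13 * D\<^sup>2" by (simp add: power2_eq_square algebra_simps)
  also have "\<dots> \<le> 13 * D\<^sup>2 * (1 + cone_dist ?q)"
  proof -
    have "D \<le> D\<^sup>2" using D_ge mult_mono[of 1 D D D] by (simp add: power2_eq_square)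
    then have "cone_dist ?q * D \<le> cone_dist ?q * D\<^sup>2" using cone_dist_nonneg by (intro mult_left_mono)
    moreover have "0 \<le> cone_dist ?q * D\<^sup>2" using cone_dist_nonneg by simp
    ultimately have "6 * (cone_dist ?q * D) \<le> 13 * (cone_dist ?q * D\<^sup>2)" by linarith
    then show ?thesis by (simp add: algebra_simps)
  qed
  finally show ?thesis using True by simp
qed

text \<open>Twice \<open>\<epsilon>\<close> times the leading term of the theorem.\<close>

definition noise :: real where
  "noise = ones_form UNIV (hadamard (projection_matrix J c)
       (\<lambda>i j. covar (measure_pmf pa) (\<lambda>a. rvec a $ i) (\<lambda>a. rvec a $ j)))
     + ones_form J (hadamard (gram_inverse J c)
       (\<lambda>l l'. covar (measure_pmf \<psi>) (\<lambda>m. best_rate S (c l) m) (\<lambda>m. best_rate S (c l') m)))"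

lemma pa_integrable [simp]: "integrable (measure_pmf pa) (f :: _ \<Rightarrow> real)"
  by (rule integrable_measure_pmf_finite[OF arrivals_finite])

lemma \<psi>_integrable [simp]: "integrable (measure_pmf \<psi>) (f :: _ \<Rightarrow> real)"
  by (rule integrable_measure_pmf_finite) simp

lemma arrival_noise:
  "measure_pmf.expectation pa (\<lambda>a. (norm (proj (rvec a - (1 - \<epsilon>) *\<^sub>R \<nu>)))\<^sup>2) =
     ones_form UNIV (hadamard (projection_matrix J c)
       (\<lambda>i j. covar (measure_pmf pa) (\<lambda>a. rvec a $ i) (\<lambda>a. rvec a $ j)))"
  unfolding norm_gram_projection_sq_coordinates[OF J_basis(2-4)]
  by (simp add: ones_form_def hadamard_def covar_def arrivals_mean)

lemma channel_noise:
  "measure_pmf.expectation \<psi> (\<lambda>m. (norm (proj (\<nu> - \<nu>_part m)))\<^sup>2) =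
     ones_form J (hadamard (gram_inverse J c)
       (\<lambda>l l'. covar (measure_pmf \<psi>) (\<lambda>m. best_rate S (c l) m) (\<lambda>m. best_rate S (c l') m)))"
proof -
  have JP: "l \<in> P" if "l \<in> J" for l using J_basis(1) that by blast
  have mean: "measure_pmf.expectation \<psi> (\<lambda>m. best_rate S (c l) m) = b l" if "l \<in> J" for l
    using sum_best_rate_tight[OF JP[OF that]] by (simp add: expectation_channel)
  have "measure_pmf.expectation \<psi> (\<lambda>m. (c l \<bullet> (\<nu> - \<nu>_part m)) * (c l' \<bullet> (\<nu> - \<nu>_part m))) =
     covar (measure_pmf \<psi>) (\<lambda>m. best_rate S (c l) m) (\<lambda>m. best_rate S (c l') m)"
    if "l \<in> J" "l' \<in> J" for l l'
    unfolding covar_def mean[OF that(1)] mean[OF that(2)]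
    by (rule integral_cong_AE)
       (auto simp: AE_measure_pmf_iff inner_diff_right P_tight JP that \<nu>_part_tight algebra_simps)
  then show ?thesis
    unfolding norm_gram_projection_sq[OF J_basis(2-4)]
    by (simp add: ones_form_def hadamard_def)
qed

text \<open>Split \<open>a - \<nu>_part m\<close> into \<open>a - (1 - \<epsilon>) *\<^sub>R \<nu>\<close>, \<open>\<nu> - \<nu>_part m\<close> and \<open>- \<epsilon> *\<^sub>R \<nu>\<close>. The first two are
  centred and independent, so no cross term survives.\<close>

lemma noise_eq:
  "measure_pmf.expectation pa (\<lambda>a. measure_pmf.expectation \<psi> (\<lambda>m. (norm (proj (rvec a - \<nu>_part m)))\<^sup>2)) =
     noise + \<epsilon>\<^sup>2 * (norm (proj \<nu>))\<^sup>2"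
proof -
  let ?X = "\<lambda>a. proj (rvec a - (1 - \<epsilon>) *\<^sub>R \<nu>)" and ?Y = "\<lambda>m. proj (\<nu> - \<nu>_part m)"
  let ?Z = "- \<epsilon> *\<^sub>R proj \<nu>"
  have Y0: "measure_pmf.expectation \<psi> (\<lambda>m. v \<bullet> ?Y m) = 0" for v
  proof -
    have "v \<bullet> ?Y m = proj v \<bullet> \<nu> - proj v \<bullet> \<nu>_part m" for m
      using inner_proj_left[of v "\<nu> - \<nu>_part m"] inner_proj_left[of "\<nu> - \<nu>_part m" v]
      by (simp add: inner_commute inner_diff_right)
    then show ?thesis by (simp add: expectation_\<nu>_part)
  qed
  have X0: "measure_pmf.expectation pa (\<lambda>a. v \<bullet> ?X a) = 0" for v
  proof -
    have "v \<bullet> ?X a = proj v \<bullet> rvec a - (1 - \<epsilon>) * (proj v \<bullet> \<nu>)" for a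
      using inner_proj_left[of v "rvec a - (1 - \<epsilon>) *\<^sub>R \<nu>"] inner_proj_left[of "rvec a - (1 - \<epsilon>) *\<^sub>R \<nu>" v]
      by (simp add: inner_commute inner_diff_right)
    then show ?thesis by (simp add: expectation_arrivals_inner)
  qed
  have expand: "(norm (proj (rvec a - \<nu>_part m)))\<^sup>2 =
      (norm (?X a))\<^sup>2 + (norm (?Y m))\<^sup>2 + (norm ?Z)\<^sup>2 + 2 * ((?X a + ?Z) \<bullet> ?Y m) + 2 * (?Z \<bullet> ?X a)" for a m
  proof -
    have "rvec a - \<nu>_part m = (rvec a - (1 - \<epsilon>) *\<^sub>R \<nu>) + (\<nu> - \<nu>_part m) + (- \<epsilon>) *\<^sub>R \<nu>"
      by (simp add: algebra_simps)
    then have "proj (rvec a - \<nu>_part m) = ?X a + ?Y m + ?Z"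
      by (simp only: proj_add linear_scale[OF linear_proj])
    then show ?thesis
      unfolding power2_norm_eq_inner by (simp only:) (simp only: inner_add inner_commute algebra_simps)
  qed
  have "measure_pmf.expectation \<psi> (\<lambda>m. (norm (proj (rvec a - \<nu>_part m)))\<^sup>2) =
      (norm (?X a))\<^sup>2 + measure_pmf.expectation \<psi> (\<lambda>m. (norm (?Y m))\<^sup>2) + (norm ?Z)\<^sup>2 + 2 * (?Z \<bullet> ?X a)" for a
    unfolding expand using Y0[of "?X a + ?Z"] by simp
  then have "measure_pmf.expectation pa (\<lambda>a. measure_pmf.expectation \<psi> (\<lambda>m. (norm (proj (rvec a - \<nu>_part m)))\<^sup>2)) =
      measure_pmf.expectation pa (\<lambda>a. (norm (?X a))\<^sup>2) + measure_pmf.expectation \<psi> (\<lambda>m. (norm (?Y m))\<^sup>2) + (norm ?Z)\<^sup>2"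
    using X0[of ?Z] by simp
  then show ?thesis unfolding arrival_noise channel_noise noise_def by (simp add: power_mult_distrib)
qed

lemma E_ideal_drift:
  "E x (ideal_drift x) = noise + \<epsilon>\<^sup>2 * (norm (proj \<nu>))\<^sup>2 - 2 * \<epsilon> * (proj (rvec x) \<bullet> \<nu>)"
proof -
  have "E x (ideal_drift x) = 2 * (E x (\<lambda>z. proj (rvec x) \<bullet> arrived z) - E x (\<lambda>z. proj (rvec x) \<bullet> \<nu>_part (channel z)))
      + E x (\<lambda>z. (norm (proj (arrived z - \<nu>_part (channel z))))\<^sup>2)"
    unfolding ideal_drift_def by (simp add: inner_diff_right)
  also have "E x (\<lambda>z. (norm (proj (arrived z - \<nu>_part (channel z))))\<^sup>2) = noise + \<epsilon>\<^sup>2 * (norm (proj \<nu>))\<^sup>2"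
    using E_pair[of x "\<lambda>a m. (norm (proj (rvec a - \<nu>_part m)))\<^sup>2"] by (simp add: noise_eq)
  finally show ?thesis by (simp add: E_inner_arrived E_\<nu>_part algebra_simps)
qed

lemma integrable_inner_queue:
  assumes "\<And>x. norm (f x) \<le> norm (rvec x)"
  shows "integrable (measure_pmf \<pi>) (\<lambda>x. f x \<bullet> w)"
proof (rule Bochner_Integration.integrable_bound)
  show "integrable (measure_pmf \<pi>) (\<lambda>x. norm (rvec x) * norm w)"
    using integrable_queue by (rule integrable_mult_left)
  show "AE x in measure_pmf \<pi>. norm (f x \<bullet> w) \<le> norm (norm (rvec x) * norm w)"
    using abs_inner_le[OF assms order_refl] by (intro AE_I2) (simp add: abs_mult)
qed auto

lemma projected_queue_identity:
  "\<bar>noise + \<epsilon>\<^sup>2 * (norm (proj \<nu>))\<^sup>2 - 2 * \<epsilon> * E\<pi> (\<lambda>x. proj (rvec x) \<bullet> \<nu>)\<bar> \<le>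
     13 * D\<^sup>2 * E\<pi> (\<lambda>x. (1 + cone_dist (rvec x)) * bad_prob x)"
proof -
  let ?V = "\<lambda>x. (norm (proj (rvec x)))\<^sup>2"
  let ?r = "\<lambda>x. E x (\<lambda>z. ?V (next_state x z) - ?V x) - E x (ideal_drift x)"
  have D0: "0 \<le> D" using D_ge by simp
  have int_g: "integrable (measure_pmf \<pi>) (\<lambda>x. 2 * D * (2 * norm (rvec x) + 2 * D))"
    using integrable_queue by simp
  have jump: "\<bar>?V (next_state x z) - ?V x\<bar> \<le> 2 * D * (2 * norm (rvec x) + 2 * D)"
    if z: "z \<in> set_pmf (law x)" for x z
  proof -
    let ?p = "proj (rvec x)" and ?p' = "proj (rvec (next_state x z))"
    have d: "norm (?p' - ?p) \<le> 2 * D"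
      unfolding proj_diff[symmetric] using norm_proj_le step_bounds(4)[OF z] by (rule order_trans)
    then have "norm ?p' \<le> norm ?p + 2 * D" using norm_triangle_ineq2[of ?p' ?p] by linarith
    then have s: "norm ?p' + norm ?p \<le> 2 * norm (rvec x) + 2 * D"
      using norm_proj_le[of "rvec x"] by linarith
    have "\<bar>?V (next_state x z) - ?V x\<bar> = \<bar>norm ?p' - norm ?p\<bar> * (norm ?p' + norm ?p)"
      by (simp add: power2_eq_square square_diff_square_factored abs_mult)
    also have "\<dots> \<le> 2 * D * (2 * norm (rvec x) + 2 * D)"
      using norm_triangle_ineq3[of ?p' ?p] d s D0 by (intro mult_mono) auto
    finally show ?thesis .
  qed
  have zero: "E\<pi> (\<lambda>x. E x (\<lambda>z. ?V (next_state x z) - ?V x)) = 0"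
    by (rule stationary_drift[OF int_g jump])
  have int1: "integrable (measure_pmf \<pi>) (\<lambda>x. E x (\<lambda>z. ?V (next_state x z) - ?V x))"
    by (rule integrable_E_bounded[OF int_g jump])
  have int2: "integrable (measure_pmf \<pi>) (\<lambda>x. proj (rvec x) \<bullet> \<nu>)"
    by (rule integrable_inner_queue) (rule norm_proj_le)
  then have int3: "integrable (measure_pmf \<pi>) (\<lambda>x. E x (ideal_drift x))"
    unfolding E_ideal_drift by simp
  have r: "\<bar>?r x\<bar> \<le> 13 * D\<^sup>2 * ((1 + cone_dist (rvec x)) * bad_prob x)" for x
  proof -
    have "\<bar>E x (\<lambda>z. ?V (next_state x z) - ?V x - ideal_drift x z)\<bar> \<le>
        E x (\<lambda>z. \<bar>?V (next_state x z) - ?V x - ideal_drift x z\<bar>)" by (rule integral_abs_bound)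
    also have "\<dots> \<le> E x (\<lambda>z. 13 * D\<^sup>2 * ((1 + cone_dist (rvec x)) * of_bool (bad x z)))"
      by (rule E_mono) (rule step_close_to_ideal)
    finally show ?thesis by (simp add: bad_prob_def)
  qed
  have "E\<pi> (\<lambda>x. E x (ideal_drift x)) = - E\<pi> ?r" using zero int1 int3 by simp
  moreover have "\<bar>E\<pi> ?r\<bar> \<le> E\<pi> (\<lambda>x. 13 * D\<^sup>2 * ((1 + cone_dist (rvec x)) * bad_prob x))"
    by (rule order_trans[OF integral_abs_bound integral_mono])
       (use int1 int3 r cone_dist_times_bad(1) in auto)
  ultimately show ?thesis using int2 cone_dist_times_bad(1) unfolding E_ideal_drift by simp
qed

text \<open>The three summands come from replacing \<open>q \<bullet> w\<close> by \<open>p q \<bullet> \<nu>\<close>, from the term of order \<open>\<epsilon>\<^sup>2\<close> in the ideal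
  drift, and from the bad slots.\<close>

definition \<beta> :: real where
  "\<beta> = D * M / \<theta> + D\<^sup>2 / 2 + 13 * D\<^sup>2 / 2 * ((1 + 1 / \<theta>) * b_total / \<gamma> + M / \<theta>)"

lemma expected_cone_dist: "integrable (measure_pmf \<pi>) (\<lambda>x. cone_dist (rvec x))" "E\<pi> (\<lambda>x. cone_dist (rvec x)) \<le> M / \<theta>"
proof -
  have le: "cone_dist (rvec x) \<le> exp (\<theta> * cone_dist (rvec x)) / \<theta>" for x
  proof -
    have "\<theta> * cone_dist (rvec x) \<le> exp (\<theta> * cone_dist (rvec x))"
      using exp_ge_add_one_self[of "\<theta> * cone_dist (rvec x)"] by linarith
    then show ?thesis using \<theta>_pos by (simp add: pos_le_divide_eq mult.commute)
  qed
  have int: "integrable (measure_pmf \<pi>) (\<lambda>x. exp (\<theta> * cone_dist (rvec x)) / \<theta>)"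
    using exp_cone_dist_bound(1) by simp
  show i: "integrable (measure_pmf \<pi>) (\<lambda>x. cone_dist (rvec x))"
    by (rule Bochner_Integration.integrable_bound[OF int])
       (use le cone_dist_nonneg \<theta>_pos in \<open>auto intro!: AE_I2 simp: abs_of_nonneg\<close>)
  have "E\<pi> (\<lambda>x. cone_dist (rvec x)) \<le> E\<pi> (\<lambda>x. exp (\<theta> * cone_dist (rvec x)) / \<theta>)"
    using i int le by (rule integral_mono)
  also have "\<dots> \<le> M / \<theta>" using exp_cone_dist_bound(2) \<theta>_pos by (simp add: divide_right_mono)
  finally show "E\<pi> (\<lambda>x. cone_dist (rvec x)) \<le> M / \<theta>" .
qed

theorem heavy_traffic_bound:
  assumes w: "w \<in> region" "\<And>l. l \<in> P \<Longrightarrow> c l \<bullet> w = b l"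
  shows "integrable (measure_pmf \<pi>) (\<lambda>x. rvec x \<bullet> w)"
    and "\<bar>E\<pi> (\<lambda>x. rvec x \<bullet> w) - noise / (2 * \<epsilon>)\<bar> \<le> \<beta> * ln (1 / \<epsilon>)"
proof -
  show int_w: "integrable (measure_pmf \<pi>) (\<lambda>x. rvec x \<bullet> w)"
    by (rule integrable_inner_queue) simp
  have int_p: "integrable (measure_pmf \<pi>) (\<lambda>x. proj (rvec x) \<bullet> \<nu>)"
    by (rule integrable_inner_queue) (rule norm_proj_le)
  \<comment> \<open>from \<open>\<epsilon> \<le> 1 / 3\<close>; it absorbs all constants into the logarithm\<close>
  have ln1: "1 \<le> ln (1 / \<epsilon>)"
  proof -
    have "exp 1 \<le> (3 :: real)" by (rule exp_le)
    also have "3 \<le> 1 / \<epsilon>" using \<epsilon>_pos \<epsilon>_le by (simp add: field_simps)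
    finally show ?thesis using \<epsilon>_pos by (subst ln_ge_iff) auto
  qed
  have D0: "0 \<le> D" using D_ge by simp
  have near_w: "\<bar>rvec x \<bullet> w - proj (rvec x) \<bullet> \<nu>\<bar> \<le> cone_dist (rvec x) * D" for x
  proof -
    have "proj (rvec x) \<bullet> w = proj (rvec x) \<bullet> \<nu>"
      by (rule inner_span_eq[OF _ proj_span]) (simp add: w(2) P_tight)
    then show ?thesis
      using abs_inner_le[OF norm_diff_proj_le_cone_dist region_norm[OF w(1)], of "rvec x"]
      by (simp add: inner_diff_left)
  qed
  have "\<bar>E\<pi> (\<lambda>x. rvec x \<bullet> w) - E\<pi> (\<lambda>x. proj (rvec x) \<bullet> \<nu>)\<bar> =
      \<bar>E\<pi> (\<lambda>x. rvec x \<bullet> w - proj (rvec x) \<bullet> \<nu>)\<bar>" using int_w int_p by simp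
  also have "\<dots> \<le> E\<pi> (\<lambda>x. cone_dist (rvec x) * D)"
    by (rule order_trans[OF integral_abs_bound integral_mono])
       (use int_w int_p near_w expected_cone_dist(1) in auto)
  also have "\<dots> \<le> M / \<theta> * D" using mult_right_mono[OF expected_cone_dist(2) D0] integral_mult_left_zero by metis
  finally have 1: "\<bar>E\<pi> (\<lambda>x. rvec x \<bullet> w) - E\<pi> (\<lambda>x. proj (rvec x) \<bullet> \<nu>)\<bar> \<le> D * M / \<theta>"
    by (simp add: mult.commute)
  let ?R = "(1 + ln (1 / \<epsilon>) / \<theta>) * b_total / \<gamma> + M / \<theta>"
  let ?n = "(norm (proj \<nu>))\<^sup>2" and ?e = "E\<pi> (\<lambda>x. proj (rvec x) \<bullet> \<nu>)"
  have 2: "\<bar>?e - noise / (2 * \<epsilon>)\<bar> \<le> \<epsilon> * ?n / 2 + 13 * D\<^sup>2 / 2 * ?R"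
  proof -
    have "\<bar>noise + \<epsilon>\<^sup>2 * ?n - 2 * \<epsilon> * ?e\<bar> \<le> 13 * D\<^sup>2 * (\<epsilon> * ?R)"
      by (rule order_trans[OF projected_queue_identity mult_left_mono[OF cone_dist_times_bad(2)]]) simp
    then have "\<bar>2 * \<epsilon> * ?e - noise\<bar> \<le> \<epsilon>\<^sup>2 * ?n + 13 * D\<^sup>2 * (\<epsilon> * ?R)"
      using zero_le_power2[of \<epsilon>] zero_le_power2[of "norm (proj \<nu>)"] mult_nonneg_nonneg[of "\<epsilon>\<^sup>2" ?n]
      by linarith
    then have "\<bar>2 * \<epsilon> * ?e - noise\<bar> / (2 * \<epsilon>) \<le> (\<epsilon>\<^sup>2 * ?n + 13 * D\<^sup>2 * (\<epsilon> * ?R)) / (2 * \<epsilon>)"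
      using \<epsilon>_pos by (intro divide_right_mono) auto
    also have "\<dots> = \<epsilon> * ?n / 2 + 13 * D\<^sup>2 / 2 * ?R"
      using \<epsilon>_pos by (simp add: add_divide_distrib power2_eq_square)
    also have "\<bar>2 * \<epsilon> * ?e - noise\<bar> / (2 * \<epsilon>) = \<bar>?e - noise / (2 * \<epsilon>)\<bar>"
    proof -
      have "?e - noise / (2 * \<epsilon>) = (2 * \<epsilon> * ?e - noise) / (2 * \<epsilon>)"
        using \<epsilon>_pos by (simp add: diff_divide_distrib)
      then show ?thesis using \<epsilon>_pos by (simp add: abs_divide)
    qed
    finally show ?thesis .
  qed
  have 3: "\<epsilon> * ?n / 2 \<le> D\<^sup>2 / 2"
  proof -
    have "norm (proj \<nu>) \<le> D" using norm_proj_le region_norm[OF \<nu>_in_region] by (rule order_trans)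
    then have "?n \<le> D\<^sup>2" by (intro power_mono) auto
    moreover have "\<epsilon> * ?n \<le> 1 * ?n" using \<epsilon>_le by (intro mult_right_mono) auto
    ultimately show ?thesis by simp
  qed
  have 4: "?R \<le> ln (1 / \<epsilon>) * ((1 + 1 / \<theta>) * b_total / \<gamma> + M / \<theta>)"
  proof -
    have "(1 + ln (1 / \<epsilon>) / \<theta>) * (b_total / \<gamma>) \<le> (ln (1 / \<epsilon>) * (1 + 1 / \<theta>)) * (b_total / \<gamma>)"
      using ln1 b_total_nonneg \<gamma>_pos by (intro mult_right_mono) (auto simp: distrib_left)
    moreover have "1 * (M / \<theta>) \<le> ln (1 / \<epsilon>) * (M / \<theta>)"
      using ln1 M_pos \<theta>_pos by (intro mult_right_mono) auto
    ultimately have "(1 + ln (1 / \<epsilon>) / \<theta>) * (b_total / \<gamma>) + M / \<theta> \<le>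
        (ln (1 / \<epsilon>) * (1 + 1 / \<theta>)) * (b_total / \<gamma>) + ln (1 / \<epsilon>) * (M / \<theta>)" by linarith
    then show ?thesis by (simp add: algebra_simps add_divide_distrib)
  qed
  have 5: "1 * (D * M / \<theta> + D\<^sup>2 / 2) \<le> ln (1 / \<epsilon>) * (D * M / \<theta> + D\<^sup>2 / 2)"
    using ln1 M_pos \<theta>_pos D0 by (intro mult_right_mono) auto
  have "\<bar>E\<pi> (\<lambda>x. rvec x \<bullet> w) - noise / (2 * \<epsilon>)\<bar> \<le> D * M / \<theta> + D\<^sup>2 / 2 + 13 * D\<^sup>2 / 2 * ?R"
    using 1 2 3 by linarith
  also have "\<dots> \<le> D * M / \<theta> + D\<^sup>2 / 2 + 13 * D\<^sup>2 / 2 * (ln (1 / \<epsilon>) * ((1 + 1 / \<theta>) * b_total / \<gamma> + M / \<theta>))"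
    using 4 by (intro add_left_mono mult_left_mono) auto
  also have "\<dots> \<le> ln (1 / \<epsilon>) * (D * M / \<theta> + D\<^sup>2 / 2) + 13 * D\<^sup>2 / 2 * (ln (1 / \<epsilon>) * ((1 + 1 / \<theta>) * b_total / \<gamma> + M / \<theta>))"
    using 5 by simp
  also have "\<dots> = \<beta> * ln (1 / \<epsilon>)" unfolding \<beta>_def by (simp only: algebra_simps)
  finally show "\<bar>E\<pi> (\<lambda>x. rvec x \<bullet> w) - noise / (2 * \<epsilon>)\<bar> \<le> \<beta> * ln (1 / \<epsilon>)" .
qed

end

section \<open>Invariance of the limit law\<close>

lemma inj_rvec: "inj (rvec :: nat ^ 'n \<Rightarrow> real ^ 'n)"
  by (auto simp: inj_def rvec_def vec_eq_iff)

lemma dist_rvec_less_1: "dist (rvec x) (rvec y) < 1 \<Longrightarrow> x = y"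
proof (rule ccontr)
  assume d: "dist (rvec x) (rvec y) < 1" and "x \<noteq> y"
  then obtain i where i: "x $ i \<noteq> y $ i" by (auto simp: vec_eq_iff)
  have "\<bar>real (x $ i) - real (y $ i)\<bar> \<le> dist (rvec x) (rvec y)"
    using component_le_norm_cart[of "rvec x - rvec y" i] by (simp add: dist_norm rvec_def)
  moreover have "1 \<le> \<bar>real (x $ i) - real (y $ i)\<bar>" using i by linarith
  ultimately show False using d by linarith
qed

text \<open>The integer lattice is closed and discrete, so by Tietze's theorem every bounded function on it
  extends to a bounded continuous test function.\<close>

lemma converges_in_distribution_bounded:
  fixes f :: "nat ^ 'n \<Rightarrow> real"
  assumes conv: "converges_in_distribution \<Omega> X \<pi>" and bd: "\<And>x. \<bar>f x\<bar> \<le> B"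
  shows "(\<lambda>k. integral\<^sup>L \<Omega> (\<lambda>\<omega>. f (X k \<omega>))) \<longlonglongrightarrow> measure_pmf.expectation \<pi> f"
proof -
  define h where "h = (\<lambda>y :: real ^ 'n. f (inv rvec y))"
  have h: "h (rvec x) = f x" for x by (simp add: h_def inv_f_f[OF inj_rvec])
  have cont: "continuous_on (range (rvec :: nat ^ 'n \<Rightarrow> real ^ 'n)) h"
    unfolding continuous_on_iff
  proof (intro ballI allI impI)
    fix y :: "real ^ 'n" and e :: real assume "y \<in> range rvec" "0 < e"
    then show "\<exists>d>0. \<forall>y'\<in>range (rvec :: nat ^ 'n \<Rightarrow> real ^ 'n). dist y' y < d \<longrightarrow> dist (h y') (h y) < e"
      by (intro exI[of _ 1]) (auto dest: dist_rvec_less_1)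
  qed
  have "closed (range (rvec :: nat ^ 'n \<Rightarrow> real ^ 'n))"
    by (rule discrete_imp_closed[of 1]) (auto dest: dist_rvec_less_1)
  then have cl: "closedin (top_of_set UNIV) (range (rvec :: nat ^ 'n \<Rightarrow> real ^ 'n))" by simp
  have B: "0 \<le> B" using bd[of undefined] by linarith
  obtain g where g: "continuous_on UNIV g" "\<And>y. y \<in> range rvec \<Longrightarrow> g y = h y"
    "\<And>y. y \<in> UNIV \<Longrightarrow> norm (g y) \<le> B"
    by (rule Tietze[OF cont cl B]) (auto simp: h bd)
  have "bounded (range g)" using g(3) by (auto simp: bounded_iff)
  then have "(\<lambda>k. integral\<^sup>L \<Omega> (\<lambda>\<omega>. g (rvec (X k \<omega>)))) \<longlonglongrightarrow>
      measure_pmf.expectation \<pi> (\<lambda>x. g (rvec x))"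
    using conv g(1) unfolding converges_in_distribution_def by blast
  then show ?thesis by (simp add: g(2) h)
qed

text \<open>On a countable type every distribution is discrete, so that the law of a random variable can be
  treated as a mass function.\<close>

definition law_pmf :: "'w measure \<Rightarrow> ('w \<Rightarrow> 'b) \<Rightarrow> 'b pmf" where
  "law_pmf M X = Abs_pmf (distr M (count_space UNIV) X)"

lemma measure_pmf_law_pmf:
  fixes X :: "'w \<Rightarrow> 'b::countable"
  assumes "prob_space M" and X: "X \<in> M \<rightarrow>\<^sub>M count_space UNIV"
  shows "measure_pmf (law_pmf M X) = distr M (count_space UNIV) X"
proof -
  interpret prob_space M by fact
  let ?D = "distr M (count_space UNIV) X"
  interpret D: prob_space ?D by (rule prob_space_distr[OF X])
  have "(\<Union>x\<in>{x. measure ?D {x} = 0}. {x}) \<in> null_sets ?D"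
    by (rule null_sets_UN') (auto simp: D.emeasure_eq_measure)
  then have "AE x in ?D. measure ?D {x} \<noteq> 0"
    by (rule AE_I') auto
  then show ?thesis
    unfolding law_pmf_def by (subst Abs_pmf_inverse) (auto simp: D.prob_space_axioms)
qed

lemma expectation_law_pmf:
  fixes X :: "'w \<Rightarrow> 'b::countable" and f :: "'b \<Rightarrow> real"
  assumes "prob_space M" and X: "X \<in> M \<rightarrow>\<^sub>M count_space UNIV"
  shows "measure_pmf.expectation (law_pmf M X) f = integral\<^sup>L M (\<lambda>\<omega>. f (X \<omega>))"
  unfolding measure_pmf_law_pmf[OF assms] by (rule integral_distr[OF X]) simp

lemma law_pmf_support:
  fixes X :: "'w \<Rightarrow> 'b::countable"
  assumes "prob_space M" and X: "X \<in> M \<rightarrow>\<^sub>M count_space UNIV" and "AE \<omega> in M. Q (X \<omega>)"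
    and "x \<in> set_pmf (law_pmf M X)"
  shows "Q x"
proof -
  have "AE x in measure_pmf (law_pmf M X). Q x"
    unfolding measure_pmf_law_pmf[OF assms(1,2)] using assms(3) by (subst AE_distr_iff[OF X]) auto
  then show ?thesis using assms(4) by (simp add: AE_measure_pmf_iff)
qed

text \<open>The queue length process of one switch as a random recursion driven by i.i.d. slot inputs.\<close>

locale switch_process =
  fixes \<Omega> :: "'w measure" and \<psi> :: "'m::finite pmf"
    and a :: "nat \<Rightarrow> 'w \<Rightarrow> nat ^ 'n::finite" and m :: "nat \<Rightarrow> 'w \<Rightarrow> 'm" and r :: "nat \<Rightarrow> 'w \<Rightarrow> real"
    and x :: "'w \<Rightarrow> nat ^ 'n" and \<sigma> :: "nat ^ 'n \<Rightarrow> 'm \<Rightarrow> real \<Rightarrow> nat ^ 'n"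
  assumes inputs: "switch_inputs \<Omega> \<psi> a m r x"
    and rule_measurable: "\<And>y ch. \<sigma> y ch \<in> borel \<rightarrow>\<^sub>M count_space UNIV"
begin

abbreviation N :: "((nat ^ 'n) \<times> 'm \<times> real) measure" where
  "N \<equiv> count_space UNIV \<Otimes>\<^sub>M (count_space UNIV \<Otimes>\<^sub>M borel)"
abbreviation input :: "nat \<Rightarrow> 'w \<Rightarrow> (nat ^ 'n) \<times> 'm \<times> real" where
  "input k \<omega> \<equiv> (a k \<omega>, m k \<omega>, r k \<omega>)"
abbreviation slot :: "((nat ^ 'n) \<times> 'm \<times> real) measure" where
  "slot \<equiv> distr \<Omega> (count_space UNIV) (a 1) \<Otimes>\<^sub>M (measure_pmf \<psi> \<Otimes>\<^sub>M distr \<Omega> borel (r 1))"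
abbreviation inputs_space :: "(nat \<Rightarrow> (nat ^ 'n) \<times> 'm \<times> real) measure" where
  "inputs_space \<equiv> PiM UNIV (\<lambda>_. N)"

lemma prob_space_\<Omega>: "prob_space \<Omega>"
  and indep_inputs: "prob_space.indep_vars \<Omega> (\<lambda>_. N) input UNIV"
  and input_law: "distr \<Omega> N (input k) = slot"
  and start_measurable: "x \<in> \<Omega> \<rightarrow>\<^sub>M count_space UNIV"
  and start_independent: "distr \<Omega> (count_space UNIV \<Otimes>\<^sub>M inputs_space) (\<lambda>\<omega>. (x \<omega>, \<lambda>k. input k \<omega>)) =
    distr \<Omega> (count_space UNIV) x \<Otimes>\<^sub>M distr \<Omega> inputs_space (\<lambda>\<omega> k. input k \<omega>)"
  using inputs unfolding switch_inputs_def Let_def by blast+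

sublocale prob_space \<Omega> by (rule prob_space_\<Omega>)

lemma input_measurable: "input k \<in> \<Omega> \<rightarrow>\<^sub>M N"
  using indep_inputs by (auto simp: indep_vars_def)

lemma arrivals_measurable: "a k \<in> \<Omega> \<rightarrow>\<^sub>M count_space UNIV"
  using measurable_compose[OF input_measurable[of k] measurable_fst] by simp

lemma ties_measurable: "r k \<in> \<Omega> \<rightarrow>\<^sub>M borel"
  using measurable_compose[OF measurable_compose[OF input_measurable[of k] measurable_snd] measurable_snd]
  by simp

lemma inputs_measurable: "(\<lambda>\<omega> k. input k \<omega>) \<in> \<Omega> \<rightarrow>\<^sub>M inputs_space"
  by (rule measurable_PiM_single') (auto intro: input_measurable simp: space_pair_measure)

lemma sets_slot: "sets slot = sets N"
  by (intro sets_pair_measure_cong) auto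

lemma prob_space_slot: "prob_space slot"
  unfolding input_law[of 0, symmetric] by (rule prob_space_distr[OF input_measurable])

definition advance :: "nat ^ 'n \<Rightarrow> (nat ^ 'n) \<times> 'm \<times> real \<Rightarrow> nat ^ 'n" where
  "advance y d = next_queue y (fst d) (\<sigma> y (fst (snd d)) (snd (snd d)))"

text \<open>The queue length as a function of the starting state and the whole input sequence; this makes
  explicit that it depends on past inputs only (\<open>run_restrict\<close>).\<close>

definition run :: "nat ^ 'n \<Rightarrow> (nat \<Rightarrow> (nat ^ 'n) \<times> 'm \<times> real) \<Rightarrow> nat \<Rightarrow> nat ^ 'n" where
  "run y d k = queue \<sigma> (\<lambda>j. fst (d j)) (\<lambda>j. fst (snd (d j))) (\<lambda>j. snd (snd (d j))) y k"

lemma run_simps: "run y d 0 = y" "run y d (Suc k) = advance (run y d k) (d k)"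
  by (simp_all add: run_def advance_def)

text \<open>Replaces the tie-breaking number, which is continuous, by the service vector that it selects,
  so that the law of a slot becomes discrete.\<close>

definition slot_outcome :: "nat ^ 'n \<Rightarrow> (nat ^ 'n) \<times> 'm \<times> real \<Rightarrow> (nat ^ 'n) \<times> 'm \<times> (nat ^ 'n)" where
  "slot_outcome y d = (fst d, fst (snd d), \<sigma> y (fst (snd d)) (snd (snd d)))"

lemma advance_outcome:
  "advance y d = next_queue y (fst (slot_outcome y d)) (snd (snd (slot_outcome y d)))"
  by (simp add: advance_def slot_outcome_def)

lemma slot_outcome_measurable: "slot_outcome y \<in> N \<rightarrow>\<^sub>M count_space UNIV"
proof (rule measurable_pair_measure_countable1)
  fix u :: "nat ^ 'n"
  show "(\<lambda>v. slot_outcome y (u, v)) \<in> count_space UNIV \<Otimes>\<^sub>M borel \<rightarrow>\<^sub>M count_space UNIV"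
  proof (rule measurable_pair_measure_countable1)
    fix ch :: 'm
    show "(\<lambda>\<rho>. slot_outcome y (u, ch, \<rho>)) \<in> borel \<rightarrow>\<^sub>M count_space UNIV"
      using measurable_compose[OF rule_measurable, of "\<lambda>s. (u, ch, s)" "count_space UNIV" y ch]
      by (simp add: slot_outcome_def)
  qed auto
qed auto

lemma advance_measurable: "advance y \<in> N \<rightarrow>\<^sub>M count_space UNIV"
  unfolding advance_outcome[abs_def]
  by (rule measurable_compose[OF slot_outcome_measurable]) simp

lemma advance_measurable_pair: "(\<lambda>(y, d). advance y d) \<in> count_space UNIV \<Otimes>\<^sub>M N \<rightarrow>\<^sub>M count_space UNIV"
  by (rule measurable_pair_measure_countable1) (auto intro: advance_measurable)

lemma run_measurable:
  assumes "{..<k} \<subseteq> I"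
  shows "(\<lambda>d. run y d k) \<in> PiM I (\<lambda>_. N) \<rightarrow>\<^sub>M count_space UNIV"
  using assms
proof (induction k)
  case 0 then show ?case by (simp add: run_simps)
next
  case (Suc k)
  have "{..<k} \<subseteq> I" using Suc.prems by (auto simp: lessThan_Suc)
  then have 1: "(\<lambda>d. run y d k) \<in> PiM I (\<lambda>_. N) \<rightarrow>\<^sub>M count_space UNIV" by (rule Suc.IH)
  have 2: "(\<lambda>d. d k) \<in> PiM I (\<lambda>_. N) \<rightarrow>\<^sub>M N" using Suc.prems by (intro measurable_component_singleton) auto
  from measurable_compose[OF measurable_Pair[OF 1 2] advance_measurable_pair]
  show ?case by (simp add: run_simps)
qed

lemma run_restrict: "k \<le> n \<Longrightarrow> run y (restrict d {..<n}) k = run y d k"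
  by (induction k) (auto simp: run_simps)

lemma run_measurable_pair:
  "(\<lambda>(y, d). run y d k) \<in> count_space UNIV \<Otimes>\<^sub>M inputs_space \<rightarrow>\<^sub>M count_space UNIV"
  by (rule measurable_pair_measure_countable1) (auto intro: run_measurable)

definition transition :: "(nat ^ 'n \<Rightarrow> real) \<Rightarrow> nat ^ 'n \<Rightarrow> real" where
  "transition f y = integral\<^sup>L slot (\<lambda>d. f (advance y d))"

lemma transition_bound:
  fixes f :: "nat ^ 'n \<Rightarrow> real"
  assumes bd: "\<And>y. \<bar>f y\<bar> \<le> B"
  shows "\<bar>transition f y\<bar> \<le> B"
proof -
  interpret slot: prob_space slot by (rule prob_space_slot)
  have "\<bar>transition f y\<bar> \<le> integral\<^sup>L slot (\<lambda>d. \<bar>f (advance y d)\<bar>)"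
    unfolding transition_def by (rule integral_abs_bound)
  also have "\<dots> \<le> B"
  proof (rule slot.integral_le_const)
    have "(\<lambda>d. \<bar>f (advance y d)\<bar>) \<in> borel_measurable slot"
      unfolding measurable_cong_sets[OF sets_slot refl]
      by (rule measurable_compose[OF advance_measurable]) simp
    then show "integrable slot (\<lambda>d. \<bar>f (advance y d)\<bar>)"
      by (rule slot.integrable_const_bound[of _ B, rotated]) (use bd in auto)
  qed (use bd in auto)
  finally show ?thesis .
qed

text \<open>For a fixed starting state, the state at time \<open>k\<close> depends on inputs before \<open>k\<close>, which are
  independent of input \<open>k\<close>. Independence is applied to the two restrictions of the input sequence, which
  have one type, as \<open>indep_var\<close> demands.\<close>

lemma transition_fixed_start:
  fixes f :: "nat ^ 'n \<Rightarrow> real"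
  assumes bd: "\<And>y. \<bar>f y\<bar> \<le> B"
  shows "expectation (\<lambda>\<omega>. f (run y (\<lambda>j. input j \<omega>) (Suc k))) =
    expectation (\<lambda>\<omega>. transition f (run y (\<lambda>j. input j \<omega>) k))"
proof -
  let ?past = "\<lambda>\<omega>. restrict (\<lambda>i. input i \<omega>) {..<k}" and ?now = "\<lambda>\<omega>. restrict (\<lambda>i. input i \<omega>) {k}"
  let ?M1 = "PiM {..<k} (\<lambda>_. N)" and ?M2 = "PiM {k} (\<lambda>_. N)"
  let ?L = "distr \<Omega> ?M1 ?past" and ?R = "distr \<Omega> ?M2 ?now"
  let ?F = "\<lambda>(d, e). f (advance (run y d k) (e k))"
  have "indep_var ?M1 ?past ?M2 ?now"
    by (rule indep_var_restrict[OF indep_inputs]) auto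
  then have joint: "distr \<Omega> (?M1 \<Otimes>\<^sub>M ?M2) (\<lambda>\<omega>. (?past \<omega>, ?now \<omega>)) = ?L \<Otimes>\<^sub>M ?R"
    and past: "?past \<in> \<Omega> \<rightarrow>\<^sub>M ?M1" and now: "?now \<in> \<Omega> \<rightarrow>\<^sub>M ?M2"
    unfolding indep_var_distribution_eq by auto
  interpret L: prob_space ?L by (rule prob_space_distr[OF past])
  interpret R: prob_space ?R by (rule prob_space_distr[OF now])
  interpret LR: pair_prob_space ?L ?R ..
  have run_meas: "(\<lambda>d. run y d k) \<in> ?M1 \<rightarrow>\<^sub>M count_space UNIV" by (rule run_measurable) simp
  have now_meas: "(\<lambda>e. e k) \<in> ?M2 \<rightarrow>\<^sub>M N" by (rule measurable_component_singleton) simp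
  have meas: "?F \<in> borel_measurable (?M1 \<Otimes>\<^sub>M ?M2)"
    using measurable_compose[OF measurable_compose[OF measurable_Pair[OF
          measurable_compose[OF measurable_fst run_meas] measurable_compose[OF measurable_snd now_meas]]
        advance_measurable_pair], of f borel]
    by (simp add: split_def)
  have sets_eq: "sets (?L \<Otimes>\<^sub>M ?R) = sets (?M1 \<Otimes>\<^sub>M ?M2)"
    by (intro sets_pair_measure_cong) auto
  have int: "integrable (?L \<Otimes>\<^sub>M ?R) ?F"
    by (rule LR.integrable_const_bound[of _ B])
       (use bd meas in \<open>auto simp: measurable_cong_sets[OF sets_eq refl] split_def\<close>)
  have inner: "(\<integral>e. f (advance u (e k)) \<partial>?R) = transition f u" for u
  proof -
    have adv: "(\<lambda>d. f (advance u d)) \<in> borel_measurable N"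
      by (rule measurable_compose[OF advance_measurable]) simp
    have "(\<integral>e. f (advance u (e k)) \<partial>?R) = expectation (\<lambda>\<omega>. f (advance u (input k \<omega>)))"
      by (subst integral_distr[OF now measurable_compose[OF now_meas adv]]) simp
    also have "\<dots> = integral\<^sup>L (distr \<Omega> N (input k)) (\<lambda>d. f (advance u d))"
      by (rule integral_distr[OF input_measurable adv, symmetric])
    finally show ?thesis unfolding transition_def input_law .
  qed
  have trans_meas: "(\<lambda>d. transition f (run y d k)) \<in> borel_measurable ?M1"
    by (rule measurable_compose[OF run_meas]) simp
  have "expectation (\<lambda>\<omega>. f (run y (\<lambda>j. input j \<omega>) (Suc k))) =
      expectation (\<lambda>\<omega>. ?F (?past \<omega>, ?now \<omega>))"
    by (simp add: run_simps run_restrict)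
  also have "\<dots> = integral\<^sup>L (distr \<Omega> (?M1 \<Otimes>\<^sub>M ?M2) (\<lambda>\<omega>. (?past \<omega>, ?now \<omega>))) ?F"
    by (rule integral_distr[symmetric, OF measurable_Pair[OF past now] meas])
  also have "\<dots> = (\<integral>d. transition f (run y d k) \<partial>?L)"
    unfolding joint using LR.integral_fst'[OF int] by (simp add: inner)
  also have "\<dots> = expectation (\<lambda>\<omega>. transition f (run y (?past \<omega>) k))"
    by (rule integral_distr[OF past trans_meas])
  finally show ?thesis by (simp add: run_restrict)
qed

text \<open>Conditioning on the starting state, which is independent of all inputs.\<close>

lemma run_expectation:
  fixes f :: "nat ^ 'n \<Rightarrow> real"
  assumes bd: "\<And>y. \<bar>f y\<bar> \<le> B"
  shows "expectation (\<lambda>\<omega>. f (run (x \<omega>) (\<lambda>j. input j \<omega>) k)) =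
    (\<integral>y. expectation (\<lambda>\<omega>. f (run y (\<lambda>j. input j \<omega>) k)) \<partial>distr \<Omega> (count_space UNIV) x)"
proof -
  let ?X = "distr \<Omega> (count_space UNIV) x" and ?I = "distr \<Omega> inputs_space (\<lambda>\<omega> k. input k \<omega>)"
  interpret X: prob_space ?X by (rule prob_space_distr[OF start_measurable])
  interpret I: prob_space ?I by (rule prob_space_distr[OF inputs_measurable])
  interpret XI: pair_prob_space ?X ?I ..
  have meas: "(\<lambda>(y, d). f (run y d k)) \<in> borel_measurable (count_space UNIV \<Otimes>\<^sub>M inputs_space)"
    using measurable_compose[OF run_measurable_pair, of f borel] by (simp add: split_def)
  have sets_eq: "sets (?X \<Otimes>\<^sub>M ?I) = sets (count_space UNIV \<Otimes>\<^sub>M inputs_space)"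
    by (intro sets_pair_measure_cong) auto
  have int: "integrable (?X \<Otimes>\<^sub>M ?I) (\<lambda>(y, d). f (run y d k))"
    by (rule XI.integrable_const_bound[of _ B])
       (use bd meas in \<open>auto simp: measurable_cong_sets[OF sets_eq refl] split_def\<close>)
  have "expectation (\<lambda>\<omega>. f (run (x \<omega>) (\<lambda>j. input j \<omega>) k)) =
      integral\<^sup>L \<Omega> (\<lambda>\<omega>. (\<lambda>(y, d). f (run y d k)) (x \<omega>, \<lambda>j. input j \<omega>))" by simp
  also have "\<dots> = integral\<^sup>L (?X \<Otimes>\<^sub>M ?I) (\<lambda>(y, d). f (run y d k))"
    unfolding start_independent[symmetric]
    by (rule integral_distr[symmetric, OF measurable_Pair[OF start_measurable inputs_measurable] meas])
  also have "\<dots> = (\<integral>y. (\<integral>d. f (run y d k) \<partial>?I) \<partial>?X)"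
    using XI.integral_fst'[OF int] by simp
  also have "(\<lambda>y. \<integral>d. f (run y d k) \<partial>?I) = (\<lambda>y. expectation (\<lambda>\<omega>. f (run y (\<lambda>j. input j \<omega>) k)))"
  proof
    fix y
    have "(\<lambda>d. f (run y d k)) \<in> borel_measurable inputs_space"
      by (rule measurable_compose[OF run_measurable]) auto
    then show "(\<integral>d. f (run y d k) \<partial>?I) = expectation (\<lambda>\<omega>. f (run y (\<lambda>j. input j \<omega>) k))"
      by (rule integral_distr[OF inputs_measurable])
  qed
  finally show ?thesis .
qed

lemma markov_property:
  fixes f :: "nat ^ 'n \<Rightarrow> real"
  assumes bd: "\<And>y. \<bar>f y\<bar> \<le> B"
  shows "expectation (\<lambda>\<omega>. f (run (x \<omega>) (\<lambda>j. input j \<omega>) (Suc k))) =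
    expectation (\<lambda>\<omega>. transition f (run (x \<omega>) (\<lambda>j. input j \<omega>) k))"
  unfolding run_expectation[of f B "Suc k", OF bd]
    run_expectation[of "transition f" B k, OF transition_bound[OF bd]]
    transition_fixed_start[of f B, OF bd] ..

definition slot_law :: "nat ^ 'n \<Rightarrow> ((nat ^ 'n) \<times> 'm \<times> (nat ^ 'n)) pmf" where
  "slot_law y = law_pmf slot (slot_outcome y)"

definition arrival_law :: "(nat ^ 'n) pmf" where "arrival_law = law_pmf \<Omega> (a 1)"

lemma slot_outcome_measurable_slot: "slot_outcome y \<in> slot \<rightarrow>\<^sub>M count_space UNIV"
  unfolding measurable_cong_sets[OF sets_slot refl] by (rule slot_outcome_measurable)

lemma transition_slot_law:
  "transition f y = measure_pmf.expectation (slot_law y) (\<lambda>z. f (next_queue y (fst z) (snd (snd z))))"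
  unfolding slot_law_def expectation_law_pmf[OF prob_space_slot slot_outcome_measurable_slot]
    transition_def advance_outcome ..

text \<open>Pass to the limit in the Markov property for the indicator of a state. Its image under the
  transition operator is again a bounded function on the lattice.\<close>

lemma stationary_of_limit:
  assumes conv: "converges_in_distribution \<Omega>
    (\<lambda>k \<omega>. queue \<sigma> (\<lambda>j. a j \<omega>) (\<lambda>j. m j \<omega>) (\<lambda>j. r j \<omega>) (x \<omega>) k) \<pi>"
  shows "bind_pmf \<pi> (\<lambda>y. map_pmf (\<lambda>z. next_queue y (fst z) (snd (snd z))) (slot_law y)) = \<pi>"
proof (rule pmf_eqI)
  fix v :: "nat ^ 'n"
  let ?f = "indicator {v} :: nat ^ 'n \<Rightarrow> real"
  let ?K = "\<lambda>y. map_pmf (\<lambda>z. next_queue y (fst z) (snd (snd z))) (slot_law y)"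
  have bd: "\<bar>?f y\<bar> \<le> 1" for y by (simp add: indicator_def)
  have conv': "converges_in_distribution \<Omega> (\<lambda>k \<omega>. run (x \<omega>) (\<lambda>j. input j \<omega>) k) \<pi>"
    using conv by (simp add: run_def)
  have "(\<lambda>k. expectation (\<lambda>\<omega>. ?f (run (x \<omega>) (\<lambda>j. input j \<omega>) (Suc k)))) \<longlonglongrightarrow> measure_pmf.expectation \<pi> ?f"
    by (rule LIMSEQ_Suc) (rule converges_in_distribution_bounded[OF conv' bd])
  then have "(\<lambda>k. expectation (\<lambda>\<omega>. transition ?f (run (x \<omega>) (\<lambda>j. input j \<omega>) k))) \<longlonglongrightarrow> measure_pmf.expectation \<pi> ?f"
    unfolding markov_property[of ?f 1, OF bd] .
  moreover have "(\<lambda>k. expectation (\<lambda>\<omega>. transition ?f (run (x \<omega>) (\<lambda>j. input j \<omega>) k))) \<longlonglongrightarrow>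
      measure_pmf.expectation \<pi> (transition ?f)"
    by (rule converges_in_distribution_bounded[OF conv' transition_bound[OF bd]])
  ultimately have eq: "measure_pmf.expectation \<pi> (transition ?f) = measure_pmf.expectation \<pi> ?f"
    using LIMSEQ_unique by blast
  have ind: "measure_pmf.expectation p ?f = pmf p v" for p by (simp add: measure_pmf_single)
  have "transition ?f = (\<lambda>y. pmf (?K y) v)"
    unfolding ind[symmetric] by (simp only: transition_slot_law integral_map_pmf fun_eq_iff simp_thms)
  then show "pmf (bind_pmf \<pi> ?K) v = pmf \<pi> v"
    using eq by (simp only: pmf_bind ind)
qed

lemma slot_law_support:
  assumes "z \<in> set_pmf (slot_law y)"
  shows "\<exists>\<rho>. snd (snd z) = \<sigma> y (fst (snd z)) \<rho>"
  by (rule law_pmf_support[OF prob_space_slot slot_outcome_measurable_slot _ assms[unfolded slot_law_def]])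
     (auto simp: slot_outcome_def)

lemma slot_law_marginal:
  "map_pmf (\<lambda>z. (fst z, fst (snd z))) (slot_law y) = pair_pmf arrival_law \<psi>"
proof (rule pmf_eqI)
  fix v :: "(nat ^ 'n) \<times> 'm"
  obtain u ch where v: "v = (u, ch)" by (cases v)
  let ?A = "distr \<Omega> (count_space UNIV) (a 1)" and ?R = "distr \<Omega> borel (r 1)"
  interpret R: prob_space ?R by (rule prob_space_distr[OF ties_measurable])
  interpret \<psi>R: pair_prob_space "measure_pmf \<psi>" ?R ..
  have "pmf (map_pmf (\<lambda>z. (fst z, fst (snd z))) (slot_law y)) v =
      measure (measure_pmf (slot_law y)) ((\<lambda>z. (fst z, fst (snd z))) -` {v})"
    by (simp add: pmf_map)
  also have "\<dots> = measure slot (slot_outcome y -` ((\<lambda>z. (fst z, fst (snd z))) -` {v}) \<inter> space slot)"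
    unfolding slot_law_def measure_pmf_law_pmf[OF prob_space_slot slot_outcome_measurable_slot]
    by (rule measure_distr[OF slot_outcome_measurable_slot]) simp
  also have "slot_outcome y -` ((\<lambda>z. (fst z, fst (snd z))) -` {v}) \<inter> space slot = {u} \<times> ({ch} \<times> UNIV)"
    by (auto simp: slot_outcome_def v space_pair_measure)
  also have "measure slot ({u} \<times> ({ch} \<times> UNIV)) = measure ?A {u} * (measure (measure_pmf \<psi>) {ch} * measure ?R UNIV)"
  proof -
    have "emeasure slot ({u} \<times> ({ch} \<times> UNIV)) = emeasure ?A {u} * (emeasure (measure_pmf \<psi>) {ch} * emeasure ?R UNIV)"
      by (subst \<psi>R.emeasure_pair_measure_Times; (subst R.emeasure_pair_measure_Times)?; auto)
    then show ?thesis by (simp add: measure_def enn2real_mult)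
  qed
  also have "measure ?R UNIV = 1" using R.prob_space by simp
  also have "measure ?A {u} = pmf arrival_law u"
    unfolding arrival_law_def measure_pmf_single[symmetric]
      measure_pmf_law_pmf[OF prob_space_\<Omega> arrivals_measurable] ..
  finally show "pmf (map_pmf (\<lambda>z. (fst z, fst (snd z))) (slot_law y)) v = pmf (pair_pmf arrival_law \<psi>) v"
    by (simp add: v pmf_pair measure_pmf_single)
qed

end

section \<open>Heavy-traffic queue lengths\<close>

lemma finite_bounded_nat_vec: "finite {y :: nat ^ 'n. \<forall>i. real (y $ i) \<le> B}"
proof (rule finite_subset)
  show "{y :: nat ^ 'n. \<forall>i. real (y $ i) \<le> B} \<subseteq> vec_lambda ` (UNIV \<rightarrow>\<^sub>E {..nat \<lfloor>B\<rfloor>})"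
  proof
    fix y :: "nat ^ 'n" assume "y \<in> {y. \<forall>i. real (y $ i) \<le> B}"
    then have "($) y \<in> UNIV \<rightarrow>\<^sub>E {..nat \<lfloor>B\<rfloor>}" by (auto simp: le_nat_floor)
    then show "y \<in> vec_lambda ` (UNIV \<rightarrow>\<^sub>E {..nat \<lfloor>B\<rfloor>})" by (metis imageI vec_nth_inverse)
  qed
  show "finite (vec_lambda ` (UNIV \<rightarrow>\<^sub>E {..nat \<lfloor>B\<rfloor>}) :: (nat ^ 'n) set)"
    by (intro finite_imageI finite_PiE) auto
qed

theorem theorem1:
  fixes \<psi> :: "'m::finite pmf"
    and S :: "'m \<Rightarrow> (nat ^ 'n::finite) set"
    and A\<^sub>m\<^sub>a\<^sub>x S\<^sub>m\<^sub>a\<^sub>x :: real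
    and L :: nat and c :: "nat \<Rightarrow> real ^ 'n" and b :: "nat \<Rightarrow> real"
    and \<nu> :: "real ^ 'n" and P P\<^sub>t :: "nat set"
    and \<Omega> :: "real \<Rightarrow> 'w measure"
    and a :: "real \<Rightarrow> nat \<Rightarrow> 'w \<Rightarrow> nat ^ 'n"
    and m :: "real \<Rightarrow> nat \<Rightarrow> 'w \<Rightarrow> 'm"
    and r :: "real \<Rightarrow> nat \<Rightarrow> 'w \<Rightarrow> real"
    and x\<^sub>0 :: "real \<Rightarrow> 'w \<Rightarrow> nat ^ 'n"
    and \<sigma> :: "real \<Rightarrow> nat ^ 'n \<Rightarrow> 'm \<Rightarrow> real \<Rightarrow> nat ^ 'n"
    and q s :: "real \<Rightarrow> nat \<Rightarrow> 'w \<Rightarrow> nat ^ 'n"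
    and qbar :: "real \<Rightarrow> (nat ^ 'n) pmf"
  defines "CR \<equiv> capacity_region \<psi> S"
  defines "P \<equiv> tight_facets CR L c b \<nu>"
  defines "q \<equiv> \<lambda>\<epsilon> k \<omega>. queue (\<sigma> \<epsilon>) (\<lambda>j. a \<epsilon> j \<omega>) (\<lambda>j. m \<epsilon> j \<omega>) (\<lambda>j. r \<epsilon> j \<omega>) (x\<^sub>0 \<epsilon> \<omega>) k"
  defines "s \<equiv> \<lambda>\<epsilon> k \<omega>. \<sigma> \<epsilon> (q \<epsilon> k \<omega>) (m \<epsilon> k \<omega>) (r \<epsilon> k \<omega>)"
  defines "\<Sigma>\<^sub>a \<equiv> \<lambda>\<epsilon> i j. covar (\<Omega> \<epsilon>) (\<lambda>\<omega>. real (a \<epsilon> 1 \<omega> $ i)) (\<lambda>\<omega>. real (a \<epsilon> 1 \<omega> $ j))"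
  defines "\<Sigma>\<^sub>B \<equiv> \<lambda>l l'. covar (measure_pmf \<psi>) (\<lambda>ch. max_rate S c ch l) (\<lambda>ch. max_rate S c ch l')"
  assumes S_finite: "\<And>ch. finite (S ch)" and S_nonempty: "\<And>ch. S ch \<noteq> {}"
    and S_proj: "\<And>ch x i. x \<in> S ch \<Longrightarrow> axis_projection i x \<in> S ch"
    and CR_eq: "CR = {x. (\<forall>i. 0 \<le> x $ i) \<and> (\<forall>l\<in>{1..L}. c l \<bullet> x \<le> b l)}"
    and c_nonneg: "\<And>l i. l \<in> {1..L} \<Longrightarrow> 0 \<le> c l $ i"
    and c_norm: "\<And>l. l \<in> {1..L} \<Longrightarrow> norm (c l) = 1"
    and b_pos: "\<And>l. l \<in> {1..L} \<Longrightarrow> 0 < b l"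
    and \<nu>_boundary: "\<nu> \<in> frontier CR"
    and \<nu>_idle: "idle_queues_not_tight CR L c b \<nu>"
    and P\<^sub>t: "maximal_independent c P P\<^sub>t"
    and inputs: "\<And>\<epsilon>. \<epsilon> \<in> {0<..<1} \<Longrightarrow> switch_inputs (\<Omega> \<epsilon>) \<psi> (a \<epsilon>) (m \<epsilon>) (r \<epsilon>) (x\<^sub>0 \<epsilon>)"
    and mean: "\<And>\<epsilon> i. \<epsilon> \<in> {0<..<1} \<Longrightarrow>
      integral\<^sup>L (\<Omega> \<epsilon>) (\<lambda>\<omega>. real (a \<epsilon> 1 \<omega> $ i)) = (1 - \<epsilon>) * \<nu> $ i"
    and a_bounded: "\<And>\<epsilon>. \<epsilon> \<in> {0<..<1} \<Longrightarrow>
      AE \<omega> in \<Omega> \<epsilon>. \<forall>i. real (a \<epsilon> 1 \<omega> $ i) \<le> A\<^sub>m\<^sub>a\<^sub>x"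
    and s_bounded: "\<And>\<epsilon>. \<epsilon> \<in> {0<..<1} \<Longrightarrow>
      AE \<omega> in \<Omega> \<epsilon>. \<forall>i. real (s \<epsilon> 1 \<omega> $ i) \<le> S\<^sub>m\<^sub>a\<^sub>x"
    and policy: "\<And>\<epsilon>. \<epsilon> \<in> {0<..<1} \<Longrightarrow> maxweight S (\<sigma> \<epsilon>)"
    and recurrent: "\<And>\<epsilon>. \<epsilon> \<in> {0<..<1} \<Longrightarrow>
      positive_recurrent (\<Omega> \<epsilon>) (\<sigma> \<epsilon>) (a \<epsilon>) (m \<epsilon>) (r \<epsilon>) (x\<^sub>0 \<epsilon>)"
    and steady: "\<And>\<epsilon>. \<epsilon> \<in> {0<..<1} \<Longrightarrow> converges_in_distribution (\<Omega> \<epsilon>) (q \<epsilon>) (qbar \<epsilon>)"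
  shows "\<exists>\<epsilon>\<^sub>0 \<beta>. \<epsilon>\<^sub>0 \<in> {0<..<1} \<and>
    (\<forall>\<epsilon>\<in>{0<..<1}. \<epsilon> < \<epsilon>\<^sub>0 \<longrightarrow> (\<forall>w \<in> CR \<inter> (\<Inter>l\<in>P. facet CR c b l).
       integrable (measure_pmf (qbar \<epsilon>)) (\<lambda>x. rvec x \<bullet> w) \<and>
       \<bar>measure_pmf.expectation (qbar \<epsilon>) (\<lambda>x. rvec x \<bullet> w)
          - 1 / (2 * \<epsilon>) * ones_form UNIV (hadamard (projection_matrix P\<^sub>t c) (\<Sigma>\<^sub>a \<epsilon>))
          - 1 / (2 * \<epsilon>) * ones_form P\<^sub>t (hadamard (gram_inverse P\<^sub>t c) \<Sigma>\<^sub>B)\<bar>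
         \<le> \<beta> * ln (1 / \<epsilon>)))"
proof -
  have P_eq: "P = tight_facets (capacity_region \<psi> S) L c b \<nu>" by (simp add: P_def CR_def)
  have "closed {x :: real ^ 'n. (\<forall>i. 0 \<le> x $ i) \<and> (\<forall>l. l \<in> {1..L} \<longrightarrow> c l \<bullet> x \<le> b l)}"
    by (intro closed_Collect_conj closed_Collect_all closed_Collect_imp closed_Collect_le
        continuous_intros open_Collect_const)
  then have "closed CR" unfolding CR_eq Ball_def .
  then have \<nu>_in: "\<nu> \<in> capacity_region \<psi> S"
    using \<nu>_boundary frontier_subset_closed unfolding CR_def by blast
  interpret geo: switch_geometry \<psi> S c b L \<nu> P\<^sub>t
    by unfold_locales
       (use S_finite S_nonempty CR_eq c_nonneg c_norm b_pos \<nu>_in \<nu>_idle P\<^sub>t in \<open>simp_all add: P_eq CR_def\<close>)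
  obtain \<delta>' where \<delta>': "0 < \<delta>'"
    "\<And>q. (\<And>i. 0 \<le> q $ i) \<Longrightarrow> \<exists>z\<in>capacity_region \<psi> S. \<delta>' * geo.cone_dist q \<le> q \<bullet> (z - \<nu>)"
    by (rule geo.drift_direction_exists) blast
  \<comment> \<open>a bound on \<open>\<delta>\<close> keeps the exponent \<open>\<theta>\<close> within the range of the quadratic bound on \<open>exp\<close>\<close>
  define \<delta> where "\<delta> = min \<delta>' 1"
  have \<delta>: "0 < \<delta>" "\<delta> \<le> 1"
    "\<And>q. (\<And>i. 0 \<le> q $ i) \<Longrightarrow> \<exists>z\<in>capacity_region \<psi> S. \<delta> * geo.cone_dist q \<le> q \<bullet> (z - \<nu>)"
  proof -
    show "0 < \<delta>" "\<delta> \<le> 1" using \<delta>' by (auto simp: \<delta>_def)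
    fix q :: "real ^ 'n" assume "\<And>i. 0 \<le> q $ i"
    then obtain z where z: "z \<in> capacity_region \<psi> S" "\<delta>' * geo.cone_dist q \<le> q \<bullet> (z - \<nu>)"
      using \<delta>'(2) by blast
    have "\<delta> * geo.cone_dist q \<le> \<delta>' * geo.cone_dist q"
      using geo.cone_dist_nonneg by (intro mult_right_mono) (auto simp: \<delta>_def)
    then show "\<exists>z\<in>capacity_region \<psi> S. \<delta> * geo.cone_dist q \<le> q \<bullet> (z - \<nu>)"
      using z by (intro bexI[of _ z]) auto
  qed
  obtain \<gamma> where \<gamma>: "0 < \<gamma>"
    "\<And>m s l. s \<in> S m \<Longrightarrow> l \<in> tight_facets (capacity_region \<psi> S) L c b \<nu> \<Longrightarrow>
       c l \<bullet> rvec s \<noteq> best_rate S (c l) m \<Longrightarrow> \<gamma> \<le> best_rate S (c l) m - c l \<bullet> rvec s"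
    "\<And>l u. l \<in> tight_facets (capacity_region \<psi> S) L c b \<nu> \<Longrightarrow>
       c l \<bullet> rvec u \<noteq> 0 \<Longrightarrow> \<gamma> \<le> c l \<bullet> rvec u"
    by (rule geo.positive_loss_bounded_below) blast
  define D where "D = 1 + real CARD('n) * \<bar>A\<^sub>m\<^sub>a\<^sub>x\<bar> + (\<Sum>s\<in>(\<Union>ch. S ch). norm (rvec s))"
  have D_ge: "1 \<le> D" by (simp add: D_def sum_nonneg)
  have D_service: "norm (rvec y) \<le> D" if "y \<in> S ch" for y ch
  proof -
    have "norm (rvec y) \<le> (\<Sum>s\<in>(\<Union>ch. S ch). norm (rvec s))"
      by (rule member_le_sum) (use that S_finite in auto)
    moreover have "0 \<le> real CARD('n) * \<bar>A\<^sub>m\<^sub>a\<^sub>x\<bar>" by simp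
    ultimately show ?thesis unfolding D_def by linarith
  qed
  have D_arrival: "norm (rvec y) \<le> D" if "\<forall>i. real (y $ i) \<le> A\<^sub>m\<^sub>a\<^sub>x" for y :: "nat ^ 'n"
  proof -
    have "norm (rvec y) \<le> (\<Sum>i\<in>UNIV. \<bar>rvec y $ i\<bar>)" by (rule norm_le_l1_cart)
    also have "\<dots> \<le> (\<Sum>i\<in>(UNIV :: 'n set). \<bar>A\<^sub>m\<^sub>a\<^sub>x\<bar>)"
      using that by (intro sum_mono) (auto simp: rvec_def intro: order_trans[OF _ abs_ge_self])
    also have "\<dots> \<le> D" by (simp add: D_def sum_nonneg)
    finally show ?thesis .
  qed
  \<comment> \<open>below \<open>1 / 3\<close> the logarithm is at least \<open>1\<close>; the other bound makes the price of the reduced load small against \<open>\<delta>\<close>\<close>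
  define \<epsilon>\<^sub>0 where "\<epsilon>\<^sub>0 = min (1 / 3) (\<delta> / (2 * (norm \<nu> + 1)))"
  have \<epsilon>\<^sub>0: "\<epsilon>\<^sub>0 \<in> {0<..<1}" using \<delta> by (auto simp: \<epsilon>\<^sub>0_def add_nonneg_pos)
  define \<beta> where "\<beta> = stationary_switch.\<beta> \<psi> S c b L \<nu> D \<delta> \<gamma>"
  show ?thesis
  proof (rule exI[of _ \<epsilon>\<^sub>0], rule exI[of _ \<beta>], intro conjI \<epsilon>\<^sub>0 ballI impI)
    fix \<epsilon> w assume \<epsilon>: "\<epsilon> \<in> {0<..<1}" "\<epsilon> < \<epsilon>\<^sub>0" and w: "w \<in> CR \<inter> (\<Inter>l\<in>P. facet CR c b l)"
    have \<epsilon>_norm: "\<epsilon> * norm \<nu> \<le> \<delta> / 2"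
    proof -
      have "\<epsilon> \<le> \<delta> / (2 * (norm \<nu> + 1))" using \<epsilon>(2) by (simp add: \<epsilon>\<^sub>0_def)
      then have "\<epsilon> * (2 * (norm \<nu> + 1)) \<le> \<delta>" by (subst (asm) pos_le_divide_eq) (auto simp: add_nonneg_pos)
      then show ?thesis using \<epsilon>(1) by (simp add: algebra_simps)
    qed
    interpret sp: switch_process "\<Omega> \<epsilon>" \<psi> "a \<epsilon>" "m \<epsilon>" "r \<epsilon>" "x\<^sub>0 \<epsilon>" "\<sigma> \<epsilon>"
      by unfold_locales (use inputs[OF \<epsilon>(1)] policy[OF \<epsilon>(1)] in \<open>auto simp: maxweight_def\<close>)
    have arrival_expectation: "measure_pmf.expectation sp.arrival_law f = integral\<^sup>L (\<Omega> \<epsilon>) (\<lambda>\<omega>. f (a \<epsilon> 1 \<omega>))"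
      for f :: "nat ^ 'n \<Rightarrow> real"
      unfolding sp.arrival_law_def
      by (rule expectation_law_pmf[OF sp.prob_space_\<Omega> sp.arrivals_measurable])
    have arrival_support: "\<forall>i. real (y $ i) \<le> A\<^sub>m\<^sub>a\<^sub>x" if "y \<in> set_pmf sp.arrival_law" for y
      using law_pmf_support[OF sp.prob_space_\<Omega> sp.arrivals_measurable a_bounded[OF \<epsilon>(1)]] that
      unfolding sp.arrival_law_def by blast
    interpret ss: stationary_switch \<psi> S c b L \<nu> P\<^sub>t \<epsilon> D \<delta> \<gamma> sp.arrival_law "qbar \<epsilon>" sp.slot_law
    proof unfold_locales
      show "0 < \<epsilon>" "\<epsilon> \<le> 1 / 3" using \<epsilon> by (auto simp: \<epsilon>\<^sub>0_def)
      show "finite (set_pmf sp.arrival_law)"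
        by (rule finite_subset[OF _ finite_bounded_nat_vec[of A\<^sub>m\<^sub>a\<^sub>x]]) (use arrival_support in auto)
      show "norm (rvec y) \<le> D" if "y \<in> set_pmf sp.arrival_law" for y
        by (rule D_arrival[OF arrival_support[OF that]])
      show "measure_pmf.expectation sp.arrival_law (\<lambda>x. rvec x $ i) = (1 - \<epsilon>) * \<nu> $ i" for i
        using mean[OF \<epsilon>(1)] by (simp add: arrival_expectation rvec_def)
      show "is_arg_max (\<lambda>y. rvec x \<bullet> rvec y) (\<lambda>y. y \<in> S (fst (snd z))) (snd (snd z))"
        if "z \<in> set_pmf (sp.slot_law x)" for x z
        using sp.slot_law_support[OF that] policy[OF \<epsilon>(1)] by (auto simp: maxweight_def)
      show "bind_pmf (qbar \<epsilon>) (\<lambda>x. map_pmf (\<lambda>z. next_queue x (fst z) (snd (snd z))) (sp.slot_law x)) = qbar \<epsilon>"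
        by (rule sp.stationary_of_limit) (use steady[OF \<epsilon>(1)] in \<open>simp add: q_def\<close>)
    qed (fact \<epsilon>_norm D_ge D_service \<delta> \<gamma> sp.slot_law_marginal)+
    have w': "w \<in> capacity_region \<psi> S"
      "\<And>l. l \<in> tight_facets (capacity_region \<psi> S) L c b \<nu> \<Longrightarrow> c l \<bullet> w = b l"
      using w by (auto simp: P_eq CR_def facet_def)
    show "integrable (measure_pmf (qbar \<epsilon>)) (\<lambda>x. rvec x \<bullet> w)"
      by (rule ss.heavy_traffic_bound(1)[OF w'])
    have "covar (measure_pmf sp.arrival_law) (\<lambda>a. rvec a $ i) (\<lambda>a. rvec a $ j) = \<Sigma>\<^sub>a \<epsilon> i j" for i j
      by (simp add: covar_def arrival_expectation \<Sigma>\<^sub>a_def rvec_def)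
    moreover have "covar (measure_pmf \<psi>) (\<lambda>m. best_rate S (c l) m) (\<lambda>m. best_rate S (c l') m) = \<Sigma>\<^sub>B l l'" for l l'
      by (simp add: \<Sigma>\<^sub>B_def max_rate_eq_best_rate)
    ultimately have noise: "ss.noise = ones_form UNIV (hadamard (projection_matrix P\<^sub>t c) (\<Sigma>\<^sub>a \<epsilon>))
        + ones_form P\<^sub>t (hadamard (gram_inverse P\<^sub>t c) \<Sigma>\<^sub>B)"
      by (simp add: ss.noise_def)
    show "\<bar>measure_pmf.expectation (qbar \<epsilon>) (\<lambda>x. rvec x \<bullet> w)
          - 1 / (2 * \<epsilon>) * ones_form UNIV (hadamard (projection_matrix P\<^sub>t c) (\<Sigma>\<^sub>a \<epsilon>))
          - 1 / (2 * \<epsilon>) * ones_form P\<^sub>t (hadamard (gram_inverse P\<^sub>t c) \<Sigma>\<^sub>B)\<bar>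
         \<le> \<beta> * ln (1 / \<epsilon>)"
      using ss.heavy_traffic_bound(2)[OF w'] by (simp add: noise \<beta>_def add_divide_distrib diff_diff_eq)
  qed
qed

end
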